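(* Let $E/k$ be a finite field extension that is potentially Galois over an overfield $L$ of $k$. Let $\widehat E$ be the Galois closure of $E$ over $k$, and set $\Gamma=\mathrm{Gal}(\widehat E/k)$ and $\Gamma_E=\mathrm{Gal}(\widehat E/E)$. Let $\mathbb G(L)=\mathrm{res}(\mathrm{Gal}(EL/L))\subset\Gamma$, let $\mathrm{Subgp}_\Gamma(\mathbb G(L))$ be the set of subgroups $H\subset\mathbb G(L)$ such that the product set $H\Gamma_E=\{hg\mid h\in H,g\in\Gamma_E\}$ is a subgroup of $\Gamma$, and let $\mathrm{Subfld}_k(E)$ be the set of subfields of $E$ containing $k$. Define $$\varepsilon_L:\mathrm{Subgp}_\Gamma(\mathbb G(L))\to\mathrm{Subfld}_k(E),\quad \varepsilon_L(H)=E^H:=E\cap\widehat E^H,$$ $$\eta_L:\mathrm{Subfld}_k(E)\to\mathrm{Subgp}_\Gamma(\mathbb G(L)),\quad \eta_L(E')=\mathrm{res}(\mathrm{Gal}(EL/E'L)).$$ Then $\varepsilon_L$ and $\eta_L$ define a bijective correspondence between the set of subgroups $\mathrm{Subgp}_\Gamma(\mathbb G(L))$ and the set of subfields $\mathrm{Subfld}_k(E)$. More precisely, for every $E'\in\mathrm{Subfld}_k(E)$ and every $H\in\mathrm{Subgp}_\Gamma(\mathbb G(L))$: - $\varepsilon_L(H)=E^H$ is a sub-extension of $E/k$ with $[E:E^H]=|H|$; - $\eta_L(E')=\mathrm{res}(\mathrm{Gal}(EL/E'L))$ is a subgroup of $\mathbb G(L)$ such that $\eta_L(E')\,\Gamma_E$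 is a subgroup of $\Gamma$, and $\eta_L(E')$ is of order $[E:E']$; - $\varepsilon_L\circ\eta_L(E')=E'$ and $\eta_L\circ\varepsilon_L(H)=H$. Furthermore, if $L/k$ is Galois and $H$ is a characteristic subgroup of $\mathbb G(L)$, then $H\Gamma_E$ is a subgroup of $\Gamma$ and the extension $E^H/k$ (with $E^H=E\cap\widehat E^H$) is pre-Galois over $L$, of group $\mathbb G(L)/H$.
   Context: For a finite field extension $E/k$ and an overfield $L$ of $k$ (not necessarily algebraic), $E/k$ is potentially Galois over $L$ with group $G$ if $E\otimes_kL$ is a Galois field extension of $L$ with Galois group $G$; equivalently, after embedding $E$ in a separable closure of $L$ as a $k$-algebra, $EL/L$ is Galois of degree $[E:k]$ with group $G$. If moreover $L/k$ is Galois (not necessarily finite), $E/k$ is called pre-Galois over $L$ with group $G$. If $E/k$ is potentially Galois over $L$ then $E/k$ is separable and $\widehat E\subset EL$; $\mathrm{res}:\mathrm{Gal}(EL/L)\to\Gamma=\mathrm{Gal}(\widehat E/k)$ denotes the restriction map, which is injective. $\widehat E^H$ is the fixed field of $H$ in $\widehat E$. *)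

theory Defs
  imports "HOL-Algebra.Algebra"
begin

text \<open>
  All fields are subfields of one ambient field \<open>R\<close>, so that composita, Galois closures and
  restriction maps make sense. In the main statement \<open>R\<close> is a separable closure of the overfield
  \<open>L\<close>, and \<open>E\<close> is identified with its image in it.
\<close>

text \<open>Root multiplicities are taken in an algebraic closure of \<open>R\<close>, which contains an algebraic
  closure of every subfield of \<open>R\<close>. So for \<open>p\<close> with coefficients in a subfield \<open>K\<close> this says
  that \<open>p\<close> has no multiple root in an algebraic closure of \<open>K\<close>.\<close>

definition separable_poly :: "('a, 'b) ring_scheme \<Rightarrow> 'a list \<Rightarrow> bool" where
  "separable_poly R p \<longleftrightarrow>
     p \<noteq> [] \<and>
     (\<forall>x \<in> carrier (field.alg_closure R).
        ring.alg_mult (field.alg_closure R) (map (ring.indexed_const R) p) x \<le> 1)"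

definition separable_extension :: "('a, 'b) ring_scheme \<Rightarrow> 'a set \<Rightarrow> 'a set \<Rightarrow> bool" where
  "separable_extension R K M \<longleftrightarrow>
     (\<forall>x \<in> M. ring.algebraic R K x \<and> separable_poly R (ring.Irr R K x))"

definition normal_extension :: "('a, 'b) ring_scheme \<Rightarrow> 'a set \<Rightarrow> 'a set \<Rightarrow> bool" where
  "normal_extension R K M \<longleftrightarrow>
     (\<forall>x \<in> M. ring.algebraic R K x) \<and>
     (\<forall>p \<in> carrier (K[X]\<^bsub>R\<^esub>).
        pirreducible\<^bsub>R\<^esub> K p \<and> (\<exists>x \<in> M. ring.eval R p x = \<zero>\<^bsub>R\<^esub>)
          \<longrightarrow> ring.splitted (R\<lparr>carrier := M\<rparr>) p)"

text \<open>Not necessarily finite.\<close>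

definition galois_extension :: "('a, 'b) ring_scheme \<Rightarrow> 'a set \<Rightarrow> 'a set \<Rightarrow> bool" where
  "galois_extension R K M \<longleftrightarrow>
     subfield K R \<and> subfield M R \<and> K \<subseteq> M \<and>
     normal_extension R K M \<and> separable_extension R K M"

definition is_separable_closure :: "('a, 'b) ring_scheme \<Rightarrow> 'a set \<Rightarrow> bool" where
  "is_separable_closure R L \<longleftrightarrow>
     subfield L R \<and>
     separable_extension R L (carrier R) \<and>
     (\<forall>p \<in> carrier (poly_ring R).
        separable_poly R p \<and> degree p > 0 \<longrightarrow> (\<exists>x \<in> carrier R. ring.eval R p x = \<zero>\<^bsub>R\<^esub>))"

definition galois_group ::
  "('a, 'b) ring_scheme \<Rightarrow> 'a set \<Rightarrow> 'a set \<Rightarrow> ('a \<Rightarrow> 'a) monoid" where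
  "galois_group R M K =
     (BijGroup M)\<lparr>carrier :=
        {s \<in> Bij M. s \<in> ring_hom (R\<lparr>carrier := M\<rparr>) (R\<lparr>carrier := M\<rparr>) \<and> (\<forall>x \<in> K. s x = x)}\<rparr>"

definition compositum :: "('a, 'b) ring_scheme \<Rightarrow> 'a set \<Rightarrow> 'a set \<Rightarrow> 'a set" where
  "compositum R A B = generate_field R (A \<union> B)"

text \<open>The intersection is over a nonempty family when \<open>E/k\<close> is finite separable and \<open>R\<close> is
  separably closed, and then it is the least Galois extension of \<open>k\<close> containing \<open>E\<close>.\<close>

definition galois_closure :: "('a, 'b) ring_scheme \<Rightarrow> 'a set \<Rightarrow> 'a set \<Rightarrow> 'a set" where
  "galois_closure R k E = \<Inter>{M. E \<subseteq> M \<and> galois_extension R k M}"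

text \<open>This is meant for \<open>E\<close> inside a separable closure \<open>R\<close> of \<open>L\<close>: \<open>E/k\<close> is finite and
  \<open>EL/L\<close> is Galois of degree \<open>[E:k]\<close>. The equality of degrees says that the canonical map
  from \<open>E \<otimes>\<^sub>k L\<close> onto \<open>EL\<close> is an isomorphism.\<close>

definition potentially_galois ::
  "('a, 'b) ring_scheme \<Rightarrow> 'a set \<Rightarrow> 'a set \<Rightarrow> 'a set \<Rightarrow> bool" where
  "potentially_galois R k E L \<longleftrightarrow>
     subfield k R \<and> subfield E R \<and> subfield L R \<and> k \<subseteq> E \<and> k \<subseteq> L \<and>
     galois_extension R L (compositum R E L) \<and>
     (\<exists>n. ring.dimension R n k E \<and> ring.dimension R n L (compositum R E L))"

definition potentially_galois_with_group ::
  "('a, 'b) ring_scheme \<Rightarrow> 'a set \<Rightarrow> 'a set \<Rightarrow> 'a set \<Rightarrow> ('c, 'd) monoid_scheme \<Rightarrow> bool" where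
  "potentially_galois_with_group R k E L G \<longleftrightarrow>
     potentially_galois R k E L \<and> galois_group R (compositum R E L) L \<cong> G"

definition pre_galois_with_group ::
  "('a, 'b) ring_scheme \<Rightarrow> 'a set \<Rightarrow> 'a set \<Rightarrow> 'a set \<Rightarrow> ('c, 'd) monoid_scheme \<Rightarrow> bool" where
  "pre_galois_with_group R k E L G \<longleftrightarrow>
     potentially_galois_with_group R k E L G \<and> galois_extension R k L"

definition characteristic_subgroup :: "'a set \<Rightarrow> ('a, 'b) monoid_scheme \<Rightarrow> bool" where
  "characteristic_subgroup H G \<longleftrightarrow> subgroup H G \<and> (\<forall>f \<in> auto G. f ` H = H)"

text \<open>Below, \<open>Gam\<close> is the group \<open>\<Gamma>\<close>, \<open>Gam_E\<close> its subset \<open>\<Gamma>\<^sub>E\<close> (maps defined on the Galois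
  closure of \<open>E/k\<close> and fixing \<open>E\<close>), and \<open>GL\<close> is the image of \<open>Gal(EL/L)\<close> under restriction,
  with the group structure of \<open>\<Gamma>\<close>. Elements of Galois groups are extensional functions, so
  equality of automorphisms is equality of functions.\<close>

definition Gam :: "('a, 'b) ring_scheme \<Rightarrow> 'a set \<Rightarrow> 'a set \<Rightarrow> ('a \<Rightarrow> 'a) monoid" where
  "Gam R k E = galois_group R (galois_closure R k E) k"

definition Gam_E :: "('a, 'b) ring_scheme \<Rightarrow> 'a set \<Rightarrow> 'a set \<Rightarrow> ('a \<Rightarrow> 'a) set" where
  "Gam_E R k E = carrier (galois_group R (galois_closure R k E) E)"

definition res :: "('a, 'b) ring_scheme \<Rightarrow> 'a set \<Rightarrow> 'a set \<Rightarrow> ('a \<Rightarrow> 'a) \<Rightarrow> ('a \<Rightarrow> 'a)" where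
  "res R k E s = restrict s (galois_closure R k E)"

definition GL :: "('a, 'b) ring_scheme \<Rightarrow> 'a set \<Rightarrow> 'a set \<Rightarrow> 'a set \<Rightarrow> ('a \<Rightarrow> 'a) monoid" where
  "GL R k E L =
     (Gam R k E)\<lparr>carrier := res R k E ` carrier (galois_group R (compositum R E L) L)\<rparr>"

definition Subgp ::
  "('a, 'b) ring_scheme \<Rightarrow> 'a set \<Rightarrow> 'a set \<Rightarrow> 'a set \<Rightarrow> ('a \<Rightarrow> 'a) set set" where
  "Subgp R k E L =
     {H. subgroup H (GL R k E L) \<and> subgroup (H <#>\<^bsub>Gam R k E\<^esub> Gam_E R k E) (Gam R k E)}"

definition Subfld :: "('a, 'b) ring_scheme \<Rightarrow> 'a set \<Rightarrow> 'a set \<Rightarrow> 'a set set" where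
  "Subfld R k E = {F. subfield F R \<and> k \<subseteq> F \<and> F \<subseteq> E}"

definition eps ::
  "('a, 'b) ring_scheme \<Rightarrow> 'a set \<Rightarrow> 'a set \<Rightarrow> ('a \<Rightarrow> 'a) set \<Rightarrow> 'a set" where
  "eps R k E H = E \<inter> {x \<in> galois_closure R k E. \<forall>h \<in> H. h x = x}"

definition eta ::
  "('a, 'b) ring_scheme \<Rightarrow> 'a set \<Rightarrow> 'a set \<Rightarrow> 'a set \<Rightarrow> 'a set \<Rightarrow> ('a \<Rightarrow> 'a) set" where
  "eta R k E L F =
     res R k E ` carrier (galois_group R (compositum R E L) (compositum R F L))"

end

theory Submission
  imports Defs
begin

text \<open>
  Put \<open>N = EL\<close>. Since \<open>[N:L] = [E:k]\<close>, also \<open>[N:FL] = [E:F]\<close> and \<open>E \<inter> FL = F\<close> for every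
  intermediate field \<open>F\<close> of \<open>E/k\<close>, and the minimal polynomials over \<open>k\<close> of the elements of \<open>E\<close>
  split in \<open>N\<close> with simple roots; so the Galois closure lies in \<open>N\<close>.
  By Dedekind there are at most \<open>[E:F]\<close> embeddings of \<open>E\<close> into \<open>N\<close> over \<open>F\<close>, and \<open>Gal(N/FL)\<close>
  already provides that many. Hence an element of \<open>\<Gamma>\<close> fixing \<open>F\<close> differs from an element of
  \<open>\<eta>(F)\<close> by one of \<open>\<Gamma>\<^sub>E\<close>, that is \<open>\<eta>(F) \<Gamma>\<^sub>E = Gal(Eh/F)\<close> with \<open>Eh\<close> the Galois closure.
  Conversely, if \<open>H \<Gamma>\<^sub>E\<close> is a group then it permutes the embeddings of \<open>E\<close> given by \<open>H\<close>, and
  Artin's argument, applied to these embeddings instead of a full group, gives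
  \<open>[E : E\<^sup>H] \<le> |H|\<close>; comparing orders yields \<open>H = \<eta>(E\<^sup>H)\<close>.
\<close>

section \<open>Polynomials with simple roots\<close>

text \<open>Being Galois is handled through one counting condition, \<open>simply_split\<close>: a
  polynomial has as many distinct zeros in a field as its degree. Multiplicities in an algebraic
  closure occur only where this is matched with the definition of separability. Counting replaces
  primitive elements: fields are compared by degrees, groups by orders. The condition on
  \<open>H Gam_E\<close> has the following origin. The group generated by \<open>H\<close> and
  \<open>Gam_E\<close> always has fixed field \<open>E^H\<close>, but Artin's argument bounds
  \<open>[E:E^H]\<close> by the number of ways in which that group moves \<open>E\<close>. This
  number is the order of \<open>H\<close> exactly when the group is no larger than the product set.
  For characteristic \<open>H\<close> and Galois \<open>L/k\<close>, the group \<open>GL\<close> is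
  normal in \<open>Gam\<close>, so \<open>H\<close> is normal as well. This normality serves twice:
  it makes \<open>H Gam_E\<close> a group, and it makes the compositum of \<open>E^H\<close> and
  \<open>L\<close> stable under \<open>Gal(EL/L)\<close>, which yields the quotient by
  \<open>H\<close> as Galois group.\<close>

definition (in ring) zeros_in :: "'a set \<Rightarrow> 'a list \<Rightarrow> 'a set"
  where "zeros_in M p = {x \<in> M. eval p x = \<zero>}"

text \<open>Splitting in \<open>M\<close> with simple roots, expressed by a number instead of
  multiplicities. The clause \<open>p \<noteq> []\<close> matters: the zero polynomial has degree 0,
  and \<open>card\<close> of an infinite zero set is 0 as well.\<close>

definition (in ring) simply_split :: "'a set \<Rightarrow> 'a list \<Rightarrow> bool"
  where "simply_split M p \<longleftrightarrow> p \<noteq> [] \<and> card (zeros_in M p) = degree p"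

lemma (in ring) polynomial_in_carrierD:
  assumes "subring K R" "p \<in> carrier (K[X])"
  shows "set p \<subseteq> K" "set p \<subseteq> carrier R"
  using assms polynomial_incl[of K p] subringE(1)[OF assms(1)] by (auto simp: univ_poly_carrier)

lemma (in ring) polynomial_mono:
  assumes "K \<subseteq> K'" "p \<in> carrier (K[X])"
  shows "p \<in> carrier (K'[X])"
  using assms unfolding sym[OF univ_poly_carrier] polynomial_def by auto

lemma (in field) zeros_in_bound:
  assumes "p \<in> carrier (poly_ring R)" "p \<noteq> []" "M \<subseteq> carrier R"
  shows "finite (zeros_in M p)" "card (zeros_in M p) \<le> degree p"
proof -
  have eq: "{x. is_root p x} = set_mset (roots p)"
    using roots_mem_iff_is_root[OF assms(1)] by auto
  have sub: "zeros_in M p \<subseteq> set_mset (roots p)"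
    using assms unfolding eq[symmetric] zeros_in_def is_root_def by auto
  show "finite (zeros_in M p)" by (rule finite_subset[OF sub]) simp
  have "card (zeros_in M p) \<le> card (set_mset (roots p))"
    by (rule card_mono[OF _ sub]) simp
  also have "\<dots> \<le> size (roots p)"
    by (metis mset_set_set_mset_msubset size_mset_mono size_mset_set)
  also have "\<dots> \<le> degree p" by (rule size_roots_le_degree[OF assms(1)])
  finally show "card (zeros_in M p) \<le> degree p" .
qed

text \<open>The root bound is already exhausted inside \<open>M\<close>. This is how conjugates of
  an element are kept inside a normal extension, however large the surrounding field is.\<close>

lemma (in field) simply_split_zeros_eq:
  assumes "p \<in> carrier (poly_ring R)" "simply_split M p" "M \<subseteq> M'" "M' \<subseteq> carrier R"
  shows "zeros_in M' p = zeros_in M p"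
proof -
  have "zeros_in M p \<subseteq> zeros_in M' p" using assms(3) by (auto simp: zeros_in_def)
  moreover have "finite (zeros_in M' p)" "card (zeros_in M' p) \<le> degree p"
    using zeros_in_bound[OF assms(1) _ assms(4)] assms(2) by (auto simp: simply_split_def)
  ultimately show ?thesis
    using assms(2) by (metis card_seteq simply_split_def)
qed

text \<open>Every zero of \<open>p = q r\<close> is a zero of \<open>q\<close> or of
  \<open>r\<close>, and each factor has at most as many zeros as its degree. As the degrees add up
  to the number of zeros of \<open>p\<close>, both bounds are attained.\<close>

lemma (in field) simply_split_pdivides:
  assumes "p \<in> carrier (poly_ring R)" "q \<in> carrier (poly_ring R)" "M \<subseteq> carrier R"
    and "q pdivides p" "simply_split M p"
  shows "simply_split M q"
proof -
  obtain r where r: "r \<in> carrier (poly_ring R)" "p = q \<otimes>\<^bsub>poly_ring R\<^esub> r"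
    using assms(4) unfolding pdivides_def by auto
  interpret UP: domain "poly_ring R"
    using univ_poly_is_domain[OF carrier_is_subring] .
  have pn: "p \<noteq> []" using assms(5) by (simp add: simply_split_def)
  then have nn: "q \<noteq> []" "r \<noteq> []"
    using r assms(2) UP.integral_iff unfolding sym[OF univ_poly_zero[of R "carrier R"]] by auto
  have deg: "degree p = degree q + degree r"
    using poly_mult_degree_eq[OF carrier_is_subring, of q r] assms(2) r nn
    unfolding univ_poly_carrier by (simp add: univ_poly_mult)
  have "eval p x = eval q x \<otimes> eval r x" if "x \<in> carrier R" for x
    using ring_hom_mult[OF eval_is_hom[OF carrier_is_subring that] assms(2) r(1)] r(2) by simp
  moreover have "eval q x \<in> carrier R" "eval r x \<in> carrier R" if "x \<in> carrier R" for x
    using eval_in_carrier[OF polynomial_in_carrierD(2)[OF carrier_is_subring] that] assms(2) r(1)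
    by auto
  ultimately have sub: "zeros_in M p \<subseteq> zeros_in M q \<union> zeros_in M r"
    using assms(3) unfolding zeros_in_def
    by (smt (verit) Un_iff integral_iff mem_Collect_eq subset_iff)
  note q = zeros_in_bound[OF assms(2) nn(1) assms(3)]
  note r = zeros_in_bound[OF r(1) nn(2) assms(3)]
  have "card (zeros_in M p) \<le> card (zeros_in M q) + card (zeros_in M r)"
    using card_mono[OF _ sub] card_Un_le[of "zeros_in M q" "zeros_in M r"] q r by force
  with q r deg assms(5) nn show ?thesis by (auto simp: simply_split_def)
qed

lemma (in field) alg_closure_props:
  shows "field alg_closure" "indexed_const \<in> ring_hom R alg_closure"
    "ring_hom_ring R alg_closure indexed_const"
    "inj_on indexed_const (carrier R)"
proof -
  show f: "field alg_closure" using alg_closureE(1) by (simp add: algebraic_closure_def)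
  show h: "indexed_const \<in> ring_hom R alg_closure" by (rule alg_closureE(2))
  show "ring_hom_ring R alg_closure indexed_const"
    by (rule ring_hom_ringI2[OF ring_axioms field.is_ring[OF f] h])
  show "inj_on indexed_const (carrier R)" by (rule indexed_const_inj_on)
qed

lemma count_le_1_if_size_le_card:
  assumes "size m \<le> card A" "A \<subseteq> set_mset m"
  shows "count m x \<le> 1"
proof -
  have fA: "finite A" using assms(2) finite_subset by blast
  have sub: "mset_set A \<subseteq># m"
    using assms(2) by (metis finite_set_mset fA mset_set_set_mset_msubset subset_imp_msubset_mset_set
        subset_mset.order_trans)
  have "m = mset_set A"
  proof (rule ccontr)
    assume "m \<noteq> mset_set A"
    then have "mset_set A \<subset># m" using sub by auto
    then have "size (mset_set A) < size m" by (rule mset_subset_size)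
    then show False using assms(1) by simp
  qed
  then show ?thesis by (simp add: count_mset_set')
qed

text \<open>The embedding into the algebraic closure is injective, so the zeros in \<open>M\<close>
  yield \<open>degree p\<close> different roots there, and no root can be repeated.\<close>

lemma (in field) simply_split_imp_separable:
  assumes p: "p \<in> carrier (poly_ring R)" and "M \<subseteq> carrier R" "simply_split M p"
  shows "separable_poly R p"
proof -
  interpret A: field alg_closure by (rule alg_closure_props)
  interpret H: ring_hom_ring R alg_closure indexed_const by (rule alg_closure_props)
  let ?c = "indexed_const :: 'a \<Rightarrow> ('a list \<times> nat) multiset \<Rightarrow> 'a"
  let ?q = "map ?c p"
  have pn: "p \<noteq> []" using assms(3) by (simp add: simply_split_def)
  have q: "?q \<in> carrier (poly_ring alg_closure)"
    by (rule polynomial_hom[OF alg_closure_props(2) field_axioms A.field_axioms p])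
  have "A.is_root ?q (?c x)" if "x \<in> zeros_in M p" for x
    using that assms(2) pn H.eval_hom'[of x p] polynomial_in_carrierD(2)[OF carrier_is_subring p]
    by (auto simp: zeros_in_def A.is_root_def)
  then have sub: "?c ` zeros_in M p \<subseteq> set_mset (A.roots ?q)"
    using A.roots_mem_iff_is_root[OF q] by blast
  have "card (?c ` zeros_in M p) = card (zeros_in M p)"
    by (rule card_image, rule inj_on_subset[OF alg_closure_props(4)])
      (use assms(2) in \<open>auto simp: zeros_in_def\<close>)
  also have "\<dots> = degree ?q" using assms(3) by (simp add: simply_split_def)
  finally have "size (A.roots ?q) \<le> card (?c ` zeros_in M p)"
    using A.size_roots_le_degree[OF q] by linarith
  from count_le_1_if_size_le_card[OF this sub]
  show ?thesis
    unfolding separable_poly_def using pn A.alg_mult_eq_count_roots[OF q] by simp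
qed

lemma (in field) simply_split_imp_splitted:
  assumes M: "subfield M R" and p: "p \<in> carrier (M[X])" and s: "simply_split M p"
  shows "ring.splitted (R\<lparr>carrier := M\<rparr>) p"
proof -
  interpret M: field "R\<lparr>carrier := M\<rparr>" by (rule subfield_iff(2)[OF M])
  note c = univ_poly_consistent[OF subfieldE(1)[OF M]] eval_consistent[OF subfieldE(1)[OF M]]
  have p': "p \<in> carrier (poly_ring (R\<lparr>carrier := M\<rparr>))" using p c by simp
  have "set_mset (M.roots p) = zeros_in M p"
    using M.roots_mem_iff_is_root[OF p'] s
    by (auto simp: M.is_root_def zeros_in_def simply_split_def c(2))
  then have "degree p \<le> size (M.roots p)"
    using s unfolding simply_split_def
    by (metis mset_set_set_mset_msubset size_mset_mono size_mset_set)
  with M.size_roots_le_degree[OF p'] show ?thesis unfolding M.splitted_def by simp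
qed

text \<open>A repeated root \<open>x\<close> in \<open>M\<close> makes \<open>(X - x)^2\<close>
  divide \<open>p\<close> over \<open>M\<close>; mapping this factorisation into the algebraic
  closure gives a double root there, against separability. So the \<open>degree p\<close> roots,
  counted with multiplicity, are distinct.\<close>

lemma (in field) separable_splitted_imp_simply_split:
  assumes M: "subfield M R" and p: "p \<in> carrier (M[X])"
    and sp: "separable_poly R p" and s: "ring.splitted (R\<lparr>carrier := M\<rparr>) p"
  shows "simply_split M p"
proof -
  interpret M: field "R\<lparr>carrier := M\<rparr>" by (rule subfield_iff(2)[OF M])
  interpret A: field alg_closure by (rule alg_closure_props)
  note c = univ_poly_consistent[OF subfieldE(1)[OF M]] eval_consistent[OF subfieldE(1)[OF M]]
  have p': "p \<in> carrier (poly_ring (R\<lparr>carrier := M\<rparr>))" using p c by simp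
  have pn: "p \<noteq> []" using sp by (simp add: separable_poly_def)
  have M_sub: "M \<subseteq> carrier R" by (rule subfieldE(3)[OF M])
  have "indexed_const \<in> ring_hom (R\<lparr>carrier := M\<rparr>) alg_closure"
    using alg_closure_props(2) M_sub unfolding ring_hom_def by (auto simp: subset_iff)
  then interpret H: ring_hom_ring "R\<lparr>carrier := M\<rparr>" alg_closure indexed_const
    by (rule ring_hom_ringI2[OF M.ring_axioms A.ring_axioms])
  note homM = \<open>indexed_const \<in> ring_hom (R\<lparr>carrier := M\<rparr>) alg_closure\<close>
  interpret UM: domain "poly_ring (R\<lparr>carrier := M\<rparr>)"
    using M.univ_poly_is_domain[OF M.carrier_is_subring] .
  interpret UA: domain "poly_ring alg_closure"
    using A.univ_poly_is_domain[OF A.carrier_is_subring] .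
  have map_in: "map indexed_const q \<in> carrier (poly_ring alg_closure)"
    if "q \<in> carrier (poly_ring (R\<lparr>carrier := M\<rparr>))" for q
    by (rule polynomial_hom[OF homM M.field_axioms A.field_axioms that])
  have map_mult: "map indexed_const (a \<otimes>\<^bsub>poly_ring (R\<lparr>carrier := M\<rparr>)\<^esub> b)
      = map indexed_const a \<otimes>\<^bsub>poly_ring alg_closure\<^esub> map indexed_const b"
    if "a \<in> carrier (poly_ring (R\<lparr>carrier := M\<rparr>))" "b \<in> carrier (poly_ring (R\<lparr>carrier := M\<rparr>))" for a b
  proof -
    have "A.normalize (map indexed_const (M.poly_mult a b))
        = A.poly_mult (map indexed_const a) (map indexed_const b)"
      by (rule H.poly_mult_hom')
        (use that[THEN M.polynomial_in_carrierD(2)[OF M.carrier_is_subring]] in simp_all)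
    moreover have "polynomial\<^bsub>alg_closure\<^esub> (carrier alg_closure) (map indexed_const (M.poly_mult a b))"
      using map_in[OF UM.m_closed[OF that]] by (simp add: univ_poly_carrier univ_poly_mult)
    ultimately show ?thesis by (simp add: univ_poly_mult A.normalize_polynomial)
  qed
  have cnt: "count (M.roots p) x \<le> 1" for x
  proof (rule ccontr)
    assume neg: "\<not> count (M.roots p) x \<le> 1"
    then have "x \<in># M.roots p" by (simp flip: count_greater_zero_iff)
    then have x: "x \<in> M"
      using M.roots_mem_iff_is_root[OF p'] by (simp add: M.is_root_def)
    have mult: "2 \<le> M.alg_mult p x" using neg M.alg_mult_eq_count_roots[OF p'] by simp
    let ?l = "[\<one>, \<ominus>\<^bsub>R\<lparr>carrier := M\<rparr>\<^esub> x]"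
    have l: "?l \<in> carrier (poly_ring (R\<lparr>carrier := M\<rparr>))"
      using x M.a_inv_closed[of x] M.one_closed M.one_not_zero
      unfolding sym[OF univ_poly_carrier] polynomial_def by auto
    have "?l [^]\<^bsub>poly_ring (R\<lparr>carrier := M\<rparr>)\<^esub> (2::nat) pdivides\<^bsub>R\<lparr>carrier := M\<rparr>\<^esub> p"
      using M.le_alg_mult_imp_pdivides[of x p 2] x p' mult by simp
    then obtain q where q: "q \<in> carrier (poly_ring (R\<lparr>carrier := M\<rparr>))"
       "p = ?l [^]\<^bsub>poly_ring (R\<lparr>carrier := M\<rparr>)\<^esub> (2::nat) \<otimes>\<^bsub>poly_ring (R\<lparr>carrier := M\<rparr>)\<^esub> q"
      unfolding pdivides_def factor_def by auto
    have pw: "?l [^]\<^bsub>poly_ring (R\<lparr>carrier := M\<rparr>)\<^esub> (2::nat) = ?l \<otimes>\<^bsub>poly_ring (R\<lparr>carrier := M\<rparr>)\<^esub> ?l"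
      by (simp only: numeral_2_eq_2 UM.nat_pow_Suc UM.nat_pow_0 UM.l_one[OF l])
    let ?y = "indexed_const x"
    let ?l' = "[\<one>\<^bsub>alg_closure\<^esub>, \<ominus>\<^bsub>alg_closure\<^esub> ?y]"
    have y: "?y \<in> carrier alg_closure" using H.hom_closed[of x] x by simp
    have ml: "map indexed_const ?l = ?l'"
      using x H.hom_one H.hom_a_inv[of x] by simp
    have l': "?l' \<in> carrier (poly_ring alg_closure)" using map_in[OF l] ml by simp
    have "map indexed_const p = (?l' \<otimes>\<^bsub>poly_ring alg_closure\<^esub> ?l') \<otimes>\<^bsub>poly_ring alg_closure\<^esub> map indexed_const q"
      unfolding q(2) pw using map_mult[OF UM.m_closed[OF l l] q(1)] map_mult[OF l l] ml by simp
    also have "?l' \<otimes>\<^bsub>poly_ring alg_closure\<^esub> ?l' = ?l' [^]\<^bsub>poly_ring alg_closure\<^esub> (2::nat)"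
      using l' by (simp add: numeral_2_eq_2)
    finally have "?l' [^]\<^bsub>poly_ring alg_closure\<^esub> (2::nat) pdivides\<^bsub>alg_closure\<^esub> map indexed_const p"
      unfolding pdivides_def factor_def using map_in[OF q(1)] by auto
    then have "2 \<le> A.alg_mult (map indexed_const p) ?y"
      by (intro A.alg_multE(2)[OF y map_in[OF p']]) (use pn in auto)
    moreover have "A.alg_mult (map indexed_const p) ?y \<le> 1"
      using sp y by (simp add: separable_poly_def)
    ultimately show False by simp
  qed
  have "M.roots p = mset_set (set_mset (M.roots p))"
  proof (rule multiset_eqI)
    fix x
    show "count (M.roots p) x = count (mset_set (set_mset (M.roots p))) x"
    proof (cases "x \<in># M.roots p")
      case True
      then have "count (M.roots p) x = 1"
        using cnt[of x] by (metis One_nat_def Suc_leI count_greater_zero_iff le_antisym)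
      with True show ?thesis by simp
    next
      case False
      then show ?thesis by (simp add: count_eq_zero_iff)
    qed
  qed
  then have "size (M.roots p) = card (set_mset (M.roots p))"
    by (metis size_mset_set)
  moreover have "set_mset (M.roots p) = zeros_in M p"
    using M.roots_mem_iff_is_root[OF p'] pn
    by (auto simp: M.is_root_def zeros_in_def c(2))
  moreover have "size (M.roots p) = degree p" using s M.splitted_def by simp
  ultimately show ?thesis using pn by (simp add: simply_split_def)
qed

section \<open>Embeddings of subfields\<close>

text \<open>Values outside \<open>E\<close> are left arbitrary, so that one map can serve as an
  embedding of several subfields. Distinctness of embeddings therefore has to be stated on
  \<open>E\<close> wherever they are counted.\<close>

definition (in ring) embeddings :: "'a set \<Rightarrow> 'a set \<Rightarrow> 'a set \<Rightarrow> ('a \<Rightarrow> 'a) set"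
  where "embeddings K E M =
    {h \<in> ring_hom (R\<lparr>carrier := E\<rparr>) (R\<lparr>carrier := M\<rparr>). \<forall>x \<in> K. h x = x}"

context field
begin

lemma embeddingsD:
  assumes "h \<in> embeddings K E M"
  shows "\<And>x. x \<in> E \<Longrightarrow> h x \<in> M"
    "\<And>x y. x \<in> E \<Longrightarrow> y \<in> E \<Longrightarrow> h (x \<otimes> y) = h x \<otimes> h y"
    "\<And>x y. x \<in> E \<Longrightarrow> y \<in> E \<Longrightarrow> h (x \<oplus> y) = h x \<oplus> h y"
    "h \<one> = \<one>"
    "\<And>x. x \<in> K \<Longrightarrow> h x = x"
  using assms unfolding embeddings_def ring_hom_def by auto

lemma embeddingsI:
  assumes "\<And>x. x \<in> E \<Longrightarrow> h x \<in> M"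
    "\<And>x y. x \<in> E \<Longrightarrow> y \<in> E \<Longrightarrow> h (x \<otimes> y) = h x \<otimes> h y"
    "\<And>x y. x \<in> E \<Longrightarrow> y \<in> E \<Longrightarrow> h (x \<oplus> y) = h x \<oplus> h y"
    "h \<one> = \<one>"
    "\<And>x. x \<in> K \<Longrightarrow> h x = x"
  shows "h \<in> embeddings K E M"
  using assms unfolding embeddings_def ring_hom_def by auto

lemma embeddings_ring_hom:
  assumes "subfield E R" "subfield M R" "h \<in> embeddings K E M"
  shows "ring_hom_ring (R\<lparr>carrier := E\<rparr>) (R\<lparr>carrier := M\<rparr>) h"
  using assms subring_is_ring[OF subfieldE(1)] unfolding embeddings_def
  by (intro ring_hom_ringI2) auto

lemma embeddings_props:
  assumes "subfield E R" "subfield M R" "h \<in> embeddings K E M"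
  shows "h \<zero> = \<zero>" "\<And>x. x \<in> E \<Longrightarrow> h (\<ominus> x) = \<ominus> h x" "inj_on h E"
    "\<And>x. x \<in> E \<Longrightarrow> h x = \<zero> \<Longrightarrow> x = \<zero>"
proof -
  interpret h: ring_hom_ring "R\<lparr>carrier := E\<rparr>" "R\<lparr>carrier := M\<rparr>" h
    by (rule embeddings_ring_hom[OF assms])
  show z: "h \<zero> = \<zero>" using h.hom_zero by simp
  show "h (\<ominus> x) = \<ominus> h x" if x: "x \<in> E" for x
  proof -
    have c: "x \<in> carrier R" "h x \<in> carrier R" "\<ominus> x \<in> E" "h (\<ominus> x) \<in> carrier R"
      using x embeddingsD(1)[OF assms(3)] subfieldE(3)[OF assms(1)] subfieldE(3)[OF assms(2)]
        subringE(5)[OF subfieldE(1)[OF assms(1)]] by auto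
    have "h (\<ominus> x) \<oplus> h x = h (\<ominus> x \<oplus> x)"
      using embeddingsD(3)[OF assms(3) c(3) x] by simp
    also have "\<dots> = \<zero>" using c(1) z by (simp add: l_neg)
    finally show ?thesis using c minus_equality by force
  qed
  have "h \<in> ring_hom (R\<lparr>carrier := E\<rparr>) (R\<lparr>carrier := M\<rparr>)"
    using assms(3) by (simp add: embeddings_def)
  from non_trivial_field_hom_is_inj[OF this subfield_iff(2)[OF assms(1)] subfield_iff(2)[OF assms(2)]]
  show i: "inj_on h E" by simp
  show "x = \<zero>" if "x \<in> E" "h x = \<zero>" for x
    using that z subringE(2)[OF subfieldE(1)[OF assms(1)]] by (metis inj_onD[OF i])
qed

lemma embeddings_map_poly:
  assumes E: "subfield E R" and M: "subfield M R" and h: "h \<in> embeddings K E M"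
    and p: "p \<in> carrier (E[X])"
  shows "map h p \<in> carrier (M[X])"
    "q \<in> carrier (E[X]) \<Longrightarrow> map h (p \<otimes>\<^bsub>E[X]\<^esub> q) = map h p \<otimes>\<^bsub>M[X]\<^esub> map h q"
    "q \<in> carrier (E[X]) \<Longrightarrow> map h (p \<oplus>\<^bsub>E[X]\<^esub> q) = map h p \<oplus>\<^bsub>M[X]\<^esub> map h q"
    "x \<in> E \<Longrightarrow> h (eval p x) = eval (map h p) (h x)"
proof -
  interpret h: ring_hom_ring "R\<lparr>carrier := E\<rparr>" "R\<lparr>carrier := M\<rparr>" h
    by (rule embeddings_ring_hom[OF E M h])
  have hh: "h \<in> ring_hom (R\<lparr>carrier := E\<rparr>) (R\<lparr>carrier := M\<rparr>)"
    using h by (simp add: embeddings_def)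
  note cE = univ_poly_consistent[OF subfieldE(1)[OF E]] eval_consistent[OF subfieldE(1)[OF E]]
     poly_mult_consistent[OF subfieldE(1)[OF E]] poly_add_consistent[OF subfieldE(1)[OF E]]
  note cM = univ_poly_consistent[OF subfieldE(1)[OF M]] eval_consistent[OF subfieldE(1)[OF M]]
     poly_mult_consistent[OF subfieldE(1)[OF M]] poly_add_consistent[OF subfieldE(1)[OF M]]
     normalize_consistent[OF subfieldE(1)[OF M]]
  interpret UE: ring "E[X]" by (rule univ_poly_is_ring[OF subfieldE(1)[OF E]])
  have map_in: "map h r \<in> carrier (M[X])" if "r \<in> carrier (E[X])" for r
    using polynomial_hom[OF hh subfield_iff(2)[OF E] subfield_iff(2)[OF M], of r] that cE cM by simp
  show "map h p \<in> carrier (M[X])" by (rule map_in[OF p])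
  have norm: "normalize (map h r) = map h r" if "r \<in> carrier (E[X])" for r
    using map_in[OF that] normalize_polynomial by (simp add: univ_poly_carrier)
  have set: "set r \<subseteq> E" if "r \<in> carrier (E[X])" for r
    by (rule polynomial_in_carrierD(1)[OF subfieldE(1)[OF E] that])
  show "map h (p \<otimes>\<^bsub>E[X]\<^esub> q) = map h p \<otimes>\<^bsub>M[X]\<^esub> map h q" if "q \<in> carrier (E[X])" for q
    using h.poly_mult_hom'[of p q] set[OF p] set[OF that] norm[OF UE.m_closed[OF p that]]
    by (simp add: cE cM univ_poly_mult)
  show "map h (p \<oplus>\<^bsub>E[X]\<^esub> q) = map h p \<oplus>\<^bsub>M[X]\<^esub> map h q" if "q \<in> carrier (E[X])" for q
    using h.poly_add_hom'[of p q] set[OF p] set[OF that] norm[OF UE.a_closed[OF p that]]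
    by (simp add: cE cM univ_poly_add)
  show "h (eval p x) = eval (map h p) (h x)" if "x \<in> E" for x
    using h.eval_hom'[of x p] set[OF p] that by (simp add: cE cM)
qed

lemma embeddings_map_fixed:
  assumes "h \<in> embeddings K E M" "subring K R" "p \<in> carrier (K[X])"
  shows "map h p = p"
  using embeddingsD(5)[OF assms(1)] polynomial_in_carrierD(1)[OF assms(2,3)]
  by (intro map_idI) auto

lemma embeddings_eval_fixed:
  assumes "subfield E R" "subfield M R" "h \<in> embeddings K E M" "subring K R" "K \<subseteq> E"
    "p \<in> carrier (K[X])" "x \<in> E"
  shows "h (eval p x) = eval p (h x)"
  using embeddings_map_poly(4)[OF assms(1-3) polynomial_mono[OF assms(5,6)] assms(7)]
    embeddings_map_fixed[OF assms(3,4,6)] by simp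

lemma embeddings_zeros:
  assumes "subfield E R" "subfield M R" "h \<in> embeddings K E M" "subring K R" "K \<subseteq> E"
    "p \<in> carrier (K[X])" "x \<in> zeros_in E p"
  shows "h x \<in> zeros_in M p"
  using assms(7) embeddings_eval_fixed[OF assms(1-6), of x] embeddingsD(1)[OF assms(3), of x]
    embeddings_props(1)[OF assms(1-3)] by (simp add: zeros_in_def)

text \<open>\<open>K1(x)\<close> consists of the values \<open>p(x)\<close>, and \<open>p(x)\<close>
  is sent to the value at \<open>y\<close> of \<open>p\<close> with \<open>h\<close> applied to its
  coefficients. Two polynomials with the same value at \<open>x\<close> differ by a multiple of
  \<open>Irr K1 x\<close>, whose image vanishes at \<open>y\<close>, so this is well
  defined.\<close>

lemma embedding_extend_simple:
  assumes K1: "subfield K1 R" and M: "subfield M R" and K: "K \<subseteq> K1"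
    and h: "h \<in> embeddings K K1 M"
    and x: "x \<in> carrier R" "(algebraic over K1) x"
    and y: "y \<in> M" "eval (map h (Irr K1 x)) y = \<zero>"
  shows "\<exists>g \<in> embeddings K (simple_extension K1 x) M. (\<forall>z \<in> K1. g z = h z) \<and> g x = y"
proof -
  interpret U: domain "K1[X]" by (rule univ_poly_is_domain[OF subfieldE(1)[OF K1]])
  have sub: "K1 \<subseteq> carrier R" and Mc: "M \<subseteq> carrier R" by (rule subfieldE(3)[OF K1], rule subfieldE(3)[OF M])
  have yc: "y \<in> carrier R" using y Mc by auto
  note mp = embeddings_map_poly[OF K1 M h]
  define ev where "ev p = eval (map h p) y" for p
  have ev_mult: "ev (p \<otimes>\<^bsub>K1[X]\<^esub> q) = ev p \<otimes> ev q"
    and ev_add: "ev (p \<oplus>\<^bsub>K1[X]\<^esub> q) = ev p \<oplus> ev q"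
    if "p \<in> carrier (K1[X])" "q \<in> carrier (K1[X])" for p q
    using mp(1)[OF that(1)] mp(1)[OF that(2)] mp(2,3)[OF that]
      eval_is_hom[OF subfieldE(1)[OF M] yc]
    by (simp_all add: ev_def ring_hom_def)
  have ev_in: "ev p \<in> M" if "p \<in> carrier (K1[X])" for p
  proof -
    interpret M: ring "R\<lparr>carrier := M\<rparr>" by (rule subring_is_ring[OF subfieldE(1)[OF M]])
    show ?thesis
      using M.eval_in_carrier[of "map h p" y] y(1) eval_consistent[OF subfieldE(1)[OF M]]
        polynomial_in_carrierD(1)[OF subfieldE(1)[OF M] mp(1)[OF that]] by (simp add: ev_def)
  qed
  have evR: "ev p \<in> carrier R" if "p \<in> carrier (K1[X])" for p using ev_in[OF that] Mc by auto
  have eval_hom: "(\<lambda>p. eval p x) \<in> ring_hom (K1[X]) R"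
    by (rule eval_is_hom[OF subfieldE(1)[OF K1] x(1)])
  note irr = IrrE[OF K1 x]
  have wd: "ev p = ev q" if p: "p \<in> carrier (K1[X])" and q: "q \<in> carrier (K1[X])"
    and e: "eval p x = eval q x" for p q
  proof -
    let ?d = "p \<ominus>\<^bsub>K1[X]\<^esub> q"
    have d: "?d \<in> carrier (K1[X])" using p q by simp
    have pd: "p = ?d \<oplus>\<^bsub>K1[X]\<^esub> q" using p q by (simp add: a_minus_def U.a_assoc U.l_neg)
    have c: "eval p x \<in> carrier R" "eval q x \<in> carrier R" "eval ?d x \<in> carrier R"
      using ring_hom_closed[OF eval_hom] p q d by auto
    have "eval p x = eval ?d x \<oplus> eval q x"
      using ring_hom_add[OF eval_hom d q] pd by simp
    then have "eval ?d x = \<zero>"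
      using c e add.r_cancel_one' by metis
    then have "(Irr K1 x) pdivides ?d" using Irr_minimal[OF K1 x d] by simp
    then obtain r where r: "r \<in> carrier (K1[X])" "?d = Irr K1 x \<otimes>\<^bsub>K1[X]\<^esub> r"
      using pdivides_iff_shell[OF K1 irr(1) d] unfolding factor_def by auto
    have "ev ?d = \<zero>" using ev_mult[OF irr(1) r(1)] r(2) y(2) evR[OF r(1)] by (simp add: ev_def)
    then show ?thesis using ev_add[OF d q] pd evR[OF q] by simp
  qed
  define g where "g z = ev (SOME p. p \<in> carrier (K1[X]) \<and> eval p x = z)" for z
  have g_eval: "g (eval p x) = ev p" if "p \<in> carrier (K1[X])" for p
  proof -
    let ?q = "SOME q. q \<in> carrier (K1[X]) \<and> eval q x = eval p x"
    have "?q \<in> carrier (K1[X]) \<and> eval ?q x = eval p x"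
      by (rule someI[of _ p]) (use that in simp)
    then show ?thesis unfolding g_def using wd that by blast
  qed
  have img: "simple_extension K1 x = (\<lambda>p. eval p x) ` carrier (K1[X])"
    by (rule simple_extension_as_eval_img[OF sub x(1)])
  have gK1: "g z = h z" if z: "z \<in> K1" for z
  proof (cases "z = \<zero>")
    case True
    have "g (eval [] x) = ev []" by (rule g_eval) (auto simp: univ_poly_zero_closed)
    then show ?thesis using True embeddings_props(1)[OF K1 M h] by (simp add: ev_def)
  next
    case False
    have "[z] \<in> carrier (K1[X])" using z False by (simp add: const_is_polynomial flip: univ_poly_carrier)
    from g_eval[OF this] show ?thesis
      using z sub embeddingsD(1)[OF h z] Mc by (auto simp: ev_def subset_iff)
  qed
  have gx: "g x = y"
  proof -
    have "[\<one>, \<zero>] \<in> carrier (K1[X])"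
      using subringE(2,3)[OF subfieldE(1)[OF K1]] unfolding sym[OF univ_poly_carrier] polynomial_def by auto
    from g_eval[OF this] show ?thesis
      using x yc embeddings_props(1)[OF K1 M h] embeddingsD(4)[OF h] by (simp add: ev_def)
  qed
  have "g \<in> embeddings K (simple_extension K1 x) M"
  proof (rule embeddingsI)
    fix a assume "a \<in> simple_extension K1 x"
    then show "g a \<in> M" using g_eval ev_in unfolding img by auto
  next
    fix a b assume "a \<in> simple_extension K1 x" "b \<in> simple_extension K1 x"
    then obtain p q where pq: "p \<in> carrier (K1[X])" "q \<in> carrier (K1[X])" "a = eval p x" "b = eval q x"
      unfolding img by auto
    show "g (a \<otimes> b) = g a \<otimes> g b"
      using ring_hom_mult[OF eval_hom pq(1,2)] g_eval[OF U.m_closed[OF pq(1,2)]]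
        g_eval[OF pq(1)] g_eval[OF pq(2)] ev_mult[OF pq(1,2)] pq by simp
    show "g (a \<oplus> b) = g a \<oplus> g b"
      using ring_hom_add[OF eval_hom pq(1,2)] g_eval[OF U.a_closed[OF pq(1,2)]]
        g_eval[OF pq(1)] g_eval[OF pq(2)] ev_add[OF pq(1,2)] pq by simp
  next
    show "g \<one> = \<one>" using gK1[of \<one>] subringE(3)[OF subfieldE(1)[OF K1]] embeddingsD(4)[OF h] by simp
  next
    fix a assume "a \<in> K" then show "g a = a" using gK1[of a] K embeddingsD(5)[OF h] by auto
  qed
  then show ?thesis using gK1 gx by blast
qed

text \<open>Over \<open>K1\<close> the minimal polynomial divides \<open>p\<close>. Applying
  \<open>h\<close> to the factorisation leaves \<open>p\<close> unchanged, since its coefficients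
  lie in \<open>K\<close>, so the conjugated minimal polynomial still divides \<open>p\<close> and
  inherits simple roots in \<open>M\<close>.\<close>

lemma simply_split_map_Irr:
  assumes K: "subfield K R" and K1: "subfield K1 R" and M: "subfield M R" and sub: "K \<subseteq> K1"
    and h: "h \<in> embeddings K K1 M"
    and p: "p \<in> carrier (K[X])" "simply_split M p" and x: "x \<in> carrier R" "eval p x = \<zero>"
  shows "(algebraic over K1) x" "simply_split M (map h (Irr K1 x))"
    "map h (Irr K1 x) \<in> carrier (M[X])"
proof -
  have p1: "p \<in> carrier (K1[X])" by (rule polynomial_mono[OF sub p(1)])
  show a: "(algebraic over K1) x"
    using p by (intro algebraicI[OF p1 _ x(2)]) (simp add: simply_split_def)
  note irr = IrrE[OF K1 x(1) a]
  have "(Irr K1 x) pdivides p" by (rule Irr_minimal[OF K1 x(1) a p1 x(2)])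
  then obtain r where r: "r \<in> carrier (K1[X])" "p = Irr K1 x \<otimes>\<^bsub>K1[X]\<^esub> r"
    using pdivides_iff_shell[OF K1 irr(1) p1] unfolding factor_def by auto
  note mp = embeddings_map_poly[OF K1 M h]
  have "p = map h (Irr K1 x) \<otimes>\<^bsub>M[X]\<^esub> map h r"
    using mp(2)[OF irr(1) r(1)] embeddings_map_fixed[OF h subfieldE(1)[OF K] p(1)] r(2) by simp
  then have dv: "map h (Irr K1 x) pdivides p"
    unfolding pdivides_def factor_def
    using carrier_polynomial_shell[OF subfieldE(1)[OF M] mp(1)[OF r(1)]]
    by (auto simp: univ_poly_mult)
  show m: "map h (Irr K1 x) \<in> carrier (M[X])" by (rule mp(1)[OF irr(1)])
  show "simply_split M (map h (Irr K1 x))"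
    using dv by (intro simply_split_pdivides[OF _ _ subfieldE(3)[OF M] _ p(2)])
      (use p1 m carrier_polynomial_shell subfieldE(1) K1 M in auto)
qed

text \<open>The tail of the list is adjoined first. Whatever embedding has been built on it, the
  conjugated minimal polynomial of the next generator divides a polynomial over \<open>K\<close>
  that splits in \<open>M\<close>, so it has a zero there to which the generator can be
  sent.\<close>

lemma embedding_extend_list:
  assumes K: "subfield K R" and K1: "subfield K1 R" and M: "subfield M R" and sub: "K \<subseteq> K1"
    and h: "h \<in> embeddings K K1 M"
    and xs: "set xs \<subseteq> carrier R" "\<And>x. x \<in> set xs \<Longrightarrow> \<exists>p \<in> carrier (K[X]). simply_split M p \<and> eval p x = \<zero>"
  shows "\<exists>g \<in> embeddings K (finite_extension K1 xs) M. \<forall>z \<in> K1. g z = h z"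
  using xs
proof (induction xs)
  case Nil
  then show ?case using h by auto
next
  case (Cons x xs)
  let ?K2 = "finite_extension K1 xs"
  obtain g where g: "g \<in> embeddings K ?K2 M" "\<forall>z \<in> K1. g z = h z" using Cons by auto
  have alg: "(algebraic over K1) z" if z: "z \<in> set xs" for z
  proof -
    obtain p where p: "p \<in> carrier (K[X])" "simply_split M p" "eval p z = \<zero>"
      using Cons.prems(2)[of z] z by auto
    show ?thesis by (rule simply_split_map_Irr(1)[OF K K1 M sub h p(1,2) _ p(3)]) (use z Cons.prems(1) in auto)
  qed
  have K2: "subfield ?K2 R"
    by (rule finite_extension_is_subfield[OF K1 _ alg]) (use Cons.prems in auto)
  have incl: "K1 \<subseteq> ?K2" by (rule finite_extension_incl[OF subfieldE(3)[OF K1]]) (use Cons.prems in auto)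
  then have sub2: "K \<subseteq> ?K2" using sub by auto
  obtain p where p: "p \<in> carrier (K[X])" "simply_split M p" "eval p x = \<zero>"
    using Cons.prems(2)[of x] by auto
  have xc: "x \<in> carrier R" using Cons.prems(1) by simp
  note s = simply_split_map_Irr[OF K K2 M sub2 g(1) p(1,2) xc p(3)]
  have "degree (Irr ?K2 x) \<ge> 1"
    by (rule pirreducible_degree[OF K2 IrrE(1,2)[OF K2 xc s(1)]])
  then have "card (zeros_in M (map g (Irr ?K2 x))) \<noteq> 0" using s(2) by (simp add: simply_split_def)
  then obtain y where y: "y \<in> M" "eval (map g (Irr ?K2 x)) y = \<zero>"
    unfolding zeros_in_def by (metis (mono_tags, lifting) card.empty empty_Collect_eq)
  obtain g' where "g' \<in> embeddings K (simple_extension ?K2 x) M" "\<forall>z \<in> ?K2. g' z = g z"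
    using embedding_extend_simple[OF K2 M sub2 g(1) xc s(1) y] by auto
  then show ?case using g(2) incl by (intro bexI[of _ g']) auto
qed

section \<open>Automorphisms of splitting fields\<close>

lemma galois_group_iff:
  "s \<in> carrier (galois_group R M K) \<longleftrightarrow>
    s \<in> extensional M \<and> bij_betw s M M \<and> s \<in> embeddings K M M"
  by (auto simp: galois_group_def Bij_def embeddings_def)

text \<open>A finite Galois extension described by data on generators alone. The form is convenient
  because it passes to a larger base field with the same list \<open>xs\<close>;
  \<open>galois_extension_split_generated\<close> and
  \<open>split_generated_galois_extension\<close> show that it agrees with being Galois of finite
  degree.\<close>

definition split_generated :: "'a set \<Rightarrow> 'a set \<Rightarrow> 'a list \<Rightarrow> bool"
  where "split_generated K M xs \<longleftrightarrow> subfield K R \<and> subfield M R \<and> M = finite_extension K xs \<and> set xs \<subseteq> M \<and>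
    (\<forall>x \<in> set xs. \<exists>p \<in> carrier (K[X]). simply_split M p \<and> eval p x = \<zero>)"

lemma split_generatedD:
  assumes "split_generated K M xs"
  shows "subfield K R" "subfield M R" "M = finite_extension K xs" "set xs \<subseteq> M" "set xs \<subseteq> carrier R" "K \<subseteq> M"
    "\<And>x. x \<in> set xs \<Longrightarrow> \<exists>p \<in> carrier (K[X]). simply_split M p \<and> eval p x = \<zero>"
proof -
  show 1: "subfield K R" "subfield M R" "M = finite_extension K xs" "set xs \<subseteq> M"
    "\<And>x. x \<in> set xs \<Longrightarrow> \<exists>p \<in> carrier (K[X]). simply_split M p \<and> eval p x = \<zero>"
    using assms by (auto simp: split_generated_def)
  show s: "set xs \<subseteq> carrier R" using 1(4) subfieldE(3)[OF 1(2)] by auto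
  show "K \<subseteq> M" using finite_extension_incl[OF subfieldE(3)[OF 1(1)] s] 1(3) by simp
qed

lemma finite_extension_intermediate:
  assumes M: "subfield M R" "M = finite_extension K xs" "set xs \<subseteq> M" and F: "K \<subseteq> F" "F \<subseteq> M"
  shows "finite_extension F xs = M"
  using mono_finite_extension[OF F(1), of xs] finite_extension_subring_incl[OF subfieldE(1)[OF M(1)] F(2) M(3)]
    M(2) by auto

lemma split_generated_intermediate:
  assumes "split_generated K M xs" and F: "subfield F R" "K \<subseteq> F" "F \<subseteq> M"
  shows "split_generated F M xs"
  using assms finite_extension_intermediate[of M K xs F] polynomial_mono[OF F(2)]
  unfolding split_generated_def by metis

text \<open>Surjectivity is checked on generators: each belongs to the finite set of zeros in
  \<open>M\<close> of a polynomial over \<open>K\<close>, which the injective map \<open>g\<close>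
  sends into itself and therefore permutes.\<close>

lemma embedding_self_bij:
  assumes s: "split_generated K M xs" and g: "g \<in> embeddings K M M"
  shows "bij_betw g M M"
proof -
  note D = split_generatedD[OF s]
  have inj: "inj_on g M" by (rule embeddings_props(3)[OF D(2,2) g])
  have "g \<in> ring_hom (R\<lparr>carrier := M\<rparr>) R"
    using embeddingsD[OF g] subfieldE(3)[OF D(2)] by (auto simp: ring_hom_def)
  then interpret g: ring_hom_ring "R\<lparr>carrier := M\<rparr>" R g
    by (rule ring_hom_ringI2[OF subring_is_ring[OF subfieldE(1)[OF D(2)]] ring_axioms])
  have sub: "subring (g ` M) R" using g.img_is_subring[OF g.R.carrier_is_subring] by simp
  have xs: "set xs \<subseteq> g ` M"
  proof
    fix x assume x: "x \<in> set xs"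
    then obtain p where p: "p \<in> carrier (K[X])" "simply_split M p" "eval p x = \<zero>" using D(7) by blast
    have fin: "finite (zeros_in M p)"
      using zeros_in_bound(1)[OF _ _ subfieldE(3)[OF D(2)]] p carrier_polynomial_shell[OF subfieldE(1)[OF D(1)]]
      by (auto simp: simply_split_def)
    have "g ` zeros_in M p \<subseteq> zeros_in M p"
      using embeddings_zeros[OF D(2,2) g subfieldE(1)[OF D(1)] D(6) p(1)] by auto
    moreover have "inj_on g (zeros_in M p)" by (rule inj_on_subset[OF inj]) (auto simp: zeros_in_def)
    ultimately have "g ` zeros_in M p = zeros_in M p" using fin endo_inj_surj by blast
    moreover have "x \<in> zeros_in M p" using p x D(4) by (auto simp: zeros_in_def)
    ultimately show "x \<in> g ` M" by (auto simp: zeros_in_def)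
  qed
  have "K \<subseteq> g ` M"
  proof
    fix x assume "x \<in> K"
    then show "x \<in> g ` M" using embeddingsD(5)[OF g] D(6) by (intro image_eqI[of _ _ x]) auto
  qed
  then have "M \<subseteq> g ` M"
    using finite_extension_subring_incl[OF sub _ xs] D(3) by simp
  moreover have "g ` M \<subseteq> M" using embeddingsD(1)[OF g] by auto
  ultimately show ?thesis using inj by (auto simp: bij_betw_def)
qed

lemma restrict_in_galois_group:
  assumes M: "subfield M R" and K: "K \<subseteq> M" and g: "g \<in> embeddings K M M" "bij_betw g M M"
  shows "restrict g M \<in> carrier (galois_group R M K)"
  unfolding galois_group_iff
proof (intro conjI)
  show "bij_betw (restrict g M) M M" using g(2) by (simp add: bij_betw_restrict_eq)
  show "restrict g M \<in> embeddings K M M"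
    using embeddingsD[OF g(1)] K subringE(3,6,7)[OF subfieldE(1)[OF M]]
    by (intro embeddingsI) (auto simp: subset_iff)
qed simp

lemma embedding_extend_galois:
  assumes s: "split_generated K M xs" and K1: "subfield K1 R" "K \<subseteq> K1" "K1 \<subseteq> M"
    and h: "h \<in> embeddings K K1 M"
  shows "\<exists>g \<in> carrier (galois_group R M K). \<forall>z \<in> K1. g z = h z"
proof -
  note D = split_generatedD[OF s]
  obtain g where g: "g \<in> embeddings K (finite_extension K1 xs) M" "\<forall>z \<in> K1. g z = h z"
    using embedding_extend_list[OF D(1) K1(1) D(2) K1(2) h D(5) D(7)] by blast
  have gM: "g \<in> embeddings K M M" using g(1) finite_extension_intermediate[OF D(2-4) K1(2,3)] by simp
  have "restrict g M \<in> carrier (galois_group R M K)"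
    by (rule restrict_in_galois_group[OF D(2,6) gM embedding_self_bij[OF s gM]])
  then show ?thesis using g(2) K1(3) by (intro bexI[of _ "restrict g M"]) auto
qed

lemma normalize_eq_NilD: "normalize p = [] \<Longrightarrow> set p \<subseteq> {\<zero>}"
  by (induction p) (auto split: if_splits)

text \<open>The list \<open>t\<close> may begin with zeros and so need not be a polynomial; the root
  bound is applied to \<open>normalize t\<close>. A nonempty normal form of length \<open>l\<close>
  has degree \<open>l - 1\<close>, so \<open>length t \<le> card A\<close> already means too many
  zeros.\<close>

lemma too_many_zeros:
  assumes "set t \<subseteq> carrier R" "A \<subseteq> carrier R" "\<And>x. x \<in> A \<Longrightarrow> eval t x = \<zero>" "length t \<le> card A"
    and "finite A"
  shows "set t \<subseteq> {\<zero>}"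
proof (rule ccontr)
  assume neg: "\<not> set t \<subseteq> {\<zero>}"
  then have nn: "normalize t \<noteq> []" using normalize_eq_NilD by blast
  have c: "normalize t \<in> carrier (poly_ring R)"
    using normalize_gives_polynomial[OF assms(1)] by (simp add: univ_poly_carrier)
  have "A \<subseteq> zeros_in A (normalize t)"
    using assms(1-3) eval_normalize by (auto simp: zeros_in_def)
  then have "card A \<le> degree (normalize t)"
    using card_mono[OF zeros_in_bound(1)[OF c nn assms(2)], of A] zeros_in_bound(2)[OF c nn assms(2)]
    by (meson order_trans)
  then show False
    using normalize_length_le[of t] assms(4) nn by (cases "normalize t") auto
qed

text \<open>If every automorphism fixes \<open>a = f(z)\<close> with \<open>deg f < deg (Irr K1 z)\<close>, then \<open>f - a\<close> vanishes
  at all conjugates of \<open>z\<close>, so \<open>f\<close> is constant.\<close>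

lemma fixed_in_simple_extension:
  assumes s: "split_generated K M xs" and K1: "subfield K1 R" "K \<subseteq> K1" "K1 \<subseteq> M"
    and z: "z \<in> M" and p: "p \<in> carrier (K[X])" "simply_split M p" "eval p z = \<zero>"
    and a: "a \<in> simple_extension K1 z"
    and fixed: "\<And>g. g \<in> carrier (galois_group R M K) \<Longrightarrow> g a = a"
  shows "a \<in> K1"
proof -
  note D = split_generatedD[OF s]
  have Mc: "M \<subseteq> carrier R" by (rule subfieldE(3)[OF D(2)])
  have zc: "z \<in> carrier R" using z Mc by auto
  have id: "id \<in> embeddings K1 K1 M" using K1 by (intro embeddingsI) auto
  have p1: "p \<in> carrier (K1[X])" by (rule polynomial_mono[OF K1(2) p(1)])
  note sp = simply_split_map_Irr[OF K1(1) K1(1) D(2) order_refl id p1 p(2) zc p(3)]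
  have ss: "simply_split M (Irr K1 z)" using sp(2) by simp
  note irr = IrrE[OF K1(1) zc sp(1)]
  have irr0: "Irr K1 z \<noteq> []" using ss by (simp add: simply_split_def)
  interpret U: domain "K1[X]" by (rule univ_poly_is_domain[OF subfieldE(1)[OF K1(1)]])
  obtain q where q: "q \<in> carrier (K1[X])" "a = eval q z"
    using a unfolding simple_extension_as_eval_img[OF subfieldE(3)[OF K1(1)] zc] by auto
  define f where "f = q pmod (Irr K1 z)"
  have f: "f \<in> carrier (K1[X])"
    using long_division_closed(2)[OF K1(1) q(1) irr(1)] by (simp add: f_def)
  have fd: "f = [] \<or> degree f < degree (Irr K1 z)"
    using pmod_degree[OF K1(1) q(1) irr(1) irr0] by (simp add: f_def)
  have eval_hom: "(\<lambda>p. eval p z) \<in> ring_hom (K1[X]) R"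
    by (rule eval_is_hom[OF subfieldE(1)[OF K1(1)] zc])
  have d: "q pdiv (Irr K1 z) \<in> carrier (K1[X])" by (rule long_division_closed(1)[OF K1(1) q(1) irr(1)])
  have "q = (Irr K1 z \<otimes>\<^bsub>K1[X]\<^esub> (q pdiv Irr K1 z)) \<oplus>\<^bsub>K1[X]\<^esub> f"
    unfolding f_def by (rule pdiv_pmod[OF K1(1) q(1) irr(1)])
  then have "eval q z = eval (Irr K1 z) z \<otimes> eval (q pdiv Irr K1 z) z \<oplus> eval f z"
    using ring_hom_add[OF eval_hom U.m_closed[OF irr(1) d] f] ring_hom_mult[OF eval_hom irr(1) d] by simp
  then have af: "a = eval f z"
    using irr(4) q(2) ring_hom_closed[OF eval_hom d] ring_hom_closed[OF eval_hom f] by simp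
  have aM: "a \<in> M"
    using a simple_extension_subring_incl[OF subfieldE(1)[OF D(2)] K1(3) z] by auto
  have conj: "eval f y = a" if y: "y \<in> zeros_in M (Irr K1 z)" for y
  proof -
    have y': "y \<in> M" "eval (map id (Irr K1 z)) y = \<zero>" using y by (auto simp: zeros_in_def)
    obtain g0 where g0: "g0 \<in> embeddings K1 (simple_extension K1 z) M" "g0 z = y"
      using embedding_extend_simple[OF K1(1) D(2) order_refl id zc sp(1) y'] by blast
    have sf: "subfield (simple_extension K1 z) R"
      using simple_extension_is_subfield[OF K1(1) zc] sp(1) by simp
    have g0': "g0 \<in> embeddings K (simple_extension K1 z) M"
      using embeddingsD[OF g0(1)] K1(2) by (intro embeddingsI) auto
    have incl: "K1 \<subseteq> simple_extension K1 z" by (rule simple_extension_incl[OF subfieldE(3)[OF K1(1)] zc])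
    obtain g where g: "g \<in> carrier (galois_group R M K)" "\<forall>w \<in> simple_extension K1 z. g w = g0 w"
      using embedding_extend_galois[OF s sf _ _ g0'] incl K1(2)
        simple_extension_subring_incl[OF subfieldE(1)[OF D(2)] K1(3) z] by blast
    have zs: "z \<in> simple_extension K1 z" by (rule simple_extension_mem[OF subfieldE(1)[OF K1(1)] zc])
    have "a = g a" using fixed[OF g(1)] by simp
    also have "\<dots> = g0 a" using g(2) a by simp
    also have "\<dots> = eval f (g0 z)"
      unfolding af by (rule embeddings_eval_fixed[OF sf D(2) g0(1) subfieldE(1)[OF K1(1)] incl f zs])
    finally show ?thesis using g0(2) by simp
  qed
  have fset: "set f \<subseteq> K1" by (rule polynomial_in_carrierD(1)[OF subfieldE(1)[OF K1(1)] f])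
  show ?thesis
  proof (cases f rule: rev_cases)
    case Nil
    then show ?thesis using af subringE(2)[OF subfieldE(1)[OF K1(1)]] by simp
  next
    case (snoc g b)
    have bK: "b \<in> K1" and gK: "set g \<subseteq> K1" using fset snoc by auto
    then have bc: "b \<in> carrier R" and gc: "set g \<subseteq> carrier R" using subfieldE(3)[OF K1(1)] by auto
    have ac: "a \<in> carrier R" using aM Mc by auto
    have fin: "finite (zeros_in M (Irr K1 z))"
      using zeros_in_bound(1)[OF carrier_polynomial_shell[OF subfieldE(1)[OF K1(1)] irr(1)] irr0 Mc] .
    \<comment> \<open>Changing the constant coefficient from \<open>b\<close> to
      \<open>b \<ominus> a\<close> turns \<open>f\<close> into \<open>f - a\<close>, at the price of
      a possible leading zero when \<open>f\<close> is constant. Its length is at most the degree of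
      \<open>Irr K1 z\<close>, which by \<open>ss\<close> is the number of conjugates.\<close>
    have "set (g @ [b \<ominus> a]) \<subseteq> {\<zero>}"
    proof (rule too_many_zeros[OF _ _ _ _ fin])
      show "set (g @ [b \<ominus> a]) \<subseteq> carrier R" using gc bc ac by auto
      show "zeros_in M (Irr K1 z) \<subseteq> carrier R" using Mc by (auto simp: zeros_in_def)
      show "eval (g @ [b \<ominus> a]) y = \<zero>" if y: "y \<in> zeros_in M (Irr K1 z)" for y
      proof -
        have yc: "y \<in> carrier R" using y Mc by (auto simp: zeros_in_def)
        have e: "eval g y \<otimes> y \<in> carrier R" using eval_in_carrier[OF gc yc] yc by simp
        have "eval g y \<otimes> y \<oplus> b = a" using conj[OF y] eval_append_aux[OF gc bc yc] snoc by simp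
        then have "(eval g y \<otimes> y \<oplus> b) \<ominus> a = \<zero>" using ac by (simp add: r_right_minus_eq)
        then show ?thesis
          using eval_append_aux[OF gc _ yc, of "b \<ominus> a"] e bc ac by (simp add: a_minus_def a_assoc)
      qed
      show "length (g @ [b \<ominus> a]) \<le> card (zeros_in M (Irr K1 z))"
        using ss fd snoc by (auto simp: simply_split_def)
    qed
    then have "b \<ominus> a = \<zero>" by simp
    then show ?thesis using bK bc ac by (simp add: r_right_minus_eq)
  qed
qed

text \<open>Descent along the fields generated by the suffixes \<open>ys\<close> of
  \<open>xs\<close>: an element of \<open>K(z, ys)\<close> fixed by the group already lies in
  \<open>K(ys)\<close>. The group is \<open>Gal(M/K)\<close> at every stage, so the hypothesis
  \<open>fixed\<close> can be reused unchanged.\<close>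

theorem split_generated_fixed_field:
  assumes s: "split_generated K M xs" and a: "a \<in> M"
    and fixed: "\<And>g. g \<in> carrier (galois_group R M K) \<Longrightarrow> g a = a"
  shows "a \<in> K"
proof -
  note D = split_generatedD[OF s]
  have alg: "(algebraic over K) x" if "x \<in> set xs" for x
    using D(7)[OF that] algebraicI by (auto simp: simply_split_def)
  have "a \<in> finite_extension K ys" if "xs = zs @ ys" for zs ys
    using that
  proof (induction zs arbitrary: ys rule: rev_induct)
    case Nil
    then show ?case using a D(3) by simp
  next
    case (snoc z zs)
    have a': "a \<in> simple_extension (finite_extension K ys) z"
      using snoc.IH[of "z # ys"] snoc.prems by simp
    have ys: "set ys \<subseteq> set xs" "z \<in> set xs" using snoc.prems by auto
    have sf: "subfield (finite_extension K ys) R"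
      by (rule finite_extension_is_subfield[OF D(1)]) (use ys D(5) alg in auto)
    have i1: "K \<subseteq> finite_extension K ys"
      by (rule finite_extension_incl[OF subfieldE(3)[OF D(1)]]) (use ys D(5) in auto)
    have i2: "finite_extension K ys \<subseteq> M"
      by (rule finite_extension_subring_incl[OF subfieldE(1)[OF D(2)] D(6)]) (use ys D(4) in auto)
    obtain p where p: "p \<in> carrier (K[X])" "simply_split M p" "eval p z = \<zero>"
      using D(7)[OF ys(2)] by blast
    have "z \<in> M" using ys(2) D(4) by auto
    then show ?case
      using fixed_in_simple_extension[OF s sf i1 i2 _ p a'] fixed by simp
  qed
  from this[of xs "[]"] show ?thesis by simp
qed

section \<open>Independence of embeddings\<close>

lemma finsum_in_subring:
  assumes "subring M R" "\<And>i. i \<in> A \<Longrightarrow> f i \<in> M"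
  shows "(\<Oplus>i\<in>A. f i) \<in> M"
  using assms(2)
proof (induction A rule: infinite_finite_induct)
  case (infinite A)
  then show ?case using subringE(2)[OF assms(1)] by (simp add: finsum_infinite)
next
  case empty
  then show ?case using subringE(2)[OF assms(1)] by simp
next
  case (insert x A)
  have "f \<in> A \<rightarrow> carrier R" "f x \<in> carrier R" using insert.prems subringE(1)[OF assms(1)] by auto
  then show ?case using insert subringE(7)[OF assms(1)] by simp
qed

text \<open>Gaussian elimination, by induction on the equations. A nonzero coefficient of the
  equation \<open>h0\<close> serves as a pivot; removing that equation and the unknown
  \<open>j\<close> keeps the strict inequality between equations and unknowns. With no equation
  left, the constant solution \<open>\<one>\<close> works.\<close>

lemma linear_system_nontrivial_solution:
  assumes M: "subfield M R" and "finite H"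
    and "finite I" "card H < card I" "\<And>h i. h \<in> H \<Longrightarrow> i \<in> I \<Longrightarrow> c h i \<in> M"
  shows "\<exists>x. (\<forall>i \<in> I. x i \<in> M) \<and> (\<exists>i \<in> I. x i \<noteq> \<zero>) \<and> (\<forall>h \<in> H. (\<Oplus>i\<in>I. c h i \<otimes> x i) = \<zero>)"
  using assms(2-)
proof (induction H arbitrary: I c rule: finite_induct)
  case empty
  then obtain i where "i \<in> I" by fastforce
  then show ?case using subringE(3)[OF subfieldE(1)[OF M]] by (intro exI[of _ "\<lambda>_. \<one>"]) auto
next
  case (insert h0 H)
  note Mr = subfieldE(1)[OF M]
  have Mc: "M \<subseteq> carrier R" by (rule subfieldE(3)[OF M])
  have cM: "c h i \<in> M" if "h \<in> insert h0 H" "i \<in> I" for h i using insert.prems that by auto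
  then have cc: "c h i \<in> carrier R" if "h \<in> insert h0 H" "i \<in> I" for h i using that Mc by auto
  show ?case
  proof (cases "\<forall>i \<in> I. c h0 i = \<zero>")
    case True
    obtain x where x: "\<forall>i \<in> I. x i \<in> M" "\<exists>i \<in> I. x i \<noteq> \<zero>" "\<forall>h \<in> H. (\<Oplus>i\<in>I. c h i \<otimes> x i) = \<zero>"
      using insert.IH[of I c] insert.prems insert.hyps by auto
    have "(\<Oplus>i\<in>I. c h0 i \<otimes> x i) = (\<Oplus>i\<in>I. \<zero>)"
      using True x(1) Mc by (intro add.finprod_cong') auto
    then show ?thesis using x by (intro exI[of _ x]) auto
  next
    case False
    then obtain j where j: "j \<in> I" "c h0 j \<noteq> \<zero>" by auto
    define I' where "I' = I - {j}"
    have I: "I = insert j I'" "j \<notin> I'" "finite I'" "card H < card I'" "I' \<subseteq> I"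
      using j insert.prems insert.hyps by (auto simp: I'_def)
    define u where "u = inv (c h0 j)"
    have uM: "u \<in> M" using subfield_m_inv(1)[OF M, of "c h0 j"] cM[of h0 j] j by (auto simp: u_def)
    have uinv: "c h0 j \<otimes> u = \<one>" using subfield_m_inv(2)[OF M, of "c h0 j"] cM[of h0 j] j by (auto simp: u_def)
    have uc: "u \<in> carrier R" using uM Mc by auto
    \<comment> \<open>Equation \<open>h\<close> minus the multiple of equation \<open>h0\<close>
      that cancels the unknown \<open>j\<close>.\<close>
    define c' where "c' h i = c h i \<ominus> (c h j \<otimes> u) \<otimes> c h0 i" for h i
    have c'M: "c' h i \<in> M" if "h \<in> H" "i \<in> I'" for h i
      using that cM uM j I subringE(5,6,7)[OF Mr] by (auto simp: c'_def a_minus_def)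
    obtain x where x: "\<forall>i \<in> I'. x i \<in> M" "\<exists>i \<in> I'. x i \<noteq> \<zero>" "\<forall>h \<in> H. (\<Oplus>i\<in>I'. c' h i \<otimes> x i) = \<zero>"
      using insert.IH[of I' c'] c'M I by auto
    have xc: "x i \<in> carrier R" if "i \<in> I'" for i using x(1) Mc that by auto
    define S where "S h = (\<Oplus>i\<in>I'. c h i \<otimes> x i)" for h
    have SM: "S h \<in> M" if "h \<in> insert h0 H" for h
      unfolding S_def using that x(1) cM I subringE(6)[OF Mr] by (intro finsum_in_subring[OF Mr]) auto
    then have Sc: "S h \<in> carrier R" if "h \<in> insert h0 H" for h using that Mc by auto
    \<comment> \<open>The value at \<open>j\<close> is the one forced by equation
      \<open>h0\<close>.\<close>
    define x' where "x' = x(j := \<ominus> (u \<otimes> S h0))"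
    have x'j: "x' j \<in> M" using uM SM[of h0] subringE(5,6)[OF Mr] by (auto simp: x'_def)
    have x'M: "x' i \<in> M" if "i \<in> I" for i
      using that x'j x(1) I by (cases "i = j") (auto simp: x'_def)
    have sum: "(\<Oplus>i\<in>I. c h i \<otimes> x' i) = c h j \<otimes> (\<ominus> (u \<otimes> S h0)) \<oplus> S h" if h: "h \<in> insert h0 H" for h
    proof -
      have "(\<Oplus>i\<in>I. c h i \<otimes> x' i) = c h j \<otimes> x' j \<oplus> (\<Oplus>i\<in>I'. c h i \<otimes> x' i)"
        unfolding I(1) using I x'M cc[OF h] Mc
        by (intro finsum_insert) (auto simp: subset_iff)
      also have "(\<Oplus>i\<in>I'. c h i \<otimes> x' i) = S h"
        unfolding S_def using I cc[OF h] xc by (intro add.finprod_cong') (auto simp: x'_def)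
      finally show ?thesis by (simp add: x'_def)
    qed
    have "(\<Oplus>i\<in>I. c h i \<otimes> x' i) = \<zero>" if h: "h \<in> insert h0 H" for h
    proof (cases "h = h0")
      case True
      have "c h0 j \<otimes> (\<ominus> (u \<otimes> S h0)) \<oplus> S h0 = \<ominus> ((c h0 j \<otimes> u) \<otimes> S h0) \<oplus> S h0"
        using cc[of h0 j] j uc Sc[of h0] by (simp add: r_minus m_assoc)
      then show ?thesis using sum[OF h] True uinv Sc[of h0] by (simp add: l_neg)
    next
      case False
      then have hH: "h \<in> H" using h by simp
      have k: "c h j \<otimes> u \<in> carrier R" using cc[OF h j(1)] uc by simp
      have "\<zero> = (\<Oplus>i\<in>I'. c' h i \<otimes> x i)" using x(3) hH by simp
      also have "\<dots> = (\<Oplus>i\<in>I'. c h i \<otimes> x i \<oplus> (\<ominus> (c h j \<otimes> u)) \<otimes> (c h0 i \<otimes> x i))"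
      proof (intro add.finprod_cong' refl)
        fix i assume i: "i \<in> I'"
        have "c h i \<in> carrier R" "c h0 i \<in> carrier R" "x i \<in> carrier R"
          using cc h i I xc by auto
        then show "c' h i \<otimes> x i = c h i \<otimes> x i \<oplus> (\<ominus> (c h j \<otimes> u)) \<otimes> (c h0 i \<otimes> x i)"
          unfolding c'_def using k by algebra
      qed (use cc[OF h] cc[of h0] k xc I in auto)
      also have "\<dots> = S h \<oplus> (\<Oplus>i\<in>I'. (\<ominus> (c h j \<otimes> u)) \<otimes> (c h0 i \<otimes> x i))"
        unfolding S_def using cc[OF h] cc[of h0] k xc I by (intro finsum_addf) auto
      also have "(\<Oplus>i\<in>I'. (\<ominus> (c h j \<otimes> u)) \<otimes> (c h0 i \<otimes> x i)) = (\<ominus> (c h j \<otimes> u)) \<otimes> S h0"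
        unfolding S_def using cc[of h0] k xc I by (intro finsum_rdistr[symmetric]) auto
      finally have e: "\<zero> = S h \<oplus> (\<ominus> (c h j \<otimes> u)) \<otimes> S h0" .
      have "c h j \<otimes> (\<ominus> (u \<otimes> S h0)) \<oplus> S h = S h \<oplus> (\<ominus> (c h j \<otimes> u)) \<otimes> S h0"
      proof -
        have "c h j \<in> carrier R" "S h0 \<in> carrier R" "S h \<in> carrier R"
          using cc[OF h j(1)] Sc[of h0] Sc[OF h] by auto
        then show ?thesis using uc by algebra
      qed
      then show ?thesis using sum[OF h] e by simp
    qed
    moreover have "\<exists>i \<in> I. x' i \<noteq> \<zero>" using x(2) I by (auto simp: x'_def)
    ultimately show ?thesis using x'M by (intro exI[of _ x']) auto
  qed
qed

text \<open>Dedekind's shortening of a relation. For \<open>e0\<close> with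
  \<open>h0 e0 \<noteq> g e0\<close>, the relation at \<open>e0 \<otimes> e\<close> minus
  \<open>g e0\<close> times the relation at \<open>e\<close> loses its term at \<open>g\<close>,
  while the coefficient at \<open>h0\<close> is only multiplied by a nonzero element. Once all other
  coefficients vanish, evaluation at \<open>\<one>\<close> removes \<open>a g\<close>.\<close>

lemma embeddings_linearly_independent:
  assumes E: "subfield E R" and M: "subfield M R" and "finite S" "S \<subseteq> embeddings K E M"
    and "\<And>g h. g \<in> S \<Longrightarrow> h \<in> S \<Longrightarrow> (\<forall>x \<in> E. g x = h x) \<Longrightarrow> g = h"
    and "\<And>h. h \<in> S \<Longrightarrow> a h \<in> M"
    and "\<And>e. e \<in> E \<Longrightarrow> (\<Oplus>h\<in>S. a h \<otimes> h e) = \<zero>" and "h \<in> S"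
  shows "a h = \<zero>"
  using assms(3-)
proof (induction S arbitrary: a h rule: finite_induct)
  case empty
  then show ?case by simp
next
  case (insert g S)
  have Mc: "M \<subseteq> carrier R" by (rule subfieldE(3)[OF M])
  note Mr = subfieldE(1)[OF M] and Er = subfieldE(1)[OF E]
  have emb: "h \<in> embeddings K E M" if "h \<in> insert g S" for h using insert.prems(1) that by auto
  have hc: "h e \<in> carrier R" "h e \<in> M" if "h \<in> insert g S" "e \<in> E" for h e
    using embeddingsD(1)[OF emb] that Mc by auto
  have ac: "a h \<in> carrier R" "a h \<in> M" if "h \<in> insert g S" for h
    using insert.prems(3)[OF that] Mc by auto
  have split: "a g \<otimes> g e \<oplus> (\<Oplus>h\<in>S. a h \<otimes> h e) = \<zero>" if e: "e \<in> E" for e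
    using insert.prems(4)[OF e] insert.hyps ac hc[OF _ e] by (subst (asm) finsum_insert) auto
  have zero: "a h0 = \<zero>" if h0: "h0 \<in> S" for h0
  proof -
    obtain e0 where e0: "e0 \<in> E" "h0 e0 \<noteq> g e0"
      using insert.prems(2)[of h0 g] h0 insert.hyps by blast
    define b where "b h = a h \<otimes> (h e0 \<ominus> g e0)" for h
    have "b h0 = \<zero>"
    proof (rule insert.IH[of b h0])
      show "S \<subseteq> embeddings K E M" using insert.prems(1) by auto
      show "g' = h'" if "g' \<in> S" "h' \<in> S" "\<forall>x\<in>E. g' x = h' x" for g' h'
        using insert.prems(2)[of g' h'] that by auto
      show "b h \<in> M" if "h \<in> S" for h
        using that ac(2) hc(2) e0 subringE(5,6,7)[OF Mr] by (auto simp: b_def a_minus_def)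
      show "(\<Oplus>h\<in>S. b h \<otimes> h e) = \<zero>" if e: "e \<in> E" for e
      proof -
        have ee: "e0 \<otimes> e \<in> E" using e e0 subringE(6)[OF Er] by auto
        have c: "g e0 \<in> carrier R" "g e \<in> carrier R" "a g \<in> carrier R" using hc e e0 ac by auto
        let ?T1 = "\<Oplus>h\<in>S. a h \<otimes> h (e0 \<otimes> e)" and ?T2 = "\<Oplus>h\<in>S. a h \<otimes> h e"
        have T: "?T1 \<in> carrier R" "?T2 \<in> carrier R"
          using ac hc[OF _ e] hc[OF _ ee] by (auto intro!: finsum_closed)
        have "(\<Oplus>h\<in>S. b h \<otimes> h e) = (\<Oplus>h\<in>S. a h \<otimes> h (e0 \<otimes> e) \<oplus> (\<ominus> g e0) \<otimes> (a h \<otimes> h e))"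
        proof (intro add.finprod_cong' refl)
          fix h assume h: "h \<in> S"
          have "h (e0 \<otimes> e) = h e0 \<otimes> h e" using embeddingsD(2)[OF emb] h e e0 by auto
          moreover have "a h \<in> carrier R" "h e0 \<in> carrier R" "h e \<in> carrier R" using ac hc e e0 h by auto
          moreover from this have "a h \<otimes> (h e0 \<ominus> g e0) \<otimes> h e = a h \<otimes> (h e0 \<otimes> h e) \<oplus> (\<ominus> g e0) \<otimes> (a h \<otimes> h e)"
            using c by algebra
          ultimately show "b h \<otimes> h e = a h \<otimes> h (e0 \<otimes> e) \<oplus> (\<ominus> g e0) \<otimes> (a h \<otimes> h e)"
            unfolding b_def by simp
        qed (use ac hc[OF _ e] hc[OF _ ee] c in auto)
        also have "\<dots> = ?T1 \<oplus> (\<Oplus>h\<in>S. (\<ominus> g e0) \<otimes> (a h \<otimes> h e))"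
          using ac hc[OF _ e] hc[OF _ ee] c insert.hyps by (intro finsum_addf) auto
        also have "(\<Oplus>h\<in>S. (\<ominus> g e0) \<otimes> (a h \<otimes> h e)) = (\<ominus> g e0) \<otimes> ?T2"
          using ac hc[OF _ e] c insert.hyps by (intro finsum_rdistr[symmetric]) auto
        finally have 1: "(\<Oplus>h\<in>S. b h \<otimes> h e) = ?T1 \<oplus> (\<ominus> g e0) \<otimes> ?T2" .
        have gg: "g (e0 \<otimes> e) = g e0 \<otimes> g e" using embeddingsD(2)[OF emb] e e0 by auto
        have "?T1 \<oplus> (\<ominus> g e0) \<otimes> ?T2 = (a g \<otimes> (g e0 \<otimes> g e) \<oplus> ?T1) \<ominus> g e0 \<otimes> (a g \<otimes> g e \<oplus> ?T2)"
        proof -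
          have "t1 \<oplus> (\<ominus> p) \<otimes> t2 = (d \<otimes> (p \<otimes> q) \<oplus> t1) \<ominus> p \<otimes> (d \<otimes> q \<oplus> t2)"
            if "t1 \<in> carrier R" "t2 \<in> carrier R" "p \<in> carrier R" "q \<in> carrier R" "d \<in> carrier R"
            for t1 t2 p q d
            using that by algebra
          from this[OF T c] show ?thesis .
        qed
        also have "\<dots> = \<zero>" using split[OF e] split[OF ee] gg c by (simp add: a_minus_def)
        finally show ?thesis using 1 by simp
      qed
    qed (use h0 in auto)
    moreover have "h0 e0 \<ominus> g e0 \<noteq> \<zero>" using e0 hc[of h0 e0] hc[of g e0] h0 by (simp add: r_right_minus_eq)
    ultimately show ?thesis
      using integral[of "a h0" "h0 e0 \<ominus> g e0"] ac[of h0] hc[of h0 e0] hc[of g e0] h0 e0 by (auto simp: b_def)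
  qed
  have "\<one> \<in> E" using subringE(3)[OF Er] .
  have "(\<Oplus>h\<in>S. a h \<otimes> h \<one>) = (\<Oplus>h\<in>S. \<zero>)"
    using zero hc[OF _ \<open>\<one> \<in> E\<close>] by (intro add.finprod_cong') auto
  then have "a g = \<zero>"
    using split[OF \<open>\<one> \<in> E\<close>] embeddingsD(4)[OF emb[of g]] ac[of g] by simp
  then show ?case using zero insert.prems(5) by (cases "h = g") simp_all
qed

lemma subfield_subalgebra:
  assumes "subfield K R" "subring F R" "K \<subseteq> F"
  shows "subalgebra K F R"
proof -
  interpret F: subring F R by (rule assms(2))
  show ?thesis
    using assms(3) subringE(6)[OF assms(2)] F.subgroup_axioms
    by (auto simp: subalgebra_def subalgebra_axioms_def)
qed

text \<open>With more than \<open>n\<close> embeddings \<open>h\<close>, the linear equations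
  \<open>sum of h v * x h = 0\<close>, one for each basis vector \<open>v\<close>, have a nontrivial
  solution \<open>x\<close>. As the embeddings are \<open>K\<close>-linear, the relation extends
  from the basis to all of \<open>E\<close> and contradicts their independence. Finite subfamilies
  are treated first, because finiteness of \<open>S\<close> is part of the claim.\<close>

lemma embeddings_card_le_dimension:
  assumes K: "subfield K R" and E: "subfield E R" and M: "subfield M R" and KE: "K \<subseteq> E"
    and dim: "dimension n K E" and S: "S \<subseteq> embeddings K E M"
    and dist: "\<And>g h. g \<in> S \<Longrightarrow> h \<in> S \<Longrightarrow> (\<forall>x \<in> E. g x = h x) \<Longrightarrow> g = h"
  shows "finite S" "card S \<le> n"
proof -
  have "card T \<le> n" if T: "T \<subseteq> S" "finite T" for T
  proof (rule ccontr)
    assume neg: "\<not> card T \<le> n"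
    obtain Vs where Vs: "set Vs \<subseteq> carrier R" "independent K Vs" "length Vs = n" "Span K Vs = E"
      using exists_base[OF K dim] by auto
    have VE: "set Vs \<subseteq> E" using Span_base_incl[OF K Vs(1)] Vs(4) by simp
    have Mc: "M \<subseteq> carrier R" by (rule subfieldE(3)[OF M])
    note Er = subfieldE(1)[OF E]
    have emb: "h \<in> embeddings K E M" if "h \<in> T" for h using that S T by auto
    have "\<exists>x. (\<forall>h \<in> T. x h \<in> M) \<and> (\<exists>h \<in> T. x h \<noteq> \<zero>)
        \<and> (\<forall>v \<in> set Vs. (\<Oplus>h\<in>T. h v \<otimes> x h) = \<zero>)"
    proof (rule linear_system_nontrivial_solution[OF M, of "set Vs" T "\<lambda>v h. h v"])
      show "card (set Vs) < card T" using neg card_length[of Vs] Vs(3) by simp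
      show "h v \<in> M" if "v \<in> set Vs" "h \<in> T" for v h
        using that VE embeddingsD(1)[OF emb] by auto
    qed (use T in auto)
    then obtain x where x: "\<forall>h \<in> T. x h \<in> M" "\<exists>h \<in> T. x h \<noteq> \<zero>"
      "\<forall>v \<in> set Vs. (\<Oplus>h\<in>T. h v \<otimes> x h) = \<zero>" by auto
    have xc: "x h \<in> carrier R" if "h \<in> T" for h using x(1) Mc that by auto
    have hc: "h e \<in> carrier R" if "h \<in> T" "e \<in> E" for h e
      using embeddingsD(1)[OF emb] that Mc by auto
    define W where "W = {e \<in> E. (\<Oplus>h\<in>T. h e \<otimes> x h) = \<zero>}"
    have Ec: "E \<subseteq> carrier R" by (rule subfieldE(3)[OF E])
    have smult: "k \<otimes> w \<in> W" if k: "k \<in> K" and w: "w \<in> W" for k w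
    proof -
      have wE: "w \<in> E" and w0: "(\<Oplus>h\<in>T. h w \<otimes> x h) = \<zero>" using w by (auto simp: W_def)
      have kc: "k \<in> carrier R" using k subfieldE(3)[OF K] by auto
      have kw: "k \<otimes> w \<in> E" using k wE KE subringE(6)[OF Er] by auto
      have "(\<Oplus>h\<in>T. h (k \<otimes> w) \<otimes> x h) = (\<Oplus>h\<in>T. k \<otimes> (h w \<otimes> x h))"
      proof (intro add.finprod_cong' refl)
        fix h assume h: "h \<in> T"
        have "h (k \<otimes> w) = k \<otimes> h w" using embeddingsD(2)[OF emb[OF h], of k w] embeddingsD(5)[OF emb[OF h] k] k KE wE by auto
        then show "h (k \<otimes> w) \<otimes> x h = k \<otimes> (h w \<otimes> x h)" using hc[OF h wE] xc[OF h] kc by (simp add: m_assoc)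
      qed (use hc[OF _ wE] xc kc in auto)
      also have "\<dots> = k \<otimes> (\<Oplus>h\<in>T. h w \<otimes> x h)"
        using hc[OF _ wE] xc kc T by (intro finsum_rdistr[symmetric]) auto
      finally show ?thesis using w0 kc kw by (simp add: W_def)
    qed
    have addW: "v \<oplus> w \<in> W" if "v \<in> W" "w \<in> W" for v w
    proof -
      have vw: "v \<in> E" "w \<in> E" "(\<Oplus>h\<in>T. h v \<otimes> x h) = \<zero>" "(\<Oplus>h\<in>T. h w \<otimes> x h) = \<zero>"
        using that by (auto simp: W_def)
      have "(\<Oplus>h\<in>T. h (v \<oplus> w) \<otimes> x h) = (\<Oplus>h\<in>T. h v \<otimes> x h \<oplus> h w \<otimes> x h)"
      proof (intro add.finprod_cong' refl)
        fix h assume h: "h \<in> T"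
        show "h (v \<oplus> w) \<otimes> x h = h v \<otimes> x h \<oplus> h w \<otimes> x h"
          using embeddingsD(3)[OF emb[OF h] vw(1,2)] hc[OF h vw(1)] hc[OF h vw(2)] xc[OF h]
          by (simp add: l_distr)
      qed (use hc[OF _ vw(1)] hc[OF _ vw(2)] xc in auto)
      also have "\<dots> = (\<Oplus>h\<in>T. h v \<otimes> x h) \<oplus> (\<Oplus>h\<in>T. h w \<otimes> x h)"
        using hc[OF _ vw(1)] hc[OF _ vw(2)] xc T by (intro finsum_addf) auto
      finally show ?thesis using vw subringE(7)[OF Er] by (simp add: W_def)
    qed
    have zW: "\<zero> \<in> W"
    proof -
      have "(\<Oplus>h\<in>T. h \<zero> \<otimes> x h) = (\<Oplus>h\<in>T. \<zero>)"
      proof (intro add.finprod_cong' refl)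
        fix h assume h: "h \<in> T"
        show "h \<zero> \<otimes> x h = \<zero>" using embeddings_props(1)[OF E M emb[OF h]] xc[OF h] by simp
      qed auto
      then show ?thesis using subringE(2)[OF Er] by (simp add: W_def)
    qed
    have "subalgebra K W R"
    proof (intro subalgebra.intro subalgebra_axioms.intro smult)
      have "\<ominus> \<one> \<in> K" using subringE(3,5)[OF subfieldE(1)[OF K]] by auto
      then have neg: "\<ominus> w \<in> W" if "w \<in> W" for w
      proof -
        have "w \<in> carrier R" using that Ec by (auto simp: W_def)
        then have "\<ominus> w = \<ominus> \<one> \<otimes> w" by (simp add: l_minus)
        then show ?thesis using smult[OF \<open>\<ominus> \<one> \<in> K\<close> that] by simp
      qed
      show "subgroup W (add_monoid R)"
      proof (rule add.subgroupI)
        show "W \<subseteq> carrier R" using Ec by (auto simp: W_def)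
        show "W \<noteq> {}" using zW by auto
      qed (use neg addW in auto)
    qed
    moreover have "set Vs \<subseteq> W" using x(3) VE by (auto simp: W_def)
    ultimately have "E \<subseteq> W" using subalgebra_Span_incl[OF K] Vs(4) by auto
    then have "(\<Oplus>h\<in>T. h e \<otimes> x h) = \<zero>" if "e \<in> E" for e
      using that by (auto simp: W_def)
    moreover have "(\<Oplus>h\<in>T. x h \<otimes> h e) = (\<Oplus>h\<in>T. h e \<otimes> x h)" if "e \<in> E" for e
      using that hc xc by (intro add.finprod_cong') (auto simp: m_comm)
    ultimately have z: "(\<Oplus>h\<in>T. x h \<otimes> h e) = \<zero>" if "e \<in> E" for e using that by simp
    have "x h = \<zero>" if "h \<in> T" for h
    proof (rule embeddings_linearly_independent[OF E M T(2) _ _ _ z that])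
      show "T \<subseteq> embeddings K E M" using emb by auto
      show "g = h" if "g \<in> T" "h \<in> T" "\<forall>x\<in>E. g x = h x" for g h using dist that T by auto
    qed (use x(1) in auto)
    then show False using x(2) by auto
  qed
  then show "finite S" "card S \<le> n"
    using finite_if_finite_subsets_card_bdd[of S n] by auto
qed

section \<open>Artin's theorem\<close>

lemma combine_eq_finsum:
  assumes "length Ks = length Us" "set Ks \<subseteq> carrier R" "set Us \<subseteq> carrier R"
  shows "combine Ks Us = (\<Oplus>i\<in>{..<length Us}. Ks ! i \<otimes> Us ! i)"
  using assms
proof (induction Ks arbitrary: Us rule: rev_induct)
  case Nil
  then show ?case by simp
next
  case (snoc k Ks Vs)
  then obtain u Us where Vs: "Vs = Us @ [u]" by (cases Vs rule: rev_cases) auto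
  have len: "length Ks = length Us" and c: "set Ks \<subseteq> carrier R" "set Us \<subseteq> carrier R" "k \<in> carrier R" "u \<in> carrier R"
    using snoc.prems Vs by auto
  have nth: "Ks ! i \<in> carrier R" "Us ! i \<in> carrier R" if "i < length Us" for i
    using that c len by (auto simp: subset_iff)
  have "(\<Oplus>i\<in>{..<length (Us @ [u])}. (Ks @ [k]) ! i \<otimes> (Us @ [u]) ! i)
      = (\<Oplus>i\<in>insert (length Us) {..<length Us}. (Ks @ [k]) ! i \<otimes> (Us @ [u]) ! i)"
    by (simp add: lessThan_Suc)
  also have "\<dots> = (k \<otimes> u) \<oplus> (\<Oplus>i\<in>{..<length Us}. (Ks @ [k]) ! i \<otimes> (Us @ [u]) ! i)"
    using nth c len by (subst finsum_insert) (auto simp: nth_append)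
  also have "(\<Oplus>i\<in>{..<length Us}. (Ks @ [k]) ! i \<otimes> (Us @ [u]) ! i) = (\<Oplus>i\<in>{..<length Us}. Ks ! i \<otimes> Us ! i)"
    using nth len by (intro add.finprod_cong') (auto simp: nth_append)
  also have "\<dots> = combine Ks Us" using snoc.IH[of Us] len c by simp
  finally have 1: "(\<Oplus>i\<in>{..<length (Us @ [u])}. (Ks @ [k]) ! i \<otimes> (Us @ [u]) ! i) = (k \<otimes> u) \<oplus> combine Ks Us" .
  have "combine (Ks @ [k]) (Us @ [u]) = combine Ks Us \<oplus> combine [k] [u]"
    using combine_append[OF len c(1,2), of "[k]" "[u]"] c by simp
  also have "\<dots> = (k \<otimes> u) \<oplus> combine Ks Us"
    using c combine_in_carrier[OF c(1,2)] by (simp add: a_comm)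
  finally show ?case using 1 Vs by simp
qed

definition fixed_field :: "'a set \<Rightarrow> ('a \<Rightarrow> 'a) set \<Rightarrow> 'a set"
  where "fixed_field M D = {x \<in> M. \<forall>d \<in> D. d x = x}"

lemma fixed_field_subfield:
  assumes M: "subfield M R" and D: "D \<subseteq> embeddings K M M"
  shows "subfield (fixed_field M D) R"
proof (rule subfieldI')
  note Mr = subfieldE(1)[OF M]
  have emb: "d \<in> embeddings K M M" if "d \<in> D" for d using D that by auto
  note e = embeddingsD[OF emb] and p = embeddings_props[OF M M emb]
  have fixD: "x \<in> M" "d x = x" if "x \<in> fixed_field M D" "d \<in> D" for x d
    using that unfolding fixed_field_def by blast+
  show "subring (fixed_field M D) R"
  proof (rule subringI)
    show "fixed_field M D \<subseteq> carrier R" using subfieldE(3)[OF M] by (auto simp: fixed_field_def)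
    show "\<one> \<in> fixed_field M D" using e(4) subringE(3)[OF Mr] by (auto simp: fixed_field_def)
    show "\<ominus> h \<in> fixed_field M D" if h: "h \<in> fixed_field M D" for h
    proof -
      have "d (\<ominus> h) = \<ominus> h" if "d \<in> D" for d
        using p(2)[OF that, of h] fixD[OF h that] by simp
      then show ?thesis using h subringE(5)[OF Mr] by (simp add: fixed_field_def)
    qed
    fix h1 h2 assume h: "h1 \<in> fixed_field M D" "h2 \<in> fixed_field M D"
    have "d (h1 \<otimes> h2) = h1 \<otimes> h2" "d (h1 \<oplus> h2) = h1 \<oplus> h2" if "d \<in> D" for d
      using e(2,3)[OF that, of h1 h2] fixD[OF h(1) that] fixD[OF h(2) that] by simp_all
    then show "h1 \<otimes> h2 \<in> fixed_field M D" "h1 \<oplus> h2 \<in> fixed_field M D"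
      using h subringE(6,7)[OF Mr] by (simp_all add: fixed_field_def)
  qed
  show "inv k \<in> fixed_field M D" if k: "k \<in> fixed_field M D - {\<zero>}" for k
  proof -
    have kM: "k \<in> M - {\<zero>}" "k \<in> carrier R" using k subfieldE(3)[OF M] by (auto simp: fixed_field_def)
    note i = subfield_m_inv[OF M kM(1)]
    have "d (inv k) = inv k" if d: "d \<in> D" for d
    proof -
      have "k \<otimes> d (inv k) = d (k \<otimes> inv k)"
        using e(2)[OF d, of k "inv k"] kM(1) i(1) fixD[OF _ d, of k] k by simp
      also have "\<dots> = k \<otimes> inv k" using i e(4)[OF d] by simp
      finally show ?thesis
        using m_lcancel[of k "d (inv k)" "inv k"] kM i(1) e(1)[OF d, of "inv k"] subfieldE(3)[OF M] by auto
    qed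
    then show ?thesis using i(1) by (auto simp: fixed_field_def)
  qed
qed

text \<open>Artin's argument: a solution with minimal support of the system
  \<open>\<Sum>\<^sub>i h(e\<^sub>i) x\<^sub>i = 0\<close>, normalised to have an entry \<open>1\<close>, is fixed by \<open>D\<close>.\<close>

lemma artin_independent_bound:
  assumes M: "subfield M R" and D: "D \<subseteq> embeddings K M M"
    and H: "finite H" "\<And>h e. h \<in> H \<Longrightarrow> e \<in> set es \<Longrightarrow> h e \<in> M"
    and perm: "\<And>d h'. d \<in> D \<Longrightarrow> h' \<in> H \<Longrightarrow> \<exists>h \<in> H. \<forall>e \<in> set es. d (h e) = h' e"
    and id: "\<exists>h \<in> H. \<forall>e \<in> set es. h e = e"
    and ind: "independent (fixed_field M D) es"
  shows "length es \<le> card H"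
proof (rule ccontr)
  assume neg: "\<not> length es \<le> card H"
  define I where "I = {..<length es}"
  have I: "finite I" "card H < card I" using neg by (auto simp: I_def)
  have Mc: "M \<subseteq> carrier R" by (rule subfieldE(3)[OF M])
  note Mr = subfieldE(1)[OF M]
  have eI: "es ! i \<in> set es" if "i \<in> I" for i using that by (auto simp: I_def)
  have hM: "h (es ! i) \<in> M" if "h \<in> H" "i \<in> I" for h i using H(2) eI that by auto
  then have hc: "h (es ! i) \<in> carrier R" if "h \<in> H" "i \<in> I" for h i using that Mc by auto
  define sol where "sol x \<longleftrightarrow> (\<forall>i \<in> I. x i \<in> M) \<and> (\<exists>i \<in> I. x i \<noteq> \<zero>)
      \<and> (\<forall>h \<in> H. (\<Oplus>i\<in>I. h (es ! i) \<otimes> x i) = \<zero>)" for x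
  define supp where "supp x = {i \<in> I. x i \<noteq> \<zero>}" for x :: "nat \<Rightarrow> 'a"
  have "\<exists>x. sol x"
    unfolding sol_def by (rule linear_system_nontrivial_solution[OF M H(1) I hM])
  then obtain x where x: "sol x" and min: "\<And>y. sol y \<Longrightarrow> card (supp x) \<le> card (supp y)"
    using ex_has_least_nat[of sol _ "\<lambda>x. card (supp x)"] by blast
  have fin_supp: "finite (supp y)" for y using I(1) by (auto simp: supp_def)
  obtain j where j: "j \<in> I" "x j \<noteq> \<zero>" using x by (auto simp: sol_def)
  have xM: "x i \<in> M" if "i \<in> I" for i using x that by (auto simp: sol_def)
  have u: "inv (x j) \<in> M" "x j \<otimes> inv (x j) = \<one>" "inv (x j) \<otimes> x j = \<one>"
    using subfield_m_inv[OF M, of "x j"] j xM by auto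
  define z where "z i = x i \<otimes> inv (x j)" for i
  have xc: "x i \<in> carrier R" if "i \<in> I" for i using xM that Mc by auto
  have uc: "inv (x j) \<in> carrier R" using u Mc by auto
  have zM: "z i \<in> M" if "i \<in> I" for i using xM that u subringE(6)[OF Mr] by (auto simp: z_def)
  then have zc: "z i \<in> carrier R" if "i \<in> I" for i using Mc that by auto
  have zj: "z j = \<one>" using u by (simp add: z_def)
  have zx: "z i = \<zero> \<longleftrightarrow> x i = \<zero>" if "i \<in> I" for i
    using integral_iff[OF xc[OF that] uc] u(2) xc[OF j(1)] uc by (auto simp: z_def)
  have zsum: "(\<Oplus>i\<in>I. h (es ! i) \<otimes> z i) = \<zero>" if h: "h \<in> H" for h
  proof -
    have "(\<Oplus>i\<in>I. h (es ! i) \<otimes> z i) = (\<Oplus>i\<in>I. (h (es ! i) \<otimes> x i) \<otimes> inv (x j))"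
      using hc[OF h] xc uc by (intro add.finprod_cong') (auto simp: z_def m_assoc)
    also have "\<dots> = (\<Oplus>i\<in>I. h (es ! i) \<otimes> x i) \<otimes> inv (x j)"
      using hc[OF h] xc uc I by (intro finsum_ldistr[symmetric]) auto
    also have "\<dots> = \<zero>" using x h uc by (simp add: sol_def)
    finally show ?thesis .
  qed
  have fixed: "d (z i) = z i" if d: "d \<in> D" and i: "i \<in> I" for d i
  proof (rule ccontr)
    assume ne: "d (z i) \<noteq> z i"
    have emb: "d \<in> embeddings K M M" using d D by auto
    note e = embeddingsD[OF emb] and p = embeddings_props[OF M M emb]
    \<comment> \<open>Applying \<open>d\<close> to the equation of a suitable \<open>h\<close> gives
      the equation of \<open>h'\<close> for the vector \<open>d (z i)\<close>, so \<open>y\<close>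
      is again a solution. It vanishes wherever \<open>z\<close> does and also at \<open>j\<close>,
      since \<open>d\<close> fixes \<open>z j = \<one>\<close>; its support is therefore smaller
      than the minimal one.\<close>
    define y where "y i = z i \<ominus> d (z i)" for i
    have dz: "d (z i) \<in> M" "d (z i) \<in> carrier R" if "i \<in> I" for i using e(1) zM that Mc by auto
    have yM: "y i \<in> M" if "i \<in> I" for i
      using zM[OF that] dz[OF that] subringE(5,7)[OF Mr] by (auto simp: y_def a_minus_def)
    have "(\<Oplus>i\<in>I. h' (es ! i) \<otimes> y i) = \<zero>" if h': "h' \<in> H" for h'
    proof -
      obtain h where h: "h \<in> H" "\<forall>e \<in> set es. d (h e) = h' e" using perm[OF d h'] by auto
      have fs: "d (\<Oplus>i\<in>J. f i) = (\<Oplus>i\<in>J. d (f i))" if "finite J" "\<And>i. i \<in> J \<Longrightarrow> f i \<in> M" for J and f :: "nat \<Rightarrow> 'a"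
        using that
      proof (induction J rule: finite_induct)
        case empty
        then show ?case using p(1) by simp
      next
        case (insert a J)
        have "(\<Oplus>i\<in>J. f i) \<in> M" by (rule finsum_in_subring[OF Mr]) (use insert in auto)
        moreover have "f \<in> J \<rightarrow> carrier R" "f a \<in> carrier R" "(\<lambda>i. d (f i)) \<in> J \<rightarrow> carrier R" "d (f a) \<in> carrier R"
          using insert.prems e(1) Mc by auto
        ultimately show ?case using insert e(3) by simp
      qed
      have hz: "h (es ! i) \<otimes> z i \<in> M" if "i \<in> I" for i
        using hM[OF h(1) that] zM[OF that] subringE(6)[OF Mr] by auto
      have "\<zero> = d (\<Oplus>i\<in>I. h (es ! i) \<otimes> z i)" using zsum[OF h(1)] p(1) by simp
      also have "\<dots> = (\<Oplus>i\<in>I. d (h (es ! i) \<otimes> z i))" by (rule fs[OF I(1) hz])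
      also have "\<dots> = (\<Oplus>i\<in>I. h' (es ! i) \<otimes> d (z i))"
      proof (intro add.finprod_cong' refl)
        fix i assume i: "i \<in> I"
        show "d (h (es ! i) \<otimes> z i) = h' (es ! i) \<otimes> d (z i)"
          using e(2)[OF hM[OF h(1) i] zM[OF i]] h(2) eI[OF i] by simp
      qed (use hc[OF h'] dz in auto)
      finally have 1: "(\<Oplus>i\<in>I. h' (es ! i) \<otimes> d (z i)) = \<zero>" by simp
      have "(\<Oplus>i\<in>I. h' (es ! i) \<otimes> y i) = (\<Oplus>i\<in>I. h' (es ! i) \<otimes> z i \<oplus> (\<ominus> \<one>) \<otimes> (h' (es ! i) \<otimes> d (z i)))"
      proof (intro add.finprod_cong' refl)
        fix i assume i: "i \<in> I"
        have "h' (es ! i) \<in> carrier R" "z i \<in> carrier R" "d (z i) \<in> carrier R"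
          using hc[OF h' i] zc[OF i] dz[OF i] by auto
        then show "h' (es ! i) \<otimes> y i = h' (es ! i) \<otimes> z i \<oplus> (\<ominus> \<one>) \<otimes> (h' (es ! i) \<otimes> d (z i))"
          by (simp add: y_def a_minus_def r_distr r_minus l_minus)
      qed (use hc[OF h'] zc dz in auto)
      also have "\<dots> = (\<Oplus>i\<in>I. h' (es ! i) \<otimes> z i) \<oplus> (\<Oplus>i\<in>I. (\<ominus> \<one>) \<otimes> (h' (es ! i) \<otimes> d (z i)))"
        using hc[OF h'] zc dz by (intro finsum_addf) auto
      also have "(\<Oplus>i\<in>I. (\<ominus> \<one>) \<otimes> (h' (es ! i) \<otimes> d (z i))) = (\<ominus> \<one>) \<otimes> (\<Oplus>i\<in>I. h' (es ! i) \<otimes> d (z i))"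
        using hc[OF h'] dz I by (intro finsum_rdistr[symmetric]) auto
      finally show ?thesis using zsum[OF h'] 1 by simp
    qed
    moreover have "y i \<noteq> \<zero>" using ne zc[OF i] dz[OF i] by (simp add: y_def r_right_minus_eq)
    ultimately have "sol y" using yM i by (auto simp: sol_def)
    moreover have "supp y \<subset> supp x"
    proof
      show "supp y \<subseteq> supp x"
      proof
        fix i assume i: "i \<in> supp y"
        then have iI: "i \<in> I" by (simp add: supp_def)
        have "z i \<noteq> \<zero>"
        proof
          assume "z i = \<zero>"
          then have "y i = \<zero>" using p(1) by (simp add: y_def r_right_minus_eq)
          then show False using i by (simp add: supp_def)
        qed
        then show "i \<in> supp x" using zx[OF iI] iI by (simp add: supp_def)
      qed
      have "y j = \<zero>" using zj e(4) by (simp add: y_def r_right_minus_eq)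
      then show "supp y \<noteq> supp x" using j by (auto simp: supp_def)
    qed
    then have "card (supp y) < card (supp x)" by (rule psubset_card_mono[OF fin_supp])
    ultimately show False using min[of y] by simp
  qed
  \<comment> \<open>At the member of \<open>H\<close> that is the identity on \<open>es\<close>, the
    system becomes a linear relation among \<open>es\<close> with coefficients in the fixed
    field.\<close>
  obtain h where h: "h \<in> H" "\<forall>e \<in> set es. h e = e" using id by auto
  have esc: "set es \<subseteq> carrier R" using independent_in_carrier[OF ind] .
  define Ks where "Ks = map z [0..<length es]"
  have len: "length Ks = length es" by (simp add: Ks_def)
  have KF: "set Ks \<subseteq> fixed_field M D" using zM fixed by (auto simp: Ks_def fixed_field_def I_def)
  have Kc: "set Ks \<subseteq> carrier R" using zc by (auto simp: Ks_def I_def)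
  have "combine Ks es = (\<Oplus>i\<in>I. Ks ! i \<otimes> es ! i)" unfolding I_def by (rule combine_eq_finsum[OF len Kc esc])
  also have "\<dots> = (\<Oplus>i\<in>I. h (es ! i) \<otimes> z i)"
  proof (intro add.finprod_cong' refl)
    fix i assume i: "i \<in> I"
    have "Ks ! i = z i" using i by (simp add: Ks_def I_def)
    then show "Ks ! i \<otimes> es ! i = h (es ! i) \<otimes> z i"
      using h(2) eI[OF i] zc[OF i] esc by (auto simp: m_comm subset_iff)
  qed (use hc[OF h(1)] zc in auto)
  also have "\<dots> = \<zero>" by (rule zsum[OF h(1)])
  finally have 0: "combine Ks es = \<zero>" .
  have "z j \<in> set (take (length es) Ks)" using j by (auto simp: Ks_def I_def)
  then have "\<not> set (take (length es) Ks) \<subseteq> {\<zero>}" using zj by auto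
  from non_trivial_combine_imp_dependent[OF fixed_field_subfield[OF M D] KF 0 this] ind
  show False by simp
qed

text \<open>A longest independent list in \<open>V\<close> spans \<open>V\<close>, since a vector
  outside its span could be added. This produces the existence of a dimension, which the relation
  \<open>dimension\<close> does not presuppose.\<close>

lemma bounded_independent_imp_dimension:
  assumes K: "subfield K R" and V: "subalgebra K V R"
    and bd: "\<And>Us. independent K Us \<Longrightarrow> set Us \<subseteq> V \<Longrightarrow> length Us \<le> n"
  shows "\<exists>m \<le> n. dimension m K V"
proof -
  define P where "P m \<longleftrightarrow> (\<exists>Us. set Us \<subseteq> V \<and> independent K Us \<and> length Us = m)" for m
  have "P 0" by (auto simp: P_def)
  moreover have "\<And>m. P m \<Longrightarrow> m \<le> n" using bd by (auto simp: P_def)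
  ultimately obtain m where m: "P m" "\<And>k. P k \<Longrightarrow> k \<le> m" using GreatestI_nat Greatest_le_nat by metis
  then obtain Us where Us: "set Us \<subseteq> V" "independent K Us" "length Us = m" by (auto simp: P_def)
  have "Span K Us = V"
  proof (rule ccontr)
    assume "Span K Us \<noteq> V"
    then obtain v where v: "v \<in> V" "v \<notin> Span K Us" using subalgebra_Span_incl[OF K V Us(1)] by blast
    then have "independent K (v # Us)"
      using independent.li_Cons[OF _ _ Us(2)] subalgebra_in_carrier[OF V] by auto
    then have "P (Suc m)" using Us v by (auto simp: P_def intro!: exI[of _ "v # Us"])
    then show False using m(2) by force
  qed
  then show ?thesis using dimensionI[OF K Us(2)] Us(3) \<open>\<And>m. P m \<Longrightarrow> m \<le> n\<close>[OF m(1)] by auto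
qed

section \<open>Galois groups as groups of bijections\<close>

lemma galois_groupD:
  assumes "s \<in> carrier (galois_group R M K)"
  shows "s \<in> embeddings K M M" "bij_betw s M M" "s \<in> extensional M" "s \<in> Bij M"
    "\<And>x. x \<in> K \<Longrightarrow> s x = x" "\<And>x. x \<in> M \<Longrightarrow> s x \<in> M"
  using assms by (auto simp: galois_group_iff embeddings_def Bij_def bij_betw_def)

lemma galois_group_subgroup_BijGroup:
  assumes M: "subfield M R" and K: "K \<subseteq> M"
  shows "subgroup (carrier (galois_group R M K)) (BijGroup M)"
proof
  show "carrier (galois_group R M K) \<subseteq> carrier (BijGroup M)"
    by (auto simp: galois_group_def BijGroup_def)
  note D = galois_groupD[of _ M K]
  note Mr = subfieldE(1)[OF M]
  show "x \<otimes>\<^bsub>BijGroup M\<^esub> y \<in> carrier (galois_group R M K)"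
    if x: "x \<in> carrier (galois_group R M K)" and y: "y \<in> carrier (galois_group R M K)" for x y
  proof -
    have "compose M x y \<in> Bij M" by (rule compose_Bij[OF D(4)[OF x] D(4)[OF y]])
    moreover have "compose M x y \<in> embeddings K M M"
      using embeddingsD[OF D(1)[OF x]] embeddingsD[OF D(1)[OF y]] subringE(3,6,7)[OF Mr] K
      by (intro embeddingsI) (auto simp: compose_def)
    ultimately show ?thesis using D(4)[OF x] D(4)[OF y] by (auto simp: BijGroup_def galois_group_iff Bij_def)
  qed
  show "\<one>\<^bsub>BijGroup M\<^esub> \<in> carrier (galois_group R M K)"
    using subringE(3,6,7)[OF Mr] K id_Bij[of M]
    by (auto simp: BijGroup_def galois_group_iff Bij_def intro!: embeddingsI)
  show "inv\<^bsub>BijGroup M\<^esub> x \<in> carrier (galois_group R M K)"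
    if x: "x \<in> carrier (galois_group R M K)" for x
  proof -
    let ?y = "inv_into M x"
    note e = embeddingsD[OF D(1)[OF x]]
    have inj: "inj_on x M" and img: "x ` M = M" using D(2)[OF x] by (auto simp: bij_betw_def)
    have y: "?y a \<in> M" "x (?y a) = a" if "a \<in> M" for a
      using that img by (auto intro: inv_into_into f_inv_into_f)
    have eqI: "?y a = b" if "b \<in> M" "x b = a" for a b using inv_into_f_f[OF inj that(1)] that(2) by simp
    have "restrict ?y M \<in> embeddings K M M"
    proof (rule embeddingsI)
      show "restrict ?y M a \<in> M" if "a \<in> M" for a using y that by simp
      show "restrict ?y M (a \<otimes> b) = restrict ?y M a \<otimes> restrict ?y M b" if "a \<in> M" "b \<in> M" for a b
        using y[OF that(1)] y[OF that(2)] subringE(6)[OF Mr] that e(2)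
        by (auto intro!: eqI)
      show "restrict ?y M (a \<oplus> b) = restrict ?y M a \<oplus> restrict ?y M b" if "a \<in> M" "b \<in> M" for a b
        using y[OF that(1)] y[OF that(2)] subringE(7)[OF Mr] that e(3)
        by (auto intro!: eqI)
      show "restrict ?y M \<one> = \<one>" using e(4) subringE(3)[OF Mr] by (auto intro!: eqI)
      show "restrict ?y M a = a" if "a \<in> K" for a using e(5)[OF that] that K by (auto intro!: eqI)
    qed
    moreover have "bij_betw (restrict ?y M) M M"
      using bij_betw_inv_into[OF D(2)[OF x]] by (simp add: bij_betw_restrict_eq)
    ultimately show ?thesis using inv_BijGroup[OF D(4)[OF x]] by (simp add: galois_group_iff)
  qed
qed

lemma galois_group_is_group:
  assumes M: "subfield M R" and K: "K \<subseteq> M"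
  shows "group (galois_group R M K)"
proof -
  have "galois_group R M K = (BijGroup M)\<lparr>carrier := carrier (galois_group R M K)\<rparr>"
    by (simp add: galois_group_def)
  then show ?thesis
    using subgroup.subgroup_is_group[OF galois_group_subgroup_BijGroup[OF assms] group_BijGroup] by metis
qed

lemma galois_group_mult:
  assumes "s \<in> carrier (galois_group R M K)" "t \<in> carrier (galois_group R M K)"
  shows "s \<otimes>\<^bsub>galois_group R M K\<^esub> t = compose M s t"
  using galois_groupD(4)[OF assms(1)] galois_groupD(4)[OF assms(2)] by (simp add: galois_group_def BijGroup_def)

lemma galois_group_one: "\<one>\<^bsub>galois_group R M K\<^esub> = (\<lambda>x\<in>M. x)"
  by (simp add: galois_group_def BijGroup_def)

lemma galois_group_inv:
  assumes M: "subfield M R" "K \<subseteq> M" and s: "s \<in> carrier (galois_group R M K)" and x: "x \<in> M"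
  shows "(inv\<^bsub>galois_group R M K\<^esub> s) (s x) = x" "s ((inv\<^bsub>galois_group R M K\<^esub> s) x) = x"
proof -
  interpret G: group "galois_group R M K" by (rule galois_group_is_group[OF M])
  have 1: "compose M (inv\<^bsub>galois_group R M K\<^esub> s) s = (\<lambda>x\<in>M. x)"
    using G.l_inv[OF s] galois_group_mult[OF G.inv_closed[OF s] s] galois_group_one[of M K] by simp
  have 2: "compose M s (inv\<^bsub>galois_group R M K\<^esub> s) = (\<lambda>x\<in>M. x)"
    using G.r_inv[OF s] galois_group_mult[OF s G.inv_closed[OF s]] galois_group_one[of M K] by simp
  show "(inv\<^bsub>galois_group R M K\<^esub> s) (s x) = x" using fun_cong[OF 1, of x] x by (simp add: compose_def)
  show "s ((inv\<^bsub>galois_group R M K\<^esub> s) x) = x" using fun_cong[OF 2, of x] x by (simp add: compose_def)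
qed

lemma galois_group_eqI:
  assumes "s \<in> carrier (galois_group R M K)" "t \<in> carrier (galois_group R M K')" "\<And>x. x \<in> M \<Longrightarrow> s x = t x"
  shows "s = t"
  using galois_groupD(3)[OF assms(1)] galois_groupD(3)[OF assms(2)] assms(3) by (rule extensionalityI)

lemma finite_galois_group:
  assumes K: "subfield K R" and M: "subfield M R" and KM: "K \<subseteq> M" and dim: "dimension n K M"
  shows "finite (carrier (galois_group R M K))" "card (carrier (galois_group R M K)) \<le> n"
proof -
  have S: "carrier (galois_group R M K) \<subseteq> embeddings K M M" using galois_groupD(1) by auto
  have dist: "g = h" if "g \<in> carrier (galois_group R M K)" "h \<in> carrier (galois_group R M K)" "\<forall>x \<in> M. g x = h x" for g h
    by (rule galois_group_eqI[OF that(1,2)]) (rule bspec[OF that(3)])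
  show "finite (carrier (galois_group R M K))"
    by (rule embeddings_card_le_dimension(1)[OF K M M KM dim S]) (erule (2) dist)
  show "card (carrier (galois_group R M K)) \<le> n"
    by (rule embeddings_card_le_dimension(2)[OF K M M KM dim S]) (erule (2) dist)
qed

lemma embeddings_subset:
  assumes "h \<in> embeddings K E M" "F \<subseteq> E"
  shows "h \<in> embeddings K F M"
  using embeddingsD[OF assms(1)] assms(2) by (intro embeddingsI) (auto simp: subset_iff)

lemma embeddings_pow:
  assumes "subfield E R" "h \<in> embeddings K E M" "x \<in> E"
  shows "h (x [^] (i::nat)) = h x [^] i" "x [^] i \<in> E"
proof -
  have "h (x [^] i) = h x [^] i \<and> x [^] i \<in> E"
    using embeddingsD[OF assms(2)] assms(3) subringE(3,6)[OF subfieldE(1)[OF assms(1)]]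
    by (induction i) auto
  then show "h (x [^] i) = h x [^] i" "x [^] i \<in> E" by auto
qed

section \<open>Fixed fields of finite groups of automorphisms\<close>

context
  fixes M K0 P K
  assumes M: "subfield M R" and K0: "K0 \<subseteq> M" and P: "subgroup P (galois_group R M K0)"
    and finP: "finite P" and K: "K = fixed_field M P"
begin

text \<open>\<open>K0\<close> is any base over which \<open>P\<close> is given as a group. The two
  existence statements express left division and composition in \<open>P\<close>; the first has the
  shape of the hypothesis \<open>perm\<close> in \<open>artin_independent_bound\<close>.\<close>

lemma fixed_field_of_subgroup:
  shows "subfield K R" "K \<subseteq> M" "P \<subseteq> embeddings K M M" "P \<subseteq> carrier (galois_group R M K)"
    "(\<lambda>x\<in>M. x) \<in> P"
    "\<And>d h'. d \<in> P \<Longrightarrow> h' \<in> P \<Longrightarrow> \<exists>h \<in> P. \<forall>x \<in> M. d (h x) = h' x"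
    "\<And>d h'. d \<in> P \<Longrightarrow> h' \<in> P \<Longrightarrow> \<exists>h \<in> P. \<forall>x \<in> M. h x = d (h' x)"
proof -
  interpret G: group "galois_group R M K0" by (rule galois_group_is_group[OF M K0])
  have sub: "P \<subseteq> carrier (galois_group R M K0)" by (rule subgroup.subset[OF P])
  then have emb: "P \<subseteq> embeddings K0 M M" using galois_groupD(1) by blast
  show "subfield K R" unfolding K by (rule fixed_field_subfield[OF M emb])
  show "K \<subseteq> M" by (auto simp: K fixed_field_def)
  show "P \<subseteq> embeddings K M M" using emb by (auto simp: K embeddings_def fixed_field_def)
  then show "P \<subseteq> carrier (galois_group R M K)"
    using sub by (meson galois_group_iff subset_iff)
  show "(\<lambda>x\<in>M. x) \<in> P" using subgroup.one_closed[OF P] by (simp add: galois_group_one)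
  show "\<exists>h \<in> P. \<forall>x \<in> M. d (h x) = h' x" if d: "d \<in> P" and h': "h' \<in> P" for d h'
  proof
    have dc: "d \<in> carrier (galois_group R M K0)" and hc: "h' \<in> carrier (galois_group R M K0)" using d h' sub by auto
    let ?h = "inv\<^bsub>galois_group R M K0\<^esub> d \<otimes>\<^bsub>galois_group R M K0\<^esub> h'"
    show "?h \<in> P" using subgroup.m_closed[OF P subgroup.m_inv_closed[OF P d] h'] .
    show "\<forall>x \<in> M. d (?h x) = h' x"
      using galois_group_mult[OF G.inv_closed[OF dc] hc] galois_group_inv(2)[OF M K0 dc] galois_groupD(6)[OF hc]
      by (simp add: compose_def)
  qed
  show "\<exists>h \<in> P. \<forall>x \<in> M. h x = d (h' x)" if d: "d \<in> P" and h': "h' \<in> P" for d h'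
  proof
    have dc: "d \<in> carrier (galois_group R M K0)" and hc: "h' \<in> carrier (galois_group R M K0)" using d h' sub by auto
    show "d \<otimes>\<^bsub>galois_group R M K0\<^esub> h' \<in> P" by (rule subgroup.m_closed[OF P d h'])
    show "\<forall>x \<in> M. (d \<otimes>\<^bsub>galois_group R M K0\<^esub> h') x = d (h' x)"
      using galois_group_mult[OF dc hc] by (simp add: compose_def)
  qed
qed

text \<open>Artin's bound gives \<open>[M:K] \<le> |P|\<close>. Conversely \<open>P\<close> lies in
  \<open>Gal(M/K)\<close>, whose order is at most \<open>[M:K]\<close> by the independence of
  embeddings.\<close>

lemma artin_dimension: "dimension (card P) K M"
proof -
  have "\<exists>m \<le> card P. dimension m K M"
  proof (rule bounded_independent_imp_dimension)
    show "subfield K R" by (rule fixed_field_of_subgroup)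
    show "subalgebra K M R"
      by (rule subfield_subalgebra[OF fixed_field_of_subgroup(1) subfieldE(1)[OF M] fixed_field_of_subgroup(2)])
    show "length es \<le> card P" if ind: "independent K es" and es: "set es \<subseteq> M" for es
    proof (rule artin_independent_bound[OF M fixed_field_of_subgroup(3) finP])
      show "h e \<in> M" if "h \<in> P" "e \<in> set es" for h e
        using that es embeddingsD(1)[of h K M M e] fixed_field_of_subgroup(3) by blast
      show "\<exists>h\<in>P. \<forall>e\<in>set es. d (h e) = h' e" if "d \<in> P" "h' \<in> P" for d h'
        using fixed_field_of_subgroup(6)[OF that] es by blast
      show "\<exists>h\<in>P. \<forall>e\<in>set es. h e = e" using fixed_field_of_subgroup(5) es by (intro bexI[of _ "\<lambda>x\<in>M. x"]) auto
      show "independent (fixed_field M P) es" using ind K by simp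
    qed
  qed
  then obtain m where m: "m \<le> card P" "dimension m K M" by auto
  have "card P \<le> card (carrier (galois_group R M K))"
    using finite_galois_group(1)[OF fixed_field_of_subgroup(1) M fixed_field_of_subgroup(2) m(2)] fixed_field_of_subgroup(4) by (rule card_mono)
  with finite_galois_group(2)[OF fixed_field_of_subgroup(1) M fixed_field_of_subgroup(2) m(2)] m show ?thesis
    using dimension_is_inj by (metis (full_types) le_antisym le_trans)
qed

lemma artin_galois_group: "carrier (galois_group R M K) = P"
  using card_seteq[OF finite_galois_group(1)[OF fixed_field_of_subgroup(1) M fixed_field_of_subgroup(2) artin_dimension] fixed_field_of_subgroup(4)]
    finite_galois_group(2)[OF fixed_field_of_subgroup(1) M fixed_field_of_subgroup(2) artin_dimension] by simp

text \<open>The degree of \<open>a\<close> over the fixed field is at most the size of its orbit, by Artin's bound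
  applied to the powers of \<open>a\<close>; and the orbit consists of roots of \<open>Irr K a\<close>.\<close>

lemma artin_simply_split:
  assumes a: "a \<in> M"
  shows "(algebraic over K) a" "simply_split M (Irr K a)"
proof -
  have Mc: "M \<subseteq> carrier R" by (rule subfieldE(3)[OF M])
  have ac: "a \<in> carrier R" using a Mc by auto
  show alg: "(algebraic over K) a"
    using finite_dimension_imp_algebraic[OF fixed_field_of_subgroup(1) subfieldE(1)[OF M] _ a] artin_dimension
    by (auto intro: finite_dimensionI)
  let ?p = "Irr K a"
  note irr = IrrE[OF fixed_field_of_subgroup(1) ac alg]
  have p0: "?p \<noteq> []" using pirreducibleE(1)[OF subfieldE(1)[OF fixed_field_of_subgroup(1)] irr(1,2)] .
  define Or where "Or = (\<lambda>s. s a) ` P"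
  \<comment> \<open>One automorphism is chosen for each point of the orbit. Automorphisms agreeing
    at \<open>a\<close> agree on its powers, so these representatives are still permuted as Artin's
    bound requires, and there are no more of them than points in the orbit.\<close>
  define rep where "rep b = (SOME s. s \<in> P \<and> s a = b)" for b
  have rep: "rep b \<in> P" "rep b a = b" if "b \<in> Or" for b
  proof -
    have "\<exists>s. s \<in> P \<and> s a = b" using that by (auto simp: Or_def)
    from someI_ex[OF this] show "rep b \<in> P" "rep b a = b" by (simp_all add: rep_def)
  qed
  have finO: "finite Or" using finP by (simp add: Or_def)
  let ?es = "exp_base a (degree ?p)"
  have es: "\<exists>i::nat. e = a [^] i" if "e \<in> set ?es" for e using that by (auto simp: exp_base_def)
  have emb: "s \<in> embeddings K M M" if "s \<in> P" for s using fixed_field_of_subgroup(3) that by auto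
  have "length ?es \<le> card (rep ` Or)"
  proof (rule artin_independent_bound[OF M fixed_field_of_subgroup(3)])
    show "finite (rep ` Or)" using finO by simp
    show "h e \<in> M" if "h \<in> rep ` Or" "e \<in> set ?es" for h e
    proof -
      obtain i :: nat where "e = a [^] i" using es \<open>e \<in> set ?es\<close> by auto
      moreover from \<open>h \<in> rep ` Or\<close> have "h \<in> P" using rep(1) by auto
      ultimately show ?thesis
        using embeddings_pow(2)[OF M emb a] embeddingsD(1)[OF emb] by auto
    qed
    show "\<exists>h\<in>rep ` Or. \<forall>e\<in>set ?es. d (h e) = h' e" if d: "d \<in> P" and h': "h' \<in> rep ` Or" for d h'
    proof -
      have hP: "h' \<in> P" using h' rep by auto
      obtain g where g: "g \<in> P" "\<forall>x \<in> M. d (g x) = h' x" using fixed_field_of_subgroup(6)[OF d hP] by auto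
      have gO: "g a \<in> Or" using g by (auto simp: Or_def)
      let ?h = "rep (g a)"
      have "d (?h (a [^] i)) = h' (a [^] i)" for i :: nat
      proof -
        have "d (?h (a [^] i)) = d (?h a) [^] i"
          using embeddings_pow[OF M emb[OF rep(1)[OF gO]] a, of i]
            embeddings_pow(1)[OF M emb[OF d] embeddingsD(1)[OF emb[OF rep(1)[OF gO]] a], of i] by simp
        also have "\<dots> = h' a [^] i" using rep(2)[OF gO] g(2) a by simp
        finally show ?thesis using embeddings_pow(1)[OF M emb[OF hP] a, of i] by simp
      qed
      then show ?thesis using gO es by (intro bexI[of _ ?h]) auto
    qed
    show "\<exists>h\<in>rep ` Or. \<forall>e\<in>set ?es. h e = e"
    proof -
      have aO: "a \<in> Or" unfolding Or_def by (rule image_eqI[OF _ fixed_field_of_subgroup(5)]) (use a in simp)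
      have "rep a (a [^] i) = a [^] i" for i :: nat
        using embeddings_pow(1)[OF M emb[OF rep(1)[OF aO]] a, of i] rep(2)[OF aO] by simp
      then show ?thesis using aO es by (intro bexI[of _ "rep a"]) auto
    qed
    show "independent (fixed_field M P) ?es"
      using exp_base_independent[OF fixed_field_of_subgroup(1) ac alg] K by simp
  qed
  then have "degree ?p \<le> card Or"
    using card_image_le[OF finO, of rep] by (simp add: exp_base_def)
  moreover have "Or \<subseteq> zeros_in M ?p"
  proof
    fix b assume "b \<in> Or"
    then obtain s where s: "s \<in> P" "b = s a" by (auto simp: Or_def)
    have "a \<in> zeros_in M ?p" using a irr(4) by (simp add: zeros_in_def)
    from embeddings_zeros[OF M M emb[OF s(1)] subfieldE(1)[OF fixed_field_of_subgroup(1)] fixed_field_of_subgroup(2) irr(1) this]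
    show "b \<in> zeros_in M ?p" using s by simp
  qed
  moreover note zeros_in_bound[OF carrier_polynomial_shell[OF subfieldE(1)[OF fixed_field_of_subgroup(1)] irr(1)] p0 Mc]
  ultimately have "card (zeros_in M ?p) = degree ?p" by (meson card_mono le_antisym le_trans)
  then show "simply_split M ?p" using p0 by (simp add: simply_split_def)
qed

text \<open>An irreducible polynomial over \<open>K\<close> with a zero \<open>x\<close> in
  \<open>M\<close> is an associate of \<open>Irr K x\<close>, which has simple roots in
  \<open>M\<close>; so normality and separability both reduce to minimal polynomials.\<close>

lemma artin_galois_extension: "galois_extension R K M"
proof -
  note Ks = fixed_field_of_subgroup(1) and KM = fixed_field_of_subgroup(2)
  have Mc: "M \<subseteq> carrier R" by (rule subfieldE(3)[OF M])
  have alg: "(algebraic over K) x" if "x \<in> M" for x using artin_simply_split(1)[OF that] .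
  have "normal_extension R K M"
    unfolding normal_extension_def
  proof (intro conjI ballI impI)
    show "algebraic K x" if "x \<in> M" for x using alg[OF that] by (simp add: over_def)
    fix p assume p: "p \<in> carrier (K[X])" and "pirreducible K p \<and> (\<exists>x \<in> M. eval p x = \<zero>)"
    then obtain x where pi: "pirreducible K p" and x: "x \<in> M" "eval p x = \<zero>" by auto
    have xc: "x \<in> carrier R" using x Mc by auto
    note irr = IrrE[OF Ks xc alg[OF x(1)]]
    have "(Irr K x) pdivides p" by (rule Irr_minimal[OF Ks xc alg[OF x(1)] p x(2)])
    then have "(Irr K x) divides\<^bsub>K[X]\<^esub> p" using pdivides_iff_shell[OF Ks irr(1) p] by simp
    then have "Irr K x \<sim>\<^bsub>K[X]\<^esub> p"
      using divides_pirreducible_condition[OF pi irr(1)]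
        pirreducibleE(2)[OF subfieldE(1)[OF Ks] irr(1,2)] by blast
    then have "p divides\<^bsub>K[X]\<^esub> (Irr K x)" by (simp add: associated_def)
    then have dv: "p pdivides (Irr K x)" using pdivides_iff_shell[OF Ks p irr(1)] by simp
    have "simply_split M p"
      by (rule simply_split_pdivides[OF carrier_polynomial_shell[OF subfieldE(1)[OF Ks] irr(1)]
          carrier_polynomial_shell[OF subfieldE(1)[OF Ks] p] Mc dv artin_simply_split(2)[OF x(1)]])
    then show "ring.splitted (R\<lparr>carrier := M\<rparr>) p"
      by (rule simply_split_imp_splitted[OF M polynomial_mono[OF KM p]])
  qed
  moreover have "separable_extension R K M"
    unfolding separable_extension_def
  proof (intro ballI conjI)
    fix x assume x: "x \<in> M"
    show "algebraic K x" using alg[OF x] by (simp add: over_def)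
    have "Irr K x \<in> carrier (poly_ring R)"
      using carrier_polynomial_shell[OF subfieldE(1)[OF Ks] IrrE(1)[OF Ks _ alg[OF x]]] x Mc by auto
    then show "separable_poly R (Irr K x)"
      by (rule simply_split_imp_separable[OF _ Mc artin_simply_split(2)[OF x]])
  qed
  ultimately show ?thesis using Ks M KM by (simp add: galois_extension_def)
qed

end

section \<open>Finite Galois extensions and their intermediate fields\<close>

lemma galois_extensionD:
  assumes "galois_extension R K M"
  shows "subfield K R" "subfield M R" "K \<subseteq> M"
    "\<And>x. x \<in> M \<Longrightarrow> (algebraic over K) x"
    "\<And>x. x \<in> M \<Longrightarrow> simply_split M (Irr K x)"
    "\<And>x. x \<in> M \<Longrightarrow> Irr K x \<in> carrier (K[X])"
    "\<And>x. x \<in> M \<Longrightarrow> eval (Irr K x) x = \<zero>"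
proof -
  note d = assms[unfolded galois_extension_def normal_extension_def separable_extension_def]
  show 1: "subfield K R" "subfield M R" "K \<subseteq> M" "\<And>x. x \<in> M \<Longrightarrow> (algebraic over K) x"
    using d by (auto simp: over_def)
  fix x assume x: "x \<in> M"
  then have xc: "x \<in> carrier R" using subfieldE(3)[OF 1(2)] by auto
  note irr = IrrE[OF 1(1) xc 1(4)[OF x]]
  show "Irr K x \<in> carrier (K[X])" "eval (Irr K x) x = \<zero>" using irr by auto
  have "ring.splitted (R\<lparr>carrier := M\<rparr>) (Irr K x)" using d irr x by blast
  moreover have "separable_poly R (Irr K x)" using d x by blast
  ultimately show "simply_split M (Irr K x)"
    using separable_splitted_imp_simply_split[OF 1(2) polynomial_mono[OF 1(3) irr(1)]] by blast
qed

text \<open>A basis of \<open>M\<close> over \<open>K\<close> serves as list of generators, with the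
  minimal polynomials of its members as witnesses.\<close>

lemma galois_extension_split_generated:
  assumes G: "galois_extension R K M" and dim: "dimension n K M"
  shows "\<exists>xs. split_generated K M xs"
proof -
  note D = galois_extensionD[OF G]
  obtain Vs where Vs: "set Vs \<subseteq> carrier R" "independent K Vs" "length Vs = n" "Span K Vs = M"
    using exists_base[OF D(1) dim] by auto
  have VM: "set Vs \<subseteq> M" using Span_base_incl[OF D(1) Vs(1)] Vs(4) by simp
  have sr: "subring (finite_extension K Vs) R" by (rule finite_extension_is_subring[OF subfieldE(1)[OF D(1)] Vs(1)])
  have "M \<subseteq> finite_extension K Vs"
    using subalgebra_Span_incl[OF D(1) subfield_subalgebra[OF D(1) sr finite_extension_incl[OF subfieldE(3)[OF D(1)] Vs(1)]]
      finite_extension_mem[OF subfieldE(1)[OF D(1)] Vs(1)]] Vs(4) by simp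
  moreover have "finite_extension K Vs \<subseteq> M"
    by (rule finite_extension_subring_incl[OF subfieldE(1)[OF D(2)] D(3) VM])
  ultimately have "split_generated K M Vs"
    unfolding split_generated_def using D VM by blast
  then show ?thesis by blast
qed

text \<open>Artin's theorem is applied to the full group \<open>Gal(M/K)\<close>, whose fixed field
  is \<open>K\<close> by the descent through the generators.\<close>

lemma split_generated_galois_extension:
  assumes s: "split_generated K M xs"
  shows "galois_extension R K M" "finite (carrier (galois_group R M K))"
    "dimension (card (carrier (galois_group R M K))) K M" "fixed_field M (carrier (galois_group R M K)) = K"
proof -
  note D = split_generatedD[OF s]
  have alg: "(algebraic over K) x" if "x \<in> set xs" for x
    using D(7)[OF that] algebraicI by (auto simp: simply_split_def)
  obtain n where n: "dimension n K M"
    using finite_extension_finite_dimension(1)[OF D(1,5) alg] D(3) by (auto elim: finite_dimensionE')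
  note KM = D(6)
  show fin: "finite (carrier (galois_group R M K))" by (rule finite_galois_group(1)[OF D(1,2) KM n])
  have "K \<subseteq> fixed_field M (carrier (galois_group R M K))"
    using KM galois_groupD(5) by (auto simp: fixed_field_def)
  moreover have "fixed_field M (carrier (galois_group R M K)) \<subseteq> K"
    using split_generated_fixed_field[OF s] by (auto simp: fixed_field_def)
  ultimately show K: "fixed_field M (carrier (galois_group R M K)) = K" by auto
  have P: "subgroup (carrier (galois_group R M K)) (galois_group R M K)"
    by (rule group.subgroup_self[OF galois_group_is_group[OF D(2) KM]])
  show "galois_extension R K M" by (rule artin_galois_extension[OF D(2) KM P fin K[symmetric]])
  show "dimension (card (carrier (galois_group R M K))) K M"
    by (rule artin_dimension[OF D(2) KM P fin K[symmetric]])
qed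

text \<open>The detour through generators pays off here: enlarging the base field changes neither
  the list nor the splitting of its polynomials.\<close>

theorem galois_intermediate:
  assumes G: "galois_extension R K M" and dim: "dimension n K M"
    and F: "subfield F R" "K \<subseteq> F" "F \<subseteq> M"
  shows "galois_extension R F M" "finite (carrier (galois_group R M F))"
    "dimension (card (carrier (galois_group R M F))) F M" "fixed_field M (carrier (galois_group R M F)) = F"
proof -
  obtain xs where "split_generated K M xs" using galois_extension_split_generated[OF G dim] by auto
  from split_generated_galois_extension[OF split_generated_intermediate[OF this F]]
  show "galois_extension R F M" "finite (carrier (galois_group R M F))"
    "dimension (card (carrier (galois_group R M F))) F M" "fixed_field M (carrier (galois_group R M F)) = F" .
qed

text \<open>The image of \<open>x\<close> is a zero of \<open>Irr K x\<close>, and all zeros in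
  \<open>N\<close> already lie in \<open>F\<close>. The degree of \<open>F\<close> over
  \<open>K\<close> may be infinite: besides the Galois closure of \<open>E\<close>, the lemma is
  applied to \<open>L\<close> over \<open>k\<close>.\<close>

lemma galois_extension_conjugates:
  assumes G: "galois_extension R K F" and N: "subfield N R" "F \<subseteq> N"
    and A: "subfield A R" "K \<subseteq> A" and s: "s \<in> embeddings K A N" and x: "x \<in> F" "x \<in> A"
  shows "s x \<in> F"
proof -
  note D = galois_extensionD[OF G]
  have "x \<in> zeros_in A (Irr K x)" using D(7)[OF x(1)] x(2) by (simp add: zeros_in_def)
  from embeddings_zeros[OF A(1) N(1) s subfieldE(1)[OF D(1)] A(2) D(6)[OF x(1)] this]
  have "s x \<in> zeros_in N (Irr K x)" .
  also have "\<dots> = zeros_in F (Irr K x)"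
    by (rule simply_split_zeros_eq[OF carrier_polynomial_shell[OF subfieldE(1)[OF D(1)] D(6)[OF x(1)]] D(5)[OF x(1)] N(2)
        subfieldE(3)[OF N(1)]])
  finally show ?thesis by (simp add: zeros_in_def)
qed

text \<open>Surjectivity on \<open>F\<close> comes from the inverse automorphism of
  \<open>N\<close>, which maps \<open>F\<close> into itself for the same reason as \<open>s\<close>
  does.\<close>

lemma galois_group_restrict:
  assumes G: "galois_extension R K F" and N: "subfield N R" "F \<subseteq> N"
    and s: "s \<in> carrier (galois_group R N K)"
  shows "restrict s F \<in> carrier (galois_group R F K)"
proof -
  note D = galois_extensionD[OF G]
  have KN: "K \<subseteq> N" using D(3) N(2) by auto
  interpret g: group "galois_group R N K" by (rule galois_group_is_group[OF N(1) KN])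
  have emb: "t \<in> embeddings K F N" if "t \<in> carrier (galois_group R N K)" for t
    by (rule embeddings_subset[OF galois_groupD(1)[OF that] N(2)])
  have into: "t x \<in> F" if "t \<in> carrier (galois_group R N K)" "x \<in> F" for t x
    by (rule galois_extension_conjugates[OF G N D(2,3) emb[OF that(1)] that(2,2)])
  have sF: "s \<in> embeddings K F F"
    using embeddingsD[OF emb[OF s]] into[OF s] by (intro embeddingsI) auto
  have "bij_betw s F F"
  proof (rule bij_betw_imageI)
    show "inj_on s F" by (rule embeddings_props(3)[OF D(2,2) sF])
    show "s ` F = F"
    proof
      show "s ` F \<subseteq> F" using into[OF s] by auto
      show "F \<subseteq> s ` F"
      proof
        fix x assume x: "x \<in> F"
        then have "x = s ((inv\<^bsub>galois_group R N K\<^esub> s) x)"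
          using galois_group_inv(2)[OF N(1) KN s] N(2) by auto
        then show "x \<in> s ` F" using into[OF g.inv_closed[OF s] x] by blast
      qed
    qed
  qed
  then show ?thesis by (rule restrict_in_galois_group[OF D(2,3) sF])
qed

section \<open>Composita and linear disjointness\<close>

lemma subfield_inter:
  assumes A: "subfield A R" and B: "subfield B R"
  shows "subfield (A \<inter> B) R"
  using subring_inter[OF subfieldE(1)[OF A] subfieldE(1)[OF B]] subfield_m_inv(1)[OF A] subfield_m_inv(1)[OF B]
  by (intro subfieldI') auto

lemma dimension_Span_le:
  assumes K: "subfield K R"
  shows "set Us \<subseteq> carrier R \<Longrightarrow> \<exists>m \<le> length Us. dimension m K (Span K Us)"
proof (induction Us)
  case Nil
  then show ?case by auto
next
  case (Cons u Us)
  then obtain m where m: "m \<le> length Us" "dimension m K (Span K Us)" by auto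
  show ?case
  proof (cases "u \<in> Span K Us")
    case True
    have "Span K (u # Us) = Span K Us"
    proof
      have "set (u # Us) \<subseteq> Span K Us" using True Span_base_incl[OF K, of Us] Cons.prems by auto
      then show "Span K (u # Us) \<subseteq> Span K Us" using mono_Span_subset[OF K, of "u # Us" Us] Cons.prems by simp
      show "Span K Us \<subseteq> Span K (u # Us)" using mono_Span[OF K, of Us u] Cons.prems by simp
    qed
    then show ?thesis using m le_SucI by (metis length_Cons)
  next
    case False
    then have "dimension (Suc m) K (Span K (u # Us))"
      using Suc_dim[of u "Span K Us" m K] m Cons.prems by simp
    then show ?thesis using m(1) by (metis Suc_le_mono length_Cons)
  qed
qed

lemma compositum_props:
  assumes A: "A \<subseteq> carrier R" and B: "B \<subseteq> carrier R"
  shows "subfield (compositum R A B) R" "A \<subseteq> compositum R A B" "B \<subseteq> compositum R A B"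
    "\<And>C. subfield C R \<Longrightarrow> A \<subseteq> C \<Longrightarrow> B \<subseteq> C \<Longrightarrow> compositum R A B \<subseteq> C"
proof -
  have c: "A \<union> B \<subseteq> carrier R" using A B by auto
  note g = generate_fieldE[OF c refl]
  show "subfield (compositum R A B) R" "A \<subseteq> compositum R A B" "B \<subseteq> compositum R A B"
    using g(1,2) by (auto simp: compositum_def)
  show "compositum R A B \<subseteq> C" if "subfield C R" "A \<subseteq> C" "B \<subseteq> C" for C
    unfolding compositum_def by (rule g(3)) (use that in auto)
qed

lemma compositum_eqI:
  assumes "A \<subseteq> carrier R" "B \<subseteq> carrier R" "subfield C R" "A \<subseteq> C" "B \<subseteq> C"
    and "\<And>D. subfield D R \<Longrightarrow> A \<subseteq> D \<Longrightarrow> B \<subseteq> D \<Longrightarrow> C \<subseteq> D"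
  shows "compositum R A B = C"
  using compositum_props[OF assms(1,2)] assms(3-6) by blast

lemma subalgebraI:
  assumes K: "subfield K R" and "V \<subseteq> carrier R" "\<zero> \<in> V"
    and "\<And>v w. v \<in> V \<Longrightarrow> w \<in> V \<Longrightarrow> v \<oplus> w \<in> V"
    and smult: "\<And>k v. k \<in> K \<Longrightarrow> v \<in> V \<Longrightarrow> k \<otimes> v \<in> V"
  shows "subalgebra K V R"
proof (intro subalgebra.intro subalgebra_axioms.intro smult)
  have neg1: "\<ominus> \<one> \<in> K" using subringE(3,5)[OF subfieldE(1)[OF K]] by auto
  have neg: "\<ominus> w \<in> V" if "w \<in> V" for w
  proof -
    have "w \<in> carrier R" using that assms(2) by auto
    then have "\<ominus> w = \<ominus> \<one> \<otimes> w" by (simp add: l_minus)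
    then show ?thesis using smult[OF neg1 that] by simp
  qed
  show "subgroup V (add_monoid R)"
  proof (rule add.subgroupI)
    show "V \<noteq> {}" using assms(3) by auto
  qed (use neg assms in auto)
qed

text \<open>A basis \<open>Vs\<close> of \<open>A\<close> over \<open>A0\<close> spans over
  \<open>B\<close> a space \<open>S\<close> that contains \<open>A\<close> and \<open>B\<close> and
  is closed under multiplication. Being finite-dimensional over \<open>B\<close>, it is generated by
  algebraic elements and hence a field, so it is the compositum.\<close>

lemma compositum_dimension_le:
  assumes A0: "subfield A0 R" and A: "subfield A R" and B: "subfield B R"
    and sub: "A0 \<subseteq> A" "A0 \<subseteq> B" and dim: "dimension n A0 A"
  shows "\<exists>m \<le> n. dimension m B (compositum R A B)"
proof -
  obtain Vs where Vs: "set Vs \<subseteq> carrier R" "independent A0 Vs" "length Vs = n" "Span A0 Vs = A"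
    using exists_base[OF A0 dim] by auto
  have VA: "set Vs \<subseteq> A" using Span_base_incl[OF A0 Vs(1)] Vs(4) by simp
  note Ar = subfieldE(1)[OF A] and Br = subfieldE(1)[OF B]
  have Ac: "A \<subseteq> carrier R" and Bc: "B \<subseteq> carrier R" using subfieldE(3) A B by auto
  define S where "S = Span B Vs"
  have SB: "subalgebra B S R" unfolding S_def by (rule Span_is_subalgebra[OF B Vs(1)])
  have Sc: "S \<subseteq> carrier R" by (rule subalgebra_in_carrier[OF SB])
  have S_zero: "\<zero> \<in> S" and S_add: "\<And>v w. v \<in> S \<Longrightarrow> w \<in> S \<Longrightarrow> v \<oplus> w \<in> S"
    and S_neg: "\<And>v. v \<in> S \<Longrightarrow> \<ominus> v \<in> S"
    and S_smult: "\<And>k v. k \<in> B \<Longrightarrow> v \<in> S \<Longrightarrow> k \<otimes> v \<in> S"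
    unfolding S_def using Span_subgroup_props[OF B Vs(1)] Span_smult_closed[OF B Vs(1)] by auto
  have VS: "set Vs \<subseteq> S" unfolding S_def by (rule Span_base_incl[OF B Vs(1)])
  have "subalgebra A0 S R" using S_zero S_add S_smult sub(2) Sc by (intro subalgebraI[OF A0]) auto
  then have AS: "A \<subseteq> S" using subalgebra_Span_incl[OF A0 _ VS] Vs(4) by simp
  \<comment> \<open>Multiplication by \<open>c\<close> is \<open>B\<close>-linear, so it suffices to
    test it on \<open>Vs\<close>. This is used first for \<open>c\<close> in \<open>A\<close>, where
    products with \<open>Vs\<close> stay in \<open>A\<close>, and then for \<open>c\<close> in
    \<open>S\<close>, where they are covered by the first use.\<close>
  have mult_from_base: "c \<otimes> s \<in> S" if c: "c \<in> carrier R" and base: "\<And>v. v \<in> set Vs \<Longrightarrow> c \<otimes> v \<in> S"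
    and s: "s \<in> S" for c s
  proof -
    let ?T = "{s \<in> S. c \<otimes> s \<in> S}"
    have "subalgebra B ?T R"
    proof (rule subalgebraI[OF B])
      show "?T \<subseteq> carrier R" using Sc by auto
      show "\<zero> \<in> ?T" using S_zero c by simp
      show "v \<oplus> w \<in> ?T" if "v \<in> ?T" "w \<in> ?T" for v w
        using that S_add Sc c by (auto simp: r_distr subset_iff)
      show "k \<otimes> v \<in> ?T" if "k \<in> B" "v \<in> ?T" for k v
      proof -
        have "c \<otimes> (k \<otimes> v) = k \<otimes> (c \<otimes> v)" using that Bc Sc c by (intro m_lcomm) auto
        then show ?thesis using that S_smult by auto
      qed
    qed
    moreover have "set Vs \<subseteq> ?T" using VS base by auto
    ultimately have "S \<subseteq> ?T" unfolding S_def[symmetric] using subalgebra_Span_incl[OF B] S_def by blast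
    then show ?thesis using s by auto
  qed
  have mult_A: "a \<otimes> s \<in> S" if a: "a \<in> A" and s: "s \<in> S" for a s
  proof (rule mult_from_base[OF _ _ s])
    show "a \<in> carrier R" using a Ac by auto
    show "a \<otimes> v \<in> S" if "v \<in> set Vs" for v
      using subringE(6)[OF Ar a, of v] that VA AS by auto
  qed
  have mult_S: "t \<otimes> s \<in> S" if t: "t \<in> S" and s: "s \<in> S" for t s
  proof (rule mult_from_base[OF _ _ s])
    show "t \<in> carrier R" using t Sc by auto
    show "t \<otimes> v \<in> S" if v: "v \<in> set Vs" for v
    proof -
      have vA: "v \<in> A" using v VA by auto
      then have "t \<otimes> v = v \<otimes> t" using t Sc Ac by (intro m_comm) auto
      then show ?thesis using mult_A[OF vA t] by simp
    qed
  qed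
  have "\<one> \<in> S" using AS subringE(3)[OF Ar] by auto
  then have Sr: "subring S R" using Sc S_neg S_add mult_S by (intro subringI) auto
  have BS: "B \<subseteq> S"
  proof
    fix b assume b: "b \<in> B"
    then have "b \<otimes> \<one> \<in> S" using S_smult \<open>\<one> \<in> S\<close> by blast
    then show "b \<in> S" using b Bc by auto
  qed
  have fe: "finite_extension B Vs = S"
  proof
    show "finite_extension B Vs \<subseteq> S" by (rule finite_extension_subring_incl[OF Sr BS VS])
    have "subalgebra B (finite_extension B Vs) R"
      by (rule subfield_subalgebra[OF B finite_extension_is_subring[OF Br Vs(1)]
          finite_extension_incl[OF Bc Vs(1)]])
    then show "S \<subseteq> finite_extension B Vs"
      unfolding S_def by (rule subalgebra_Span_incl[OF B _ finite_extension_mem[OF Br Vs(1)]])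
  qed
  have fdS: "finite_dimension B S" unfolding S_def by (rule Span_finite_dimension[OF B Vs(1)])
  have "(algebraic over B) v" if "v \<in> set Vs" for v
    using finite_dimension_imp_algebraic[OF B Sr fdS] VS that by auto
  then have Sf: "subfield S R" using finite_extension_is_subfield[OF B Vs(1)] fe by simp
  have "compositum R A B = S"
  proof (rule compositum_eqI[OF Ac Bc Sf AS BS])
    fix D assume D: "subfield D R" "A \<subseteq> D" "B \<subseteq> D"
    show "S \<subseteq> D" unfolding fe[symmetric]
      by (rule finite_extension_subring_incl[OF subfieldE(1)[OF D(1)] D(3)]) (use VA D in auto)
  qed
  then show ?thesis using dimension_Span_le[OF B Vs(1)] Vs(3) by (simp add: S_def)
qed

section \<open>Degrees in towers and linear disjointness\<close>

lemma independent_subfield: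
  assumes "subfield K R" "subfield F R" "K \<subseteq> F" "independent F Us"
  shows "independent K Us"
  using assms(3) independent_imp_trivial_combine[OF assms(2,4)]
  by (intro trivial_combine_imp_independent[OF assms(1) independent_in_carrier[OF assms(4)]]) auto

text \<open>Lists in \<open>F\<close> independent over \<open>K\<close>, and lists in
  \<open>E\<close> independent over \<open>F\<close>, are independent over \<open>K\<close> inside
  \<open>E\<close>, so their lengths are at most \<open>n\<close>. Hence both degrees exist, and the
  tower formula relates them.\<close>

lemma intermediate_dimensions:
  assumes K: "subfield K R" and F: "subfield F R" and E: "subfield E R" and sub: "K \<subseteq> F" "F \<subseteq> E"
    and dim: "dimension n K E"
  obtains a b where "dimension a K F" "dimension b F E" "a * b = n"
proof -
  have "\<exists>a \<le> n. dimension a K F"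
    by (rule bounded_independent_imp_dimension[OF K subfield_subalgebra[OF K subfieldE(1)[OF F] sub(1)]])
      (use independent_length_le_dimension[OF K dim] sub(2) in blast)
  then obtain a where a: "dimension a K F" by auto
  have "\<exists>b \<le> n. dimension b F E"
    by (rule bounded_independent_imp_dimension[OF F subfield_subalgebra[OF F subfieldE(1)[OF E] sub(2)]])
      (use independent_length_le_dimension[OF K dim] independent_subfield[OF K F sub(1)] in blast)
  then obtain b where b: "dimension b F E" by auto
  have "a * b = n" by (rule dimension_is_inj[OF K telescopic_base[OF K F a b] dim])
  then show ?thesis using that a b by blast
qed

lemma dimension_pos:
  assumes K: "subfield K R" and F: "subfield F R" and dim: "dimension n K F"
  shows "0 < n"
proof (rule ccontr)
  assume "\<not> 0 < n"
  then have "F = {\<zero>}" using dimension_zero[OF K] dim by simp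
  then show False using subringE(3)[OF subfieldE(1)[OF F]] by simp
qed

lemma dimension_eq_subset:
  assumes K: "subfield K R" and F: "dimension n K F" "dimension n K F'" "F \<subseteq> F'"
  shows "F = F'"
proof -
  obtain Vs where Vs: "set Vs \<subseteq> carrier R" "independent K Vs" "length Vs = n" "Span K Vs = F"
    using exists_base[OF K F(1)] by auto
  have "set Vs \<subseteq> F'" using Span_base_incl[OF K Vs(1)] Vs(4) F(3) by auto
  then show ?thesis using independent_length_eq_dimension[OF K F(2) Vs(2)] Vs by auto
qed

lemma compositum_assoc_le:
  assumes "subfield F R" "subfield E R" "subfield L R" "F \<subseteq> E"
  shows "compositum R E (compositum R F L) = compositum R E L"
proof -
  have c: "F \<subseteq> carrier R" "E \<subseteq> carrier R" "L \<subseteq> carrier R" using subfieldE(3) assms by auto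
  note FL = compositum_props[OF c(1,3)] and EL = compositum_props[OF c(2,3)]
  show ?thesis
  proof (rule compositum_eqI[OF c(2) subfieldE(3)[OF FL(1)] EL(1,2)])
    show "compositum R F L \<subseteq> compositum R E L" by (rule FL(4)[OF EL(1)]) (use EL assms in auto)
    show "compositum R E L \<subseteq> D" if "subfield D R" "E \<subseteq> D" "compositum R F L \<subseteq> D" for D
      by (rule EL(4)[OF that(1,2)]) (use FL that in auto)
  qed
qed

text \<open>Equality \<open>[EL:L] = [E:K]\<close> propagates to every intermediate field because both factors of
  \<open>[EL:L] = [EL:FL] [FL:L]\<close> are at most the corresponding factors of \<open>[E:K] = [E:F] [F:K]\<close>.\<close>

lemma linearly_disjoint_intermediate:
  assumes K: "subfield K R" and E: "subfield E R" and L: "subfield L R" and F: "subfield F R"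
    and KE: "K \<subseteq> E" and KL: "K \<subseteq> L" and sub: "K \<subseteq> F" "F \<subseteq> E"
    and dim: "dimension n K E" "dimension n L (compositum R E L)"
  obtains a b where "dimension a K F" "dimension a L (compositum R F L)"
    "dimension b F E" "dimension b (compositum R F L) (compositum R E L)"
proof -
  obtain a b where ab: "dimension a K F" "dimension b F E" "a * b = n"
    using intermediate_dimensions[OF K F E sub dim(1)] by blast
  have c: "F \<subseteq> carrier R" "E \<subseteq> carrier R" "L \<subseteq> carrier R" using subfieldE(3) F E L by auto
  note FL = compositum_props[OF c(1,3)]
  obtain a' where a': "a' \<le> a" "dimension a' L (compositum R F L)"
    using compositum_dimension_le[OF K F L sub(1) KL ab(1)] by auto
  obtain b' where b': "b' \<le> b" "dimension b' (compositum R F L) (compositum R E L)"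
    using compositum_dimension_le[OF F E FL(1) sub(2) FL(2) ab(2)] compositum_assoc_le[OF F E L sub(2)] by auto
  have "a' * b' = n" by (rule dimension_is_inj[OF L telescopic_base[OF L FL(1) a'(2) b'(2)] dim(2)])
  moreover have "0 < n" by (rule dimension_pos[OF K E dim(1)])
  ultimately have eq: "a' * b' = a * b" and "0 < a' * b'" "0 < a * b"
    using ab(3) by simp_all
  then have pos: "0 < a'" "0 < b'" "0 < a" "0 < b" unfolding nat_0_less_mult_iff by blast+
  have "a' * b' \<le> a' * b" "a' * b \<le> a * b" using a'(1) b'(1) by auto
  then have "a' * b = a * b" "a' * b' = a' * b" using eq by auto
  then have "a' = a" "b' = b" using pos by auto
  then show ?thesis using that ab a' b' by blast
qed

text \<open>For \<open>F' = E \<inter> FL\<close> the composita \<open>F'L\<close> and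
  \<open>FL\<close> coincide. Since degrees over \<open>K\<close> are preserved by passing to
  composita with \<open>L\<close>, the fields \<open>F\<close> and \<open>F'\<close> have the same
  degree over \<open>K\<close>, and one contains the other.\<close>

lemma linearly_disjoint_inter:
  assumes K: "subfield K R" and E: "subfield E R" and L: "subfield L R" and F: "subfield F R"
    and KE: "K \<subseteq> E" and KL: "K \<subseteq> L" and sub: "K \<subseteq> F" "F \<subseteq> E"
    and dim: "dimension n K E" "dimension n L (compositum R E L)"
  shows "E \<inter> compositum R F L = F"
proof -
  have c: "F \<subseteq> carrier R" "E \<subseteq> carrier R" "L \<subseteq> carrier R" using subfieldE(3) F E L by auto
  note FL = compositum_props[OF c(1,3)]
  let ?F' = "E \<inter> compositum R F L"
  have F': "subfield ?F' R" by (rule subfield_inter[OF E FL(1)])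
  have FF': "F \<subseteq> ?F'" using sub FL by auto
  have F'c: "?F' \<subseteq> carrier R" using c by auto
  note F'L = compositum_props[OF F'c c(3)]
  have eq: "compositum R ?F' L = compositum R F L"
  proof
    show "compositum R ?F' L \<subseteq> compositum R F L" by (rule F'L(4)[OF FL(1)]) (use FL in auto)
    show "compositum R F L \<subseteq> compositum R ?F' L" by (rule FL(4)[OF F'L(1)]) (use F'L FF' in auto)
  qed
  obtain a where 1: "dimension a K F" "dimension a L (compositum R F L)"
    using linearly_disjoint_intermediate[OF K E L F KE KL sub dim] by metis
  have KF': "K \<subseteq> ?F'" "?F' \<subseteq> E" using sub FF' by auto
  obtain a' where 2: "dimension a' K ?F'" "dimension a' L (compositum R ?F' L)"
    using linearly_disjoint_intermediate[OF K E L F' KE KL KF' dim] by metis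
  have "a = a'" using dimension_is_inj[OF L 1(2)] 2(2) eq by simp
  then show ?thesis using dimension_eq_subset[OF K 1(1) _ FF'] 2(1) by simp
qed

end

section \<open>The correspondence\<close>

lemma (in field) galois_group_subgroup:
  assumes M: "subfield M R" and K: "K \<subseteq> F" "F \<subseteq> M"
  shows "subgroup (carrier (galois_group R M F)) (galois_group R M K)"
proof -
  interpret B: group "BijGroup M" by (rule group_BijGroup)
  have "carrier (galois_group R M F) \<subseteq> carrier (galois_group R M K)"
    using K(1) by (auto simp: galois_group_def)
  then have "subgroup (carrier (galois_group R M F)) (BijGroup M\<lparr>carrier := carrier (galois_group R M K)\<rparr>)"
    using B.subgroup_incl galois_group_subgroup_BijGroup[OF M] K by blast
  then show ?thesis by (simp add: galois_group_def)
qed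

text \<open>The common degree \<open>n\<close> of \<open>E\<close> over \<open>k\<close> and of
  \<open>EL\<close> over \<open>L\<close> is a parameter, so that the existential in
  \<open>potentially_galois\<close> is eliminated only once.\<close>

locale potentially_galois_field = field R for R :: "('a, 'b) ring_scheme" (structure) +
  fixes k E L n
  assumes subk: "subfield k R" and subE: "subfield E R" and subL: "subfield L R"
    and kE: "k \<subseteq> E" and kL: "k \<subseteq> L"
    and galN: "galois_extension R L (compositum R E L)"
    and dimE: "dimension n k E" and dimN: "dimension n L (compositum R E L)"
begin

abbreviation N where "N \<equiv> compositum R E L"
abbreviation Eh where "Eh \<equiv> galois_closure R k E"

lemma carriers: "k \<subseteq> carrier R" "E \<subseteq> carrier R" "L \<subseteq> carrier R"
  using subfieldE(3) subk subE subL by auto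

lemmas N_props = compositum_props[OF carriers(2,3)]

text \<open>As \<open>k(x)L = L(x)\<close>, the degree of \<open>x\<close> does not drop from
  \<open>k\<close> to \<open>L\<close>. So \<open>Irr L x\<close>, which has simple roots in
  \<open>N\<close> because \<open>N/L\<close> is Galois, divides \<open>Irr k x\<close>, has the
  same degree, and supplies as many zeros in \<open>N\<close> as that degree.\<close>

lemma Irr_simply_split:
  assumes x: "x \<in> E"
  shows "Irr k x \<in> carrier (k[X])" "simply_split N (Irr k x)" "eval (Irr k x) x = \<zero>"
    "(algebraic over k) x" "Irr k x \<noteq> []"
proof -
  have xc: "x \<in> carrier R" using x carriers by auto
  have xN: "x \<in> N" using x N_props(2) by auto
  show alg: "(algebraic over k) x"
    by (rule finite_dimension_imp_algebraic[OF subk subfieldE(1)[OF subE] finite_dimensionI[OF dimE] x])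
  note irr = IrrE[OF subk xc alg]
  show p: "Irr k x \<in> carrier (k[X])" "eval (Irr k x) x = \<zero>" using irr by auto
  show p0: "Irr k x \<noteq> []" by (rule pirreducibleE(1)[OF subfieldE(1)[OF subk] irr(1,2)])
  note G = galois_extensionD[OF galN]
  let ?F = "simple_extension k x"
  have F: "subfield ?F R" using simple_extension_is_subfield[OF subk xc] alg by simp
  have kF: "k \<subseteq> ?F" by (rule simple_extension_incl[OF carriers(1) xc])
  have FE: "?F \<subseteq> E" by (rule simple_extension_subring_incl[OF subfieldE(1)[OF subE] kE x])
  have xF: "x \<in> ?F" by (rule simple_extension_mem[OF subfieldE(1)[OF subk] xc])
  have Fc: "?F \<subseteq> carrier R" using FE carriers by auto
  note FL = compositum_props[OF Fc carriers(3)]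
  have algL: "(algebraic over L) x" using G(4)[OF xN] .
  have "compositum R ?F L = simple_extension L x"
  proof (rule compositum_eqI[OF Fc carriers(3)])
    show "subfield (simple_extension L x) R" using simple_extension_is_subfield[OF subL xc] algL by simp
    show "?F \<subseteq> simple_extension L x" by (rule mono_simple_extension[OF kL])
    show "L \<subseteq> simple_extension L x" by (rule simple_extension_incl[OF carriers(3) xc])
    show "simple_extension L x \<subseteq> D" if "subfield D R" "?F \<subseteq> D" "L \<subseteq> D" for D
      by (rule simple_extension_subring_incl[OF subfieldE(1)[OF that(1)] that(3)]) (use that xF in auto)
  qed
  then obtain a where a: "dimension a k ?F" "dimension a L (simple_extension L x)"
    using linearly_disjoint_intermediate[OF subk subE subL F kE kL kF FE dimE dimN] by metis
  have "a = degree (Irr k x)"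
    by (rule dimension_is_inj[OF subk a(1) dimension_simple_extension[OF subk xc alg]])
  moreover have "a = degree (Irr L x)"
    by (rule dimension_is_inj[OF subL a(2) dimension_simple_extension[OF subL xc algL]])
  ultimately have deg: "degree (Irr k x) = degree (Irr L x)" by simp
  have pL: "Irr k x \<in> carrier (L[X])" by (rule polynomial_mono[OF kL p(1)])
  have pR: "Irr k x \<in> carrier (poly_ring R)" by (rule carrier_polynomial_shell[OF subfieldE(1)[OF subk] p(1)])
  have "Irr L x pdivides Irr k x" by (rule Irr_minimal[OF subL xc algL pL p(2)])
  then have "zeros_in N (Irr L x) \<subseteq> zeros_in N (Irr k x)"
    using pdivides_imp_root_sharing[OF carrier_polynomial_shell[OF subfieldE(1)[OF subL] G(6)[OF xN]]]
      subfieldE(3)[OF N_props(1)] by (auto simp: zeros_in_def)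
  moreover note b = zeros_in_bound[OF pR p0 subfieldE(3)[OF N_props(1)]]
  ultimately have "degree (Irr k x) \<le> card (zeros_in N (Irr k x))"
    using card_mono[OF b(1), of "zeros_in N (Irr L x)"] G(5)[OF xN] deg by (simp add: simply_split_def)
  then show "simply_split N (Irr k x)" using b(2) p0 by (simp add: simply_split_def)
qed

text \<open>The field \<open>M0\<close> is generated over \<open>k\<close> by all zeros in
  \<open>N\<close> of the minimal polynomials of a basis of \<open>E\<close>. It is Galois over
  \<open>k\<close>, and every Galois extension of \<open>k\<close> containing \<open>E\<close> must
  contain those zeros, so the intersection defining \<open>Eh\<close> equals
  \<open>M0\<close>.\<close>

lemma galois_closure_split_generated: "\<exists>xs. split_generated k Eh xs \<and> E \<subseteq> Eh \<and> Eh \<subseteq> N"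
proof -
  obtain Vs where Vs: "set Vs \<subseteq> carrier R" "independent k Vs" "length Vs = n" "Span k Vs = E"
    using exists_base[OF subk dimE] by auto
  have VE: "set Vs \<subseteq> E" using Span_base_incl[OF subk Vs(1)] Vs(4) by simp
  have Nc: "N \<subseteq> carrier R" by (rule subfieldE(3)[OF N_props(1)])
  define Z where "Z = (\<Union>v\<in>set Vs. zeros_in N (Irr k v))"
  have irr_R: "Irr k v \<in> carrier (poly_ring R)" if "v \<in> E" for v
    by (rule carrier_polynomial_shell[OF subfieldE(1)[OF subk] Irr_simply_split(1)[OF that]])
  have "finite Z"
    unfolding Z_def using zeros_in_bound(1)[OF irr_R Irr_simply_split(5) Nc] VE by auto
  then obtain xs where xs: "set xs = Z" using finite_list by blast
  have ZN: "Z \<subseteq> N" by (auto simp: Z_def zeros_in_def)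
  have xsc: "set xs \<subseteq> carrier R" using xs ZN Nc by auto
  have VZ: "set Vs \<subseteq> Z"
    using VE N_props(2) Irr_simply_split(3) by (fastforce simp: Z_def zeros_in_def)
  have alg: "(algebraic over k) x" if x: "x \<in> set xs" for x
  proof -
    obtain v where v: "v \<in> set Vs" "x \<in> zeros_in N (Irr k v)" using x xs by (auto simp: Z_def)
    then show ?thesis
      using algebraicI[OF Irr_simply_split(1)] Irr_simply_split(5) VE by (auto simp: zeros_in_def)
  qed
  define M0 where "M0 = finite_extension k xs"
  have M0: "subfield M0 R" unfolding M0_def by (rule finite_extension_is_subfield[OF subk xsc alg])
  have ZM0: "Z \<subseteq> M0" unfolding M0_def using finite_extension_mem[OF subfieldE(1)[OF subk] xsc] xs by simp
  have kM0: "k \<subseteq> M0" unfolding M0_def by (rule finite_extension_incl[OF carriers(1) xsc])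
  have kN: "k \<subseteq> N" using kE N_props(2) by auto
  have M0N: "M0 \<subseteq> N" unfolding M0_def
    by (rule finite_extension_subring_incl[OF subfieldE(1)[OF N_props(1)] kN]) (use xs ZN in simp)
  have EM0: "E \<subseteq> M0"
    using subalgebra_Span_incl[OF subk subfield_subalgebra[OF subk subfieldE(1)[OF M0] kM0]] VZ ZM0 Vs(4) by auto
  have sg: "split_generated k M0 xs"
    unfolding split_generated_def
  proof (intro conjI ballI)
    fix x assume "x \<in> set xs"
    then obtain v where v: "v \<in> set Vs" "x \<in> zeros_in N (Irr k v)" using xs by (auto simp: Z_def)
    have vE: "v \<in> E" using v VE by auto
    have "zeros_in M0 (Irr k v) = zeros_in N (Irr k v)"
    proof
      show "zeros_in M0 (Irr k v) \<subseteq> zeros_in N (Irr k v)" using M0N by (auto simp: zeros_in_def)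
      have "zeros_in N (Irr k v) \<subseteq> M0" using v(1) ZM0 by (auto simp: Z_def)
      then show "zeros_in N (Irr k v) \<subseteq> zeros_in M0 (Irr k v)" by (auto simp: zeros_in_def)
    qed
    then have "simply_split M0 (Irr k v)" using Irr_simply_split(2)[OF vE] by (simp add: simply_split_def)
    then show "\<exists>p\<in>carrier (k[X]). simply_split M0 p \<and> eval p x = \<zero>"
      using Irr_simply_split(1)[OF vE] v(2) by (auto simp: zeros_in_def)
  qed (use subk M0 M0_def xs ZM0 in simp_all)
  have least: "M0 \<subseteq> M" if M: "E \<subseteq> M" "galois_extension R k M" for M
  proof -
    note G = galois_extensionD[OF M(2)]
    have "Z \<subseteq> M"
    proof
      fix x assume "x \<in> Z"
      then obtain v where v: "v \<in> set Vs" "x \<in> zeros_in N (Irr k v)" by (auto simp: Z_def)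
      have vM: "v \<in> M" and vE: "v \<in> E" using v VE M by auto
      \<comment> \<open>\<open>M\<close> is not known to lie in \<open>N\<close>, so the zeros are
        compared inside all of \<open>R\<close>.\<close>
      have "x \<in> zeros_in (carrier R) (Irr k v)" using v(2) Nc by (auto simp: zeros_in_def)
      also have "\<dots> = zeros_in M (Irr k v)"
        by (rule simply_split_zeros_eq[OF irr_R[OF vE] G(5)[OF vM] subfieldE(3)[OF G(2)] order_refl])
      finally show "x \<in> M" by (simp add: zeros_in_def)
    qed
    then show ?thesis
      unfolding M0_def using finite_extension_subring_incl[OF subfieldE(1)[OF G(2)] G(3)] xs by simp
  qed
  have "Eh = M0"
    unfolding galois_closure_def using least EM0 split_generated_galois_extension(1)[OF sg] by blast
  then show ?thesis using sg EM0 M0N by blast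
qed

lemma EEh: "E \<subseteq> Eh" and EhN: "Eh \<subseteq> N" and galEh: "galois_extension R k Eh"
  and subEh: "subfield Eh R"
  using galois_closure_split_generated split_generated_galois_extension(1) split_generatedD(2) by blast+

lemma kEh: "k \<subseteq> Eh" and kN: "k \<subseteq> N" using kE EEh EhN by blast+

lemma dimEh: obtains m where "dimension m k Eh"
  using galois_closure_split_generated split_generated_galois_extension(3) by blast

section \<open>Restriction from \<open>EL\<close> to the Galois closure\<close>

abbreviation G where "G \<equiv> galois_group R N L"

lemma Gam_eq: "Gam R k E = galois_group R Eh k" by (simp add: Gam_def)
lemma Gam_E_eq: "Gam_E R k E = carrier (galois_group R Eh E)" by (simp add: Gam_E_def)
lemma res_eq: "res R k E s = restrict s Eh" by (simp add: res_def)

lemma group_Gam: "group (Gam R k E)" unfolding Gam_eq by (rule galois_group_is_group[OF subEh kEh])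
lemma group_G: "group G" by (rule galois_group_is_group[OF N_props(1,3)])

lemma res_closed: "s \<in> carrier G \<Longrightarrow> res R k E s \<in> carrier (Gam R k E)"
proof -
  assume "s \<in> carrier G"
  then have "s \<in> carrier (galois_group R N k)"
    using kL subgroup.subset[OF galois_group_subgroup[OF N_props(1) kL N_props(3)]] by auto
  from galois_group_restrict[OF galEh N_props(1) EhN this]
  show ?thesis by (simp add: Gam_eq res_eq)
qed

text \<open>The fixed field of \<open>t^-1 s\<close> contains \<open>E\<close> and \<open>L\<close>,
  hence all of \<open>EL\<close>. Besides the injectivity of \<open>res\<close>, this shows that
  counting automorphisms of \<open>N\<close> over \<open>L\<close> amounts to counting their
  restrictions to \<open>E\<close>.\<close>

lemma G_eqI:
  assumes s: "s \<in> carrier G" and t: "t \<in> carrier G" and eq: "\<And>x. x \<in> E \<Longrightarrow> s x = t x"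
  shows "s = t"
proof -
  interpret G: group G by (rule group_G)
  let ?u = "inv\<^bsub>G\<^esub> t \<otimes>\<^bsub>G\<^esub> s"
  have u: "?u \<in> carrier G" using s t by simp
  have ux: "?u x = (inv\<^bsub>G\<^esub> t) (s x)" if "x \<in> N" for x
    using galois_group_mult[OF G.inv_closed[OF t] s] that by (simp add: compose_def)
  have "subfield (fixed_field N {?u}) R"
    by (rule fixed_field_subfield[OF N_props(1), of _ L]) (use galois_groupD(1)[OF u] in simp)
  moreover have "E \<subseteq> fixed_field N {?u}"
  proof
    fix x assume x: "x \<in> E"
    then have xN: "x \<in> N" using N_props(2) by auto
    show "x \<in> fixed_field N {?u}"
      using ux[OF xN] eq[OF x] galois_group_inv(1)[OF N_props(1,3) t xN] xN by (simp add: fixed_field_def)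
  qed
  moreover have "L \<subseteq> fixed_field N {?u}"
    using galois_groupD(5)[OF u] N_props(3) by (auto simp: fixed_field_def)
  ultimately have "N \<subseteq> fixed_field N {?u}" by (rule N_props(4))
  then have uid: "?u x = x" if "x \<in> N" for x using that by (auto simp: fixed_field_def)
  show ?thesis
  proof (rule galois_group_eqI[OF s t])
    fix x assume x: "x \<in> N"
    have sx: "s x \<in> N" by (rule galois_groupD(6)[OF s x])
    have "s x = t ((inv\<^bsub>G\<^esub> t) (s x))" using galois_group_inv(2)[OF N_props(1,3) t sx] by simp
    also have "\<dots> = t x" using uid[OF x] ux[OF x] by simp
    finally show "s x = t x" .
  qed
qed

lemma res_apply: "x \<in> Eh \<Longrightarrow> res R k E s x = s x" by (simp add: res_eq)

lemma res_inj: "inj_on (res R k E) (carrier G)"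
proof (rule inj_onI)
  fix s t assume st: "s \<in> carrier G" "t \<in> carrier G" and eq: "res R k E s = res R k E t"
  show "s = t"
  proof (rule G_eqI[OF st])
    fix x assume "x \<in> E"
    then have "x \<in> Eh" using EEh by auto
    then show "s x = t x" using res_apply[of x s] res_apply[of x t] eq by simp
  qed
qed

lemma res_hom: "res R k E \<in> hom G (Gam R k E)"
proof (rule homI)
  show "res R k E s \<in> carrier (Gam R k E)" if "s \<in> carrier G" for s by (rule res_closed[OF that])
  fix s t assume st: "s \<in> carrier G" "t \<in> carrier G"
  have t_Eh: "t x \<in> Eh" if "x \<in> Eh" for x
    using galois_groupD(6)[of "res R k E t" Eh k x] res_closed[OF st(2)] res_apply[OF that] that by (simp add: Gam_eq)
  have "res R k E s \<otimes>\<^bsub>Gam R k E\<^esub> res R k E t = compose Eh (res R k E s) (res R k E t)"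
    using galois_group_mult[of "res R k E s" Eh k "res R k E t"] res_closed st by (simp add: Gam_eq)
  also have "\<dots> = res R k E (compose N s t)"
    using t_Eh EhN by (auto simp: res_eq compose_def restrict_def fun_eq_iff)
  finally show "res R k E (s \<otimes>\<^bsub>G\<^esub> t) = res R k E s \<otimes>\<^bsub>Gam R k E\<^esub> res R k E t"
    using galois_group_mult[OF st] by simp
qed

lemma res_group_hom: "group_hom G (Gam R k E) (res R k E)"
  using group_G group_Gam res_hom by (simp add: group_hom_def group_hom_axioms_def)

lemma GL_carrier: "carrier (GL R k E L) = res R k E ` carrier G" by (simp add: GL_def)

lemma GL_subgroup: "subgroup (carrier (GL R k E L)) (Gam R k E)"
  unfolding GL_carrier by (rule group_hom.img_is_subgroup[OF res_group_hom])

lemma GL_eq: "GL R k E L = (Gam R k E)\<lparr>carrier := carrier (GL R k E L)\<rparr>" by (simp add: GL_def)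

lemma group_GL: "group (GL R k E L)"
  using subgroup.subgroup_is_group[OF GL_subgroup group_Gam] GL_eq by simp

lemma subgroup_GL_iff:
  "subgroup H (GL R k E L) \<longleftrightarrow> subgroup H (Gam R k E) \<and> H \<subseteq> carrier (GL R k E L)"
  using group.incl_subgroup[OF group_Gam GL_subgroup] group.subgroup_incl[OF group_Gam _ GL_subgroup]
    subgroup.subset GL_eq by metis

lemma Subfld_iff: "F \<in> Subfld R k E \<longleftrightarrow> subfield F R \<and> k \<subseteq> F \<and> F \<subseteq> E"
  by (simp add: Subfld_def)

section \<open>The map \<open>eta\<close>, from subfields of \<open>E\<close> to subgroups\<close>

context
  fixes F assumes F: "subfield F R" "k \<subseteq> F" "F \<subseteq> E"
begin

lemma F_carrier: "F \<subseteq> carrier R" using F carriers by auto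

lemmas FL_props = compositum_props[OF F_carrier carriers(3)]

lemma FL_N: "compositum R F L \<subseteq> N"
  by (rule FL_props(4)[OF N_props(1)]) (use F N_props in auto)

lemma galois_group_FL:
  shows "finite (carrier (galois_group R N (compositum R F L)))"
    "dimension (card (carrier (galois_group R N (compositum R F L)))) (compositum R F L) N"
    "fixed_field N (carrier (galois_group R N (compositum R F L))) = compositum R F L"
    "subgroup (carrier (galois_group R N (compositum R F L))) G"
    "carrier (galois_group R N (compositum R F L)) \<subseteq> carrier G"
proof -
  note gi = galois_intermediate[OF galN dimN FL_props(1,3) FL_N]
  show "finite (carrier (galois_group R N (compositum R F L)))"
    "dimension (card (carrier (galois_group R N (compositum R F L)))) (compositum R F L) N"
    "fixed_field N (carrier (galois_group R N (compositum R F L))) = compositum R F L"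
    by (rule gi(2), rule gi(3), rule gi(4))
  show sg: "subgroup (carrier (galois_group R N (compositum R F L))) G"
    by (rule galois_group_subgroup[OF N_props(1) FL_props(3) FL_N])
  show "carrier (galois_group R N (compositum R F L)) \<subseteq> carrier G" by (rule subgroup.subset[OF sg])
qed

lemma eta_eq: "eta R k E L F = res R k E ` carrier (galois_group R N (compositum R F L))"
  by (simp add: eta_def)

text \<open>\<open>res\<close> preserves the order of \<open>Gal(N/FL)\<close>, which is
  \<open>[N:FL]\<close> by Galois theory and \<open>[E:F]\<close> by linear disjointness.\<close>

lemma eta_card: "finite (eta R k E L F)" "dimension (card (eta R k E L F)) F E"
proof -
  show "finite (eta R k E L F)" unfolding eta_eq using galois_group_FL(1) by simp
  obtain b where b: "dimension b F E" "dimension b (compositum R F L) N"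
    using linearly_disjoint_intermediate[OF subk subE subL F(1) kE kL F(2,3) dimE dimN] by metis
  have "card (eta R k E L F) = card (carrier (galois_group R N (compositum R F L)))"
    unfolding eta_eq by (rule card_image[OF inj_on_subset[OF res_inj galois_group_FL(5)]])
  also have "\<dots> = b" by (rule dimension_is_inj[OF FL_props(1) galois_group_FL(2) b(2)])
  finally show "dimension (card (eta R k E L F)) F E" using b(1) by simp
qed

lemma eta_subgroup_Gam: "subgroup (eta R k E L F) (Gam R k E)"
  unfolding eta_eq by (rule group_hom.subgroup_img_is_subgroup[OF res_group_hom galois_group_FL(4)])

lemma eta_subgroup: "subgroup (eta R k E L F) (GL R k E L)"
  using eta_subgroup_Gam galois_group_FL(5) unfolding subgroup_GL_iff eta_eq GL_carrier by blast

text \<open>Restriction does not change fixed points in \<open>E\<close>, so Galois theory of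
  \<open>N/L\<close> turns the left side into \<open>E \<inter> FL\<close>, and linear disjointness
  finishes.\<close>

lemma eps_eta: "eps R k E (eta R k E L F) = F"
proof -
  have "eps R k E (eta R k E L F) = E \<inter> fixed_field N (carrier (galois_group R N (compositum R F L)))"
    using EEh EhN by (auto simp: eps_def eta_eq fixed_field_def res_apply)
  also have "\<dots> = E \<inter> compositum R F L" by (simp only: galois_group_FL(3))
  also have "\<dots> = F" by (rule linearly_disjoint_inter[OF subk subE subL F(1) kE kL F(2,3) dimE dimN])
  finally show ?thesis .
qed

text \<open>Restriction to \<open>E\<close> yields \<open>[E:F]\<close> different embeddings of \<open>E\<close> into \<open>EL\<close> over \<open>F\<close>, and
  there are no others.\<close>

lemma embedding_from_G:
  assumes s: "s \<in> embeddings F E N"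
  shows "\<exists>g \<in> carrier (galois_group R N (compositum R F L)). \<forall>x \<in> E. g x = s x"
proof (rule ccontr)
  assume neg: "\<not> ?thesis"
  let ?Q = "carrier (galois_group R N (compositum R F L))"
  obtain b where b: "dimension b F E" "dimension b (compositum R F L) N"
    using linearly_disjoint_intermediate[OF subk subE subL F(1) kE kL F(2,3) dimE dimN] by metis
  have cardQ: "card ?Q = b" by (rule dimension_is_inj[OF FL_props(1) galois_group_FL(2) b(2)])
  have sQ: "s \<notin> ?Q" using neg by blast
  have emb: "insert s ?Q \<subseteq> embeddings F E N"
  proof -
    have "g \<in> embeddings F E N" if g: "g \<in> ?Q" for g
    proof -
      have "g \<in> embeddings (compositum R F L) E N"
        by (rule embeddings_subset[OF galois_groupD(1)[OF g] N_props(2)])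
      then show ?thesis using FL_props(2) by (auto simp: embeddings_def)
    qed
    then show ?thesis using s by auto
  qed
  have "card (insert s ?Q) \<le> b"
  proof (rule embeddings_card_le_dimension(2)[OF F(1) subE N_props(1) F(3) b(1) emb])
    fix g h assume gh: "g \<in> insert s ?Q" "h \<in> insert s ?Q" and eq: "\<forall>x \<in> E. g x = h x"
    show "g = h"
    proof (cases "g = s \<or> h = s")
      case True
      then show ?thesis using gh eq neg by fastforce
    next
      case False
      then have "g \<in> ?Q" "h \<in> ?Q" using gh by auto
      then have "g \<in> carrier G" "h \<in> carrier G" using galois_group_FL(5) by auto
      then show ?thesis by (rule G_eqI) (use eq in auto)
    qed
  qed
  then show False using sQ galois_group_FL(1) cardQ by simp
qed

lemma F_Eh: "F \<subseteq> Eh" using F EEh by auto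

lemma eta_Gam_E: "eta R k E L F <#>\<^bsub>Gam R k E\<^esub> Gam_E R k E = carrier (galois_group R Eh F)"
proof -
  interpret Ga: group "Gam R k E" by (rule group_Gam)
  have sgF: "subgroup (carrier (galois_group R Eh F)) (Gam R k E)"
    unfolding Gam_eq by (rule galois_group_subgroup[OF subEh F(2) F_Eh])
  have sgE: "subgroup (Gam_E R k E) (Gam R k E)"
    unfolding Gam_eq Gam_E_eq by (rule galois_group_subgroup[OF subEh kE EEh])
  have eta_F: "eta R k E L F \<subseteq> carrier (galois_group R Eh F)"
  proof
    fix h assume h: "h \<in> eta R k E L F"
    then obtain g where g: "g \<in> carrier (galois_group R N (compositum R F L))" "h = res R k E g"
      by (auto simp: eta_eq)
    have "h \<in> carrier (galois_group R Eh k)" using subgroup.subset[OF eta_subgroup_Gam] h by (auto simp: Gam_eq)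
    moreover have "h x = x" if "x \<in> F" for x
    proof -
      have "x \<in> Eh" "x \<in> compositum R F L" using that F_Eh FL_props(2) by auto
      then show ?thesis using g res_apply[of x g] galois_groupD(5)[OF g(1)] by simp
    qed
    ultimately show "h \<in> carrier (galois_group R Eh F)" by (auto simp: galois_group_def)
  qed
  have Gam_E_F: "Gam_E R k E \<subseteq> carrier (galois_group R Eh F)"
    unfolding Gam_E_eq by (rule subgroup.subset[OF galois_group_subgroup[OF subEh F(3) EEh]])
  show ?thesis
  proof
    show "eta R k E L F <#>\<^bsub>Gam R k E\<^esub> Gam_E R k E \<subseteq> carrier (galois_group R Eh F)"
      using eta_F Gam_E_F subgroup.m_closed[OF sgF] by (auto simp: set_mult_def)
    show "carrier (galois_group R Eh F) \<subseteq> eta R k E L F <#>\<^bsub>Gam R k E\<^esub> Gam_E R k E"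
    proof
      fix s assume s: "s \<in> carrier (galois_group R Eh F)"
      then have sG: "s \<in> carrier (Gam R k E)" using subgroup.subset[OF sgF] by auto
      have "s \<in> embeddings F E Eh" by (rule embeddings_subset[OF galois_groupD(1)[OF s] EEh])
      then have "s \<in> embeddings F E N" using EhN by (auto simp: embeddings_def ring_hom_def)
      then obtain g where g: "g \<in> carrier (galois_group R N (compositum R F L))" "\<forall>x \<in> E. g x = s x"
        using embedding_from_G by blast
      let ?h = "res R k E g"
      have h: "?h \<in> eta R k E L F" using g by (auto simp: eta_eq)
      then have hG: "?h \<in> carrier (Gam R k E)" using subgroup.subset[OF eta_subgroup_Gam] by auto
      \<comment> \<open>Since \<open>g\<close> agrees with \<open>s\<close> on \<open>E\<close>, the
        correction factor \<open>?t\<close> fixes \<open>E\<close> pointwise.\<close>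
      let ?t = "inv\<^bsub>Gam R k E\<^esub> ?h \<otimes>\<^bsub>Gam R k E\<^esub> s"
      have tG: "?t \<in> carrier (Gam R k E)" using hG sG by simp
      have "?t x = x" if x: "x \<in> E" for x
      proof -
        have xEh: "x \<in> Eh" using x EEh by auto
        have "?t x = (inv\<^bsub>Gam R k E\<^esub> ?h) (s x)"
          using galois_group_mult[of "inv\<^bsub>Gam R k E\<^esub> ?h" Eh k s] Ga.inv_closed[OF hG] sG xEh
          by (simp add: Gam_eq compose_def)
        also have "s x = ?h x" using g(2) x res_apply[OF xEh] by simp
        also have "(inv\<^bsub>Gam R k E\<^esub> ?h) (?h x) = x"
          using galois_group_inv(1)[OF subEh kEh _ xEh, of ?h] hG by (simp add: Gam_eq)
        finally show ?thesis .
      qed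
      then have "?t \<in> Gam_E R k E" using tG by (auto simp: Gam_eq Gam_E_eq galois_group_def)
      moreover have "s = ?h \<otimes>\<^bsub>Gam R k E\<^esub> ?t" using hG sG by (simp add: Ga.m_assoc[symmetric])
      ultimately show "s \<in> eta R k E L F <#>\<^bsub>Gam R k E\<^esub> Gam_E R k E"
        using h unfolding set_mult_def by blast
    qed
  qed
qed

lemma eta_Subgp: "eta R k E L F \<in> Subgp R k E L"
  using eta_subgroup galois_group_subgroup[OF subEh F(2) F_Eh]
  by (simp add: Subgp_def eta_Gam_E) (simp add: Gam_eq)

end

lemma finite_GL: "finite (carrier (GL R k E L))"
  using finite_galois_group(1)[OF subL N_props(1) N_props(3) dimN] by (simp add: GL_carrier)

section \<open>The map \<open>eps\<close>, from subgroups to subfields of \<open>E\<close>\<close>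

context
  fixes H assumes H: "subgroup H (GL R k E L)"
begin

lemma H_props: "subgroup H (Gam R k E)" "H \<subseteq> carrier (GL R k E L)" "finite H"
  "H \<subseteq> carrier (galois_group R Eh k)" "H \<subseteq> embeddings k Eh Eh"
proof -
  show 1: "subgroup H (Gam R k E)" "H \<subseteq> carrier (GL R k E L)" using H subgroup_GL_iff by auto
  show "finite H" using finite_subset[OF 1(2) finite_GL] .
  show 2: "H \<subseteq> carrier (galois_group R Eh k)" using subgroup.subset[OF 1(1)] by (simp add: Gam_eq)
  show "H \<subseteq> embeddings k Eh Eh" using 2 galois_groupD(1) by blast
qed

lemma eps_eq: "eps R k E H = E \<inter> fixed_field Eh H"
  by (simp add: eps_def fixed_field_def)

lemma eps_subfield: "subfield (eps R k E H) R" "k \<subseteq> eps R k E H" "eps R k E H \<subseteq> E"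
proof -
  show "subfield (eps R k E H) R"
    unfolding eps_eq by (rule subfield_inter[OF subE fixed_field_subfield[OF subEh H_props(5)]])
  show "k \<subseteq> eps R k E H"
    using kE kEh H_props(4) galois_groupD(5) unfolding eps_eq fixed_field_def by blast
  show "eps R k E H \<subseteq> E" by (simp add: eps_def)
qed

text \<open>An automorphism of \<open>N\<close> over \<open>L\<close> whose restriction lies in
  \<open>H\<close> fixes both \<open>L\<close> and \<open>E^H\<close>, hence their compositum. This
  inclusion holds for every subgroup of \<open>GL\<close>; the opposite one rests on the group
  property of \<open>H Gam_E\<close>.\<close>

lemma subset_eta_eps: "H \<subseteq> eta R k E L (eps R k E H)"
proof
  let ?F = "eps R k E H"
  note F = eps_subfield
  note FL = FL_props[OF F]
  fix h assume h: "h \<in> H"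
  then obtain g where g: "g \<in> carrier G" "h = res R k E g" using H_props(2) by (auto simp: GL_carrier)
  have "subfield (fixed_field N {g}) R"
    by (rule fixed_field_subfield[OF N_props(1), of _ L]) (use galois_groupD(1)[OF g(1)] in simp)
  moreover have "?F \<subseteq> fixed_field N {g}"
  proof
    fix x assume x: "x \<in> ?F"
    then have "x \<in> Eh" "h x = x" using h by (auto simp: eps_def)
    then show "x \<in> fixed_field N {g}" using res_apply[of x g] g(2) EhN by (auto simp: fixed_field_def)
  qed
  moreover have "L \<subseteq> fixed_field N {g}"
    using galois_groupD(5)[OF g(1)] N_props(3) by (auto simp: fixed_field_def)
  ultimately have "compositum R ?F L \<subseteq> fixed_field N {g}" by (rule FL(4))
  then have "g \<in> carrier (galois_group R N (compositum R ?F L))"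
    using g(1) by (auto simp: galois_group_def fixed_field_def)
  then show "h \<in> eta R k E L ?F" using g(2) by (auto simp: eta_eq[OF F])
qed

end

context
  fixes H assumes H: "H \<in> Subgp R k E L"
begin

lemma Subgp_subgroup: "subgroup H (GL R k E L)" using H by (simp add: Subgp_def)

text \<open>Every element of \<open>H \<Gamma>\<^sub>E\<close> acts on \<open>E\<close> like an element of \<open>H\<close>, so Artin's bound
  applies to the embeddings given by \<open>H\<close> and the fixed field of \<open>H \<Gamma>\<^sub>E\<close>.\<close>

lemma eps_dimension_le:
  assumes b: "dimension b (eps R k E H) E"
  shows "b \<le> card H"
proof -
  let ?F = "eps R k E H"
  let ?D = "H <#>\<^bsub>Gam R k E\<^esub> Gam_E R k E"
  interpret Ga: group "Gam R k E" by (rule group_Gam)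
  note P = H_props[OF Subgp_subgroup]
  note F = eps_subfield[OF Subgp_subgroup]
  have D: "subgroup ?D (Gam R k E)" using H by (simp add: Subgp_def)
  have sgE: "subgroup (Gam_E R k E) (Gam R k E)"
    unfolding Gam_eq Gam_E_eq by (rule galois_group_subgroup[OF subEh kE EEh])
  have Dc: "?D \<subseteq> carrier (galois_group R Eh k)" using subgroup.subset[OF D] by (simp add: Gam_eq)
  have split: "\<exists>h \<in> H. \<forall>x \<in> E. d x = h x" if d: "d \<in> ?D" for d
  proof -
    obtain h g where hg: "h \<in> H" "g \<in> Gam_E R k E" "d = h \<otimes>\<^bsub>Gam R k E\<^esub> g"
      using d by (auto simp: set_mult_def)
    have c: "h \<in> carrier (galois_group R Eh k)" "g \<in> carrier (galois_group R Eh k)"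
      using hg P(4) subgroup.subset[OF sgE] by (auto simp: Gam_eq)
    have "d x = h x" if "x \<in> E" for x
    proof -
      have "g x = x" using hg(2) that galois_groupD(5) by (auto simp: Gam_E_eq)
      then show ?thesis using hg(3) galois_group_mult[OF c] that EEh by (auto simp: Gam_eq compose_def)
    qed
    then show ?thesis using hg(1) by blast
  qed
  have HD: "H \<subseteq> ?D"
  proof
    fix h assume h: "h \<in> H"
    then have "h = h \<otimes>\<^bsub>Gam R k E\<^esub> \<one>\<^bsub>Gam R k E\<^esub>" using subgroup.subset[OF P(1)] by auto
    then show "h \<in> ?D" using h subgroup.one_closed[OF sgE] by (auto simp: set_mult_def)
  qed
  have GD: "Gam_E R k E \<subseteq> ?D"
  proof
    fix h assume h: "h \<in> Gam_E R k E"
    then have "h = \<one>\<^bsub>Gam R k E\<^esub> \<otimes>\<^bsub>Gam R k E\<^esub> h" using subgroup.subset[OF sgE] by auto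
    then show "h \<in> ?D" using h subgroup.one_closed[OF P(1)] by (auto simp: set_mult_def)
  qed
  obtain m where m: "dimension m k Eh" by (rule dimEh)
  have fixE: "fixed_field Eh (Gam_E R k E) = E"
    unfolding Gam_E_eq by (rule galois_intermediate(4)[OF galEh m subE kE EEh])
  \<comment> \<open>Galois theory of \<open>Eh/E\<close> puts everything fixed by
    \<open>Gam_E\<close> into \<open>E\<close>; conversely the elements of \<open>?D\<close> act on
    \<open>E\<close> through \<open>H\<close>. This identifies the field to which Artin's bound
    refers.\<close>
  have fixD: "fixed_field Eh ?D = ?F"
  proof
    show "fixed_field Eh ?D \<subseteq> ?F"
    proof
      fix x assume x: "x \<in> fixed_field Eh ?D"
      then have "x \<in> fixed_field Eh (Gam_E R k E)" using GD by (auto simp: fixed_field_def)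
      then have "x \<in> E" using fixE by simp
      moreover have "x \<in> fixed_field Eh H" using x HD by (auto simp: fixed_field_def)
      ultimately show "x \<in> ?F" by (simp add: eps_eq[OF Subgp_subgroup])
    qed
    show "?F \<subseteq> fixed_field Eh ?D"
    proof
      fix x assume x: "x \<in> ?F"
      then have "x \<in> E" "x \<in> Eh" "\<forall>h \<in> H. h x = x" by (auto simp: eps_def)
      then have "d x = x" if "d \<in> ?D" for d using split[OF that] by auto
      then show "x \<in> fixed_field Eh ?D" using \<open>x \<in> Eh\<close> by (simp add: fixed_field_def)
    qed
  qed
  obtain es where es: "set es \<subseteq> carrier R" "independent ?F es" "length es = b" "Span ?F es = E"
    using exists_base[OF F(1) b] by auto
  have esE: "set es \<subseteq> E" using Span_base_incl[OF F(1) es(1)] es(4) by simp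
  have "length es \<le> card H"
  proof (rule artin_independent_bound[OF subEh, where K = k and D = "?D"])
    show "?D \<subseteq> embeddings k Eh Eh" using Dc galois_groupD(1) by blast
    show "finite H" by (rule P(3))
    show "h e \<in> Eh" if "h \<in> H" "e \<in> set es" for h e
      using that P(4) galois_groupD(6) esE EEh by blast
    show "\<exists>h\<in>H. \<forall>e\<in>set es. d (h e) = h' e" if d: "d \<in> ?D" and h': "h' \<in> H" for d h'
    proof -
      \<comment> \<open>The group property of \<open>?D\<close> is what puts \<open>d^-1 h'\<close>
        back into \<open>?D\<close>; on \<open>E\<close> it then acts as some \<open>h\<close> in
        \<open>H\<close>, and there \<open>d h = h'\<close>.\<close>
      let ?u = "inv\<^bsub>Gam R k E\<^esub> d \<otimes>\<^bsub>Gam R k E\<^esub> h'"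
      have c: "d \<in> carrier (galois_group R Eh k)" "h' \<in> carrier (galois_group R Eh k)"
        using d h' Dc P(4) by auto
      have ci: "inv\<^bsub>Gam R k E\<^esub> d \<in> carrier (galois_group R Eh k)"
        using Ga.inv_closed[of d] c by (simp add: Gam_eq)
      have "?u \<in> ?D"
        using subgroup.m_closed[OF D subgroup.m_inv_closed[OF D d]] HD h' by blast
      then obtain h where h: "h \<in> H" "\<forall>x \<in> E. ?u x = h x" using split by blast
      have "d (h e) = h' e" if e: "e \<in> set es" for e
      proof -
        have eE: "e \<in> E" and eEh: "e \<in> Eh" using e esE EEh by auto
        have "d (h e) = d (?u e)" using h(2) eE by simp
        also have "?u e = (inv\<^bsub>Gam R k E\<^esub> d) (h' e)"
          using galois_group_mult[OF ci c(2)] eEh by (simp add: Gam_eq compose_def)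
        also have "d \<dots> = h' e"
          using galois_group_inv(2)[OF subEh kEh c(1), of "h' e"] galois_groupD(6)[OF c(2) eEh] by (simp add: Gam_eq)
        finally show ?thesis .
      qed
      then show ?thesis using h(1) by blast
    qed
    show "\<exists>h\<in>H. \<forall>e\<in>set es. h e = e"
    proof
      show "(\<lambda>x\<in>Eh. x) \<in> H" using subgroup.one_closed[OF P(1)] galois_group_one[of Eh k] by (simp add: Gam_eq)
      show "\<forall>e\<in>set es. (\<lambda>x\<in>Eh. x) e = e" using esE EEh by auto
    qed
    show "independent (fixed_field Eh ?D) es" using es(2) fixD by simp
  qed
  then show ?thesis using es(3) by simp
qed

lemma eta_eps: "eta R k E L (eps R k E H) = H"
  and eps_dimension: "dimension (card H) (eps R k E H) E"
proof -
  note F = eps_subfield[OF Subgp_subgroup]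
  note e = eta_card[OF F]
  have "card (eta R k E L (eps R k E H)) \<le> card H" by (rule eps_dimension_le[OF e(2)])
  then show 1: "eta R k E L (eps R k E H) = H"
    using card_seteq[OF e(1) subset_eta_eps[OF Subgp_subgroup]] by simp
  show "dimension (card H) (eps R k E H) E" using e(2) 1 by simp
qed

end

text \<open>If \<open>L/k\<close> is Galois then \<open>GL = Gal(Eh/Eh \<inter> L)\<close> and \<open>Eh \<inter> L\<close> is stable under \<open>\<Gamma>\<close>,
  so \<open>GL\<close> is normal in \<open>\<Gamma>\<close>.\<close>

lemma GL_eq_galois_group:
  "carrier (galois_group R Eh (Eh \<inter> L)) = carrier (GL R k E L)"
proof (rule artin_galois_group[OF subEh kEh _ finite_GL])
  show "subgroup (carrier (GL R k E L)) (galois_group R Eh k)" using GL_subgroup by (simp add: Gam_eq)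
  have "fixed_field N (carrier G) = L"
    by (rule galois_intermediate(4)[OF galN dimN subL order_refl N_props(3)])
  moreover have "fixed_field Eh (carrier (GL R k E L)) = Eh \<inter> fixed_field N (carrier G)"
    using EhN by (auto simp: GL_carrier fixed_field_def res_apply)
  ultimately show "Eh \<inter> L = fixed_field Eh (carrier (GL R k E L))" by simp
qed

section \<open>Characteristic subgroups over a Galois extension \<open>L/k\<close>\<close>

context
  fixes H assumes galL: "galois_extension R k L" and char: "characteristic_subgroup H (GL R k E L)"
begin

lemma char_subgroup: "subgroup H (GL R k E L)" using char by (simp add: characteristic_subgroup_def)

lemma GL_normal: "carrier (GL R k E L) \<lhd> Gam R k E"
proof -
  interpret Ga: group "Gam R k E" by (rule group_Gam)
  show ?thesis
  proof (rule Ga.normal_invI[OF GL_subgroup])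
    fix s h assume s: "s \<in> carrier (Gam R k E)" and h: "h \<in> carrier (GL R k E L)"
    let ?i = "inv\<^bsub>Gam R k E\<^esub> s"
    let ?c = "s \<otimes>\<^bsub>Gam R k E\<^esub> h \<otimes>\<^bsub>Gam R k E\<^esub> ?i"
    have hG: "h \<in> carrier (Gam R k E)" using h subgroup.subset[OF GL_subgroup] by auto
    have c: "?c \<in> carrier (Gam R k E)" "?i \<in> carrier (Gam R k E)" "s \<otimes>\<^bsub>Gam R k E\<^esub> h \<in> carrier (Gam R k E)"
      using s hG by auto
    note gg = s[unfolded Gam_eq] hG[unfolded Gam_eq] c[unfolded Gam_eq]
    have "?c x = x" if x: "x \<in> Eh \<inter> L" for x
    proof -
      have xEh: "x \<in> Eh" using x by auto
      have iEh: "?i x \<in> Eh" using galois_groupD(6)[OF gg(4)] xEh by (simp add: Gam_eq)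
      have "?i \<in> embeddings k Eh Eh" using galois_groupD(1)[OF gg(4)] by (simp add: Gam_eq)
      then have "?i \<in> embeddings k Eh N" using EhN by (auto simp: embeddings_def ring_hom_def)
      \<comment> \<open>Normality of \<open>L\<close> over \<open>k\<close> enters here: an
        embedding of \<open>Eh\<close> into \<open>N\<close> over \<open>k\<close> keeps elements of
        \<open>L\<close> inside \<open>L\<close>.\<close>
      then have "?i x \<in> L"
        by (rule galois_extension_conjugates[OF galL N_props(1) N_props(3) subEh kEh]) (use x in auto)
      then have ix: "?i x \<in> Eh \<inter> L" using iEh by auto
      have "?c x = s (h (?i x))"
        using galois_group_mult[OF gg(5,4)] galois_group_mult[OF gg(1,2)] xEh iEh by (simp add: Gam_eq compose_def)
      also have "h (?i x) = ?i x"
        using galois_groupD(5)[of h Eh "Eh \<inter> L"] h ix by (simp add: GL_eq_galois_group)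
      also have "s (?i x) = x" using galois_group_inv(2)[OF subEh kEh gg(1) xEh] by (simp add: Gam_eq)
      finally show ?thesis .
    qed
    then have "?c \<in> carrier (galois_group R Eh (Eh \<inter> L))"
      using gg(3) by (auto simp: galois_group_def Gam_eq)
    then show "?c \<in> carrier (GL R k E L)" by (simp add: GL_eq_galois_group)
  qed
qed

text \<open>Conjugation by an element of \<open>\<Gamma>\<close> is an automorphism of the normal subgroup \<open>GL\<close>.\<close>

lemma char_normal: "H \<lhd> Gam R k E"
proof -
  interpret Ga: group "Gam R k E" by (rule group_Gam)
  interpret GLn: normal "carrier (GL R k E L)" "Gam R k E" by (rule GL_normal)
  note P = H_props[OF char_subgroup]
  let ?C = "carrier (GL R k E L)"
  have Cc: "?C \<subseteq> carrier (Gam R k E)" by (rule subgroup.subset[OF GL_subgroup])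
  show ?thesis
  proof (rule Ga.normal_invI[OF P(1)])
    fix s h assume s: "s \<in> carrier (Gam R k E)" and h: "h \<in> H"
    define c where "c t u = t \<otimes>\<^bsub>Gam R k E\<^esub> u \<otimes>\<^bsub>Gam R k E\<^esub> inv\<^bsub>Gam R k E\<^esub> t" for t u
    have c_in: "c t u \<in> ?C" if "t \<in> carrier (Gam R k E)" "u \<in> ?C" for t u
      using GLn.inv_op_closed2[OF that] by (simp add: c_def)
    have c_inv: "c t (c t' u) = u" if "t \<in> carrier (Gam R k E)" "t' = inv\<^bsub>Gam R k E\<^esub> t" "u \<in> ?C" for t t' u
    proof -
      have u: "u \<in> carrier (Gam R k E)" using that Cc by auto
      then have "t \<otimes>\<^bsub>Gam R k E\<^esub> (inv\<^bsub>Gam R k E\<^esub> t \<otimes>\<^bsub>Gam R k E\<^esub> u) = u"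
        using that(1) by (simp flip: Ga.m_assoc)
      then show ?thesis using that(1) u unfolding that(2) c_def by (simp add: Ga.m_assoc)
    qed
    have "bij_betw (c s) ?C ?C"
    proof (rule bij_betw_byWitness[where f' = "c (inv\<^bsub>Gam R k E\<^esub> s)"])
      show "\<forall>a\<in>?C. c (inv\<^bsub>Gam R k E\<^esub> s) (c s a) = a"
        using c_inv[of "inv\<^bsub>Gam R k E\<^esub> s" s] s by simp
      show "\<forall>a\<in>?C. c s (c (inv\<^bsub>Gam R k E\<^esub> s) a) = a" using c_inv[OF s refl] by simp
    qed (use c_in s in auto)
    \<comment> \<open>Elements of \<open>auto\<close> are extensional bijections, hence the
      restriction of conjugation to \<open>?C\<close>.\<close>
    then have bij: "restrict (c s) ?C \<in> Bij ?C" by (simp add: Bij_def bij_betw_restrict_eq)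
    have mult: "x \<otimes>\<^bsub>GL R k E L\<^esub> y = x \<otimes>\<^bsub>Gam R k E\<^esub> y" for x y by (subst GL_eq) simp
    have "restrict (c s) ?C \<in> hom (GL R k E L) (GL R k E L)"
    proof (rule homI)
      show "restrict (c s) ?C x \<in> ?C" if "x \<in> ?C" for x using that c_in s by simp
      fix x y assume xy: "x \<in> ?C" "y \<in> ?C"
      have xyG: "x \<in> carrier (Gam R k E)" "y \<in> carrier (Gam R k E)" using xy Cc by auto
      have "x \<otimes>\<^bsub>Gam R k E\<^esub> y \<in> ?C" using subgroup.m_closed[OF GL_subgroup xy] .
      moreover have "c s (x \<otimes>\<^bsub>Gam R k E\<^esub> y) = c s x \<otimes>\<^bsub>Gam R k E\<^esub> c s y"
        using xyG s unfolding c_def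
        by (metis Ga.inv_closed Ga.inv_solve_right' Ga.m_assoc Ga.m_closed)
      ultimately show "restrict (c s) ?C (x \<otimes>\<^bsub>GL R k E L\<^esub> y) = restrict (c s) ?C x \<otimes>\<^bsub>GL R k E L\<^esub> restrict (c s) ?C y"
        using xy by (simp add: mult)
    qed
    then have "restrict (c s) ?C \<in> auto (GL R k E L)" using bij by (simp add: auto_def)
    then have img: "restrict (c s) ?C ` H = H" using char by (simp only: characteristic_subgroup_def)
    have "restrict (c s) ?C h \<in> restrict (c s) ?C ` H" by (rule imageI[OF h])
    then have "restrict (c s) ?C h \<in> H" by (simp only: img)
    moreover have "restrict (c s) ?C h = c s h" using h P(2) by auto
    ultimately show "s \<otimes>\<^bsub>Gam R k E\<^esub> h \<otimes>\<^bsub>Gam R k E\<^esub> inv\<^bsub>Gam R k E\<^esub> s \<in> H"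
      by (simp only: c_def)
  qed
qed

text \<open>The product of a normal subgroup with any subgroup is a subgroup, and \<open>H\<close>
  is normal in \<open>Gam\<close>.\<close>

lemma char_Subgp: "H \<in> Subgp R k E L"
proof -
  interpret I: second_isomorphism_grp H "Gam R k E" "Gam_E R k E"
  proof (intro second_isomorphism_grp.intro second_isomorphism_grp_axioms.intro char_normal)
    show "subgroup (Gam_E R k E) (Gam R k E)"
      unfolding Gam_eq Gam_E_eq by (rule galois_group_subgroup[OF subEh kE EEh])
  qed
  show ?thesis using char_subgroup I.normal_set_mult_subgroup by (simp add: Subgp_def)
qed

text \<open>Under \<open>res\<close> the group \<open>H\<close> corresponds to
  \<open>Gal(N/FL)\<close>, so normality of \<open>H\<close> makes \<open>FL\<close> stable under
  \<open>G\<close>. The restrictions of \<open>G\<close> to \<open>FL\<close> form a finite group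
  with fixed field \<open>L\<close>; Artin's theorem shows at once that \<open>FL/L\<close> is
  Galois and that these restrictions are its whole group.\<close>

lemma eps_galois:
  defines "F \<equiv> eps R k E H"
  shows "galois_extension R L (compositum R F L)"
    and "GL R k E L Mod H \<cong> galois_group R (compositum R F L) L"
proof -
  interpret G: group G by (rule group_G)
  interpret Ga: group "Gam R k E" by (rule group_Gam)
  interpret r: group_hom G "Gam R k E" "res R k E" by (rule res_group_hom)
  note F = eps_subfield[OF char_subgroup, folded F_def]
  note FL = FL_props[OF F]
  let ?M = "compositum R F L"
  let ?Q = "carrier (galois_group R N ?M)"
  have MN: "?M \<subseteq> N" by (rule FL_N[OF F])
  have eta: "res R k E ` ?Q = H"
    using eta_eps[OF char_Subgp] eta_eq[OF F] by (simp add: F_def)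
  have QG: "?Q \<subseteq> carrier G" by (rule galois_group_FL(5)[OF F])
  have Q_iff: "g \<in> ?Q \<longleftrightarrow> res R k E g \<in> H" if "g \<in> carrier G" for g
    using inj_on_image_mem_iff[OF res_inj that QG] by (simp only: eta)
  have conj: "inv\<^bsub>G\<^esub> g \<otimes>\<^bsub>G\<^esub> q \<otimes>\<^bsub>G\<^esub> g \<in> ?Q" if g: "g \<in> carrier G" and q: "q \<in> ?Q" for g q
  proof -
    have qG: "q \<in> carrier G" using q QG by auto
    have "res R k E (inv\<^bsub>G\<^esub> g \<otimes>\<^bsub>G\<^esub> q \<otimes>\<^bsub>G\<^esub> g)
        = inv\<^bsub>Gam R k E\<^esub> (res R k E g) \<otimes>\<^bsub>Gam R k E\<^esub> res R k E q \<otimes>\<^bsub>Gam R k E\<^esub> res R k E g"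
      using g qG by simp
    also have "\<dots> \<in> H"
      using normal.inv_op_closed1[OF char_normal r.hom_closed[OF g]] q Q_iff[OF qG] by simp
    finally show ?thesis using Q_iff g qG by simp
  qed
  have stable: "g x \<in> ?M" if g: "g \<in> carrier G" and x: "x \<in> ?M" for g x
  proof -
    have xN: "x \<in> N" using x MN by auto
    have gx: "g x \<in> N" by (rule galois_groupD(6)[OF g xN])
    have "q (g x) = g x" if q: "q \<in> ?Q" for q
    proof -
      have qG: "q \<in> carrier G" using q QG by auto
      have qgx: "q (g x) \<in> N" by (rule galois_groupD(6)[OF qG gx])
      let ?c = "inv\<^bsub>G\<^esub> g \<otimes>\<^bsub>G\<^esub> q \<otimes>\<^bsub>G\<^esub> g"
      have "x = ?c x" using galois_groupD(5)[OF conj[OF g q] x] by simp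
      also have "\<dots> = (inv\<^bsub>G\<^esub> g) (q (g x))"
        using galois_group_mult[OF G.m_closed[OF G.inv_closed[OF g] qG] g]
          galois_group_mult[OF G.inv_closed[OF g] qG] xN gx by (simp add: compose_def)
      finally have "g x = g ((inv\<^bsub>G\<^esub> g) (q (g x)))" by simp
      then show ?thesis using galois_group_inv(2)[OF N_props(1,3) g qgx] by simp
    qed
    then have "g x \<in> fixed_field N ?Q" using gx by (simp add: fixed_field_def)
    then show ?thesis using galois_group_FL(3)[OF F] by simp
  qed
  define rs where "rs g = restrict g ?M" for g :: "'a \<Rightarrow> 'a"
  have rs_in: "rs g \<in> carrier (galois_group R ?M L)" if g: "g \<in> carrier G" for g
  proof -
    have "g \<in> embeddings L ?M N" by (rule embeddings_subset[OF galois_groupD(1)[OF g] MN])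
    then have emb: "g \<in> embeddings L ?M ?M"
      using stable[OF g] by (auto simp: embeddings_def ring_hom_def)
    have "bij_betw g ?M ?M"
    proof (rule bij_betw_byWitness[where f' = "inv\<^bsub>G\<^esub> g"])
      show "\<forall>a\<in>?M. (inv\<^bsub>G\<^esub> g) (g a) = a" using galois_group_inv(1)[OF N_props(1,3) g] MN by auto
      show "\<forall>a\<in>?M. g ((inv\<^bsub>G\<^esub> g) a) = a" using galois_group_inv(2)[OF N_props(1,3) g] MN by auto
    qed (use stable g in auto)
    then show ?thesis unfolding rs_def by (rule restrict_in_galois_group[OF FL(1,3) emb])
  qed
  have rs_hom: "rs \<in> hom G (galois_group R ?M L)"
  proof (rule homI)
    show "rs g \<in> carrier (galois_group R ?M L)" if "g \<in> carrier G" for g by (rule rs_in[OF that])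
    fix g h assume gh: "g \<in> carrier G" "h \<in> carrier G"
    have "rs g \<otimes>\<^bsub>galois_group R ?M L\<^esub> rs h = compose ?M (rs g) (rs h)"
      by (rule galois_group_mult[OF rs_in[OF gh(1)] rs_in[OF gh(2)]])
    also have "\<dots> = rs (compose N g h)"
      using stable[OF gh(2)] MN by (auto simp: rs_def compose_def restrict_def fun_eq_iff)
    finally show "rs (g \<otimes>\<^bsub>G\<^esub> h) = rs g \<otimes>\<^bsub>galois_group R ?M L\<^esub> rs h"
      using galois_group_mult[OF gh] by simp
  qed
  have grpM: "group (galois_group R ?M L)" by (rule galois_group_is_group[OF FL(1,3)])
  then interpret s: group_hom G "galois_group R ?M L" rs
    using group_G rs_hom by (simp add: group_hom_def group_hom_axioms_def)
  have P: "subgroup (rs ` carrier G) (galois_group R ?M L)" by (rule s.img_is_subgroup)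
  have fin: "finite (rs ` carrier G)"
    using finite_galois_group(1)[OF subL N_props(1) N_props(3) dimN] by simp
  have fixN: "fixed_field N (carrier G) = L"
    by (rule galois_intermediate(4)[OF galN dimN subL order_refl N_props(3)])
  have "fixed_field ?M (rs ` carrier G) = ?M \<inter> fixed_field N (carrier G)"
    using MN by (auto simp: fixed_field_def rs_def)
  then have fixM: "L = fixed_field ?M (rs ` carrier G)" using fixN FL(3) by auto
  show "galois_extension R L ?M" by (rule artin_galois_extension[OF FL(1,3) P fin fixM])
  have onto: "carrier (galois_group R ?M L) = rs ` carrier G"
    by (rule artin_galois_group[OF FL(1,3) P fin fixM])
  have rs_one: "rs g = \<one>\<^bsub>galois_group R ?M L\<^esub> \<longleftrightarrow> g \<in> ?Q" if g: "g \<in> carrier G" for g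
  proof
    assume "rs g = \<one>\<^bsub>galois_group R ?M L\<^esub>"
    then have "rs g x = x" if "x \<in> ?M" for x using that by (simp add: galois_group_one)
    then have "g x = x" if "x \<in> ?M" for x using that by (simp add: rs_def)
    then show "g \<in> ?Q" using g by (auto simp: galois_group_def)
  next
    assume "g \<in> ?Q"
    then show "rs g = \<one>\<^bsub>galois_group R ?M L\<^esub>"
      using galois_groupD(5)[of g N ?M] by (auto simp: galois_group_one rs_def fun_eq_iff)
  qed
  \<comment> \<open>As \<open>res\<close> is injective, restriction to \<open>FL\<close> can be read
    as a map on \<open>GL\<close>; its kernel is then \<open>H\<close> itself instead of
    \<open>Gal(N/FL)\<close>.\<close>
  define \<psi> where "\<psi> u = rs (inv_into (carrier G) (res R k E) u)" for u
  have \<psi>_res: "\<psi> (res R k E g) = rs g" if "g \<in> carrier G" for g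
    using inv_into_f_f[OF res_inj that] by (simp add: \<psi>_def)
  have mult: "x \<otimes>\<^bsub>GL R k E L\<^esub> y = x \<otimes>\<^bsub>Gam R k E\<^esub> y" for x y by (subst GL_eq) simp
  have "\<psi> \<in> hom (GL R k E L) (galois_group R ?M L)"
  proof (rule homI)
    show "\<psi> u \<in> carrier (galois_group R ?M L)" if "u \<in> carrier (GL R k E L)" for u
      using that rs_in \<psi>_res by (auto simp: GL_carrier)
    fix u v assume "u \<in> carrier (GL R k E L)" "v \<in> carrier (GL R k E L)"
    then obtain g h where gh: "g \<in> carrier G" "h \<in> carrier G" "u = res R k E g" "v = res R k E h"
      by (auto simp: GL_carrier)
    have "u \<otimes>\<^bsub>GL R k E L\<^esub> v = res R k E (g \<otimes>\<^bsub>G\<^esub> h)" using gh by (simp add: mult)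
    then have "\<psi> (u \<otimes>\<^bsub>GL R k E L\<^esub> v) = rs (g \<otimes>\<^bsub>G\<^esub> h)"
      using \<psi>_res[OF G.m_closed[OF gh(1,2)]] by (simp only:)
    then show "\<psi> (u \<otimes>\<^bsub>GL R k E L\<^esub> v) = \<psi> u \<otimes>\<^bsub>galois_group R ?M L\<^esub> \<psi> v"
      using gh \<psi>_res by simp
  qed
  then interpret p: group_hom "GL R k E L" "galois_group R ?M L" \<psi>
    using group_GL grpM by (simp add: group_hom_def group_hom_axioms_def)
  have ker: "kernel (GL R k E L) (galois_group R ?M L) \<psi> = H"
  proof
    show "kernel (GL R k E L) (galois_group R ?M L) \<psi> \<subseteq> H"
      using \<psi>_res rs_one Q_iff by (auto simp: kernel_def GL_carrier)
    show "H \<subseteq> kernel (GL R k E L) (galois_group R ?M L) \<psi>"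
    proof
      fix h assume "h \<in> H"
      then obtain g where g: "g \<in> ?Q" "h = res R k E g" using eta by auto
      then have "g \<in> carrier G" using QG by auto
      then show "h \<in> kernel (GL R k E L) (galois_group R ?M L) \<psi>"
        using g \<psi>_res rs_one by (simp add: kernel_def GL_carrier)
    qed
  qed
  have "\<psi> ` carrier (GL R k E L) = carrier (galois_group R ?M L)"
    unfolding onto GL_carrier image_image using \<psi>_res by (intro image_cong) auto
  from p.FactGroup_iso[OF this] show "GL R k E L Mod H \<cong> galois_group R ?M L" unfolding ker .
qed

text \<open>Linear disjointness supplies the equality of the degrees of \<open>E^H\<close> over
  \<open>k\<close> and of its compositum with \<open>L\<close> over \<open>L\<close>, which a
  potentially Galois extension demands in addition to the Galois property.\<close>

lemma eps_pre_galois: "pre_galois_with_group R k (eps R k E H) L (GL R k E L Mod H)"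
proof -
  interpret Ga: group "Gam R k E" by (rule group_Gam)
  let ?F = "eps R k E H"
  note F = eps_subfield[OF char_subgroup]
  obtain a where a: "dimension a k ?F" "dimension a L (compositum R ?F L)"
    using linearly_disjoint_intermediate[OF subk subE subL F(1) kE kL F(2,3) dimE dimN] by metis
  have "H \<lhd> GL R k E L"
    using Ga.normal_restrict_supergroup[OF GL_subgroup char_normal H_props(2)[OF char_subgroup]] GL_eq by simp
  then have "group (GL R k E L Mod H)" by (rule normal.factorgroup_is_group)
  then have "galois_group R (compositum R ?F L) L \<cong> GL R k E L Mod H"
    using group.iso_sym eps_galois(2) by blast
  then show ?thesis
    using a F subk subL kL galL eps_galois(1)
    by (auto simp: pre_galois_with_group_def potentially_galois_with_group_def potentially_galois_def)
qed

end

end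

theorem proposition2p21:
  fixes R :: "('a, 'b) ring_scheme" and k E L :: "'a set"
  assumes "field R"
    and "is_separable_closure R L"
    and "potentially_galois R k E L"
  shows
    "bij_betw (eps R k E) (Subgp R k E L) (Subfld R k E) \<and>
     bij_betw (eta R k E L) (Subfld R k E) (Subgp R k E L) \<and>
     (\<forall>H \<in> Subgp R k E L.
        eps R k E H \<in> Subfld R k E \<and> ring.dimension R (card H) (eps R k E H) E) \<and>
     (\<forall>E' \<in> Subfld R k E.
        subgroup (eta R k E L E') (GL R k E L) \<and>
        subgroup (eta R k E L E' <#>\<^bsub>Gam R k E\<^esub> Gam_E R k E) (Gam R k E) \<and>
        ring.dimension R (card (eta R k E L E')) E' E) \<and>
     (\<forall>E' \<in> Subfld R k E. eps R k E (eta R k E L E') = E') \<and>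
     (\<forall>H \<in> Subgp R k E L. eta R k E L (eps R k E H) = H) \<and>
     (\<forall>H. galois_extension R k L \<and> characteristic_subgroup H (GL R k E L) \<longrightarrow>
        subgroup (H <#>\<^bsub>Gam R k E\<^esub> Gam_E R k E) (Gam R k E) \<and>
        pre_galois_with_group R k (eps R k E H) L (GL R k E L Mod H))"
proof -
  interpret field R by fact
  note d = assms(3)[unfolded potentially_galois_def]
  obtain n where n: "dimension n k E" "dimension n L (compositum R E L)"
    using d by metis
  interpret potentially_galois_field R k E L n
    by (intro potentially_galois_field.intro potentially_galois_field_axioms.intro field_axioms n)
      (simp_all only: d)
  have eps_Subfld: "eps R k E H \<in> Subfld R k E" if "H \<in> Subgp R k E L" for H
    using eps_subfield[OF Subgp_subgroup[OF that]] by (simp add: Subfld_iff)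
  have Subfld: "subfield F R" "k \<subseteq> F" "F \<subseteq> E" if "F \<in> Subfld R k E" for F
    using that by (auto simp: Subfld_iff)
  have eta_Subgp: "eta R k E L F \<in> Subgp R k E L" if "F \<in> Subfld R k E" for F
    by (rule eta_Subgp[OF Subfld[OF that]])
  have eps_eta: "eps R k E (eta R k E L F) = F" if "F \<in> Subfld R k E" for F
    by (rule eps_eta[OF Subfld[OF that]])
  show ?thesis
  proof (intro conjI ballI allI impI)
    have w: "\<forall>H \<in> Subgp R k E L. eta R k E L (eps R k E H) = H"
      "\<forall>F \<in> Subfld R k E. eps R k E (eta R k E L F) = F"
      "eps R k E ` Subgp R k E L \<subseteq> Subfld R k E" "eta R k E L ` Subfld R k E \<subseteq> Subgp R k E L"
      using eta_eps eps_eta eps_Subfld eta_Subgp by blast+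
    show "bij_betw (eps R k E) (Subgp R k E L) (Subfld R k E)"
      by (rule bij_betw_byWitness[OF w])
    show "bij_betw (eta R k E L) (Subfld R k E) (Subgp R k E L)"
      by (rule bij_betw_byWitness[OF w(2,1,4,3)])
    show "subgroup (H <#>\<^bsub>Gam R k E\<^esub> Gam_E R k E) (Gam R k E)"
      "pre_galois_with_group R k (eps R k E H) L (GL R k E L Mod H)"
      if "galois_extension R k L \<and> characteristic_subgroup H (GL R k E L)" for H
    proof -
      have c: "galois_extension R k L" "characteristic_subgroup H (GL R k E L)" using that by auto
      show "subgroup (H <#>\<^bsub>Gam R k E\<^esub> Gam_E R k E) (Gam R k E)"
        using char_Subgp[OF c] by (simp add: Subgp_def)
      show "pre_galois_with_group R k (eps R k E H) L (GL R k E L Mod H)" by (rule eps_pre_galois[OF c])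
    qed
  next
    fix H assume H: "H \<in> Subgp R k E L"
    show "eps R k E H \<in> Subfld R k E" by (rule eps_Subfld[OF H])
    show "dimension (card H) (eps R k E H) E" by (rule eps_dimension[OF H])
    show "eta R k E L (eps R k E H) = H" by (rule eta_eps[OF H])
  next
    fix F assume F: "F \<in> Subfld R k E"
    show "subgroup (eta R k E L F) (GL R k E L)" "subgroup (eta R k E L F <#>\<^bsub>Gam R k E\<^esub> Gam_E R k E) (Gam R k E)"
      using eta_Subgp[OF F] unfolding Subgp_def by blast+
    show "dimension (card (eta R k E L F)) F E" by (rule eta_card(2)[OF Subfld[OF F]])
    show "eps R k E (eta R k E L F) = F" by (rule eps_eta[OF F])
  qed
qed

end
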